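(* Let $w_1=(a_1,\dots,a_k)$ and $w_2=(b_1,\dots,b_l)$ be two non-empty words in even integers such that $b_i\ge a_j+4$ for all $i,j$, and let the word $w$ be a shuffle of $w_1$ and $w_2$. Then $$H(w)\cong H(w_1)\otimes H(w_2),\qquad h(w)=h(w_1)h(w_2).$$
   Context: Fix $q\in\mathbb C^\times$ not a root of unity. $U=U_q\widehat{\mathfrak{sl}}_2$ (level zero) is the unital associative $\mathbb C$-algebra with generators $e_0,e_1,f_0,f_1,K^{\pm1}$ and relations $KK^{-1}=K^{-1}K=1$, $Ke_1K^{-1}=q^2e_1$, $Kf_1K^{-1}=q^{-2}f_1$, $Ke_0K^{-1}=q^{-2}e_0$, $Kf_0K^{-1}=q^{2}f_0$, $[e_1,f_1]=-[e_0,f_0]=\frac{K-K^{-1}}{q-q^{-1}}$, $[e_1,f_0]=[e_0,f_1]=0$, and for $i\neq j$ in $\{0,1\}$: $e_i^3e_j-(q^2+1+q^{-2})e_i^2e_je_i+(q^2+1+q^{-2})e_ie_je_i^2-e_je_i^3=0$ and the same relation with $e$ replaced by $f$. Tensor products of $U$-modules are formed with the coproduct $\Delta(K^{\pm1})=K^{\pm1}\otimes K^{\pm1}$, $\Delta(e_0)=e_0\otimes K^{-1}+1\otimes e_0$, $\Delta(f_0)=f_0\otimes 1+K\otimes f_0$, $\Delta(e_1)=e_1\otimes K+1\otimes e_1$, $\Delta(f_1)=f_1\otimes 1+K^{-1}\otimes f_1$. The trivial module $\mathbb C$ has $e_i,f_i$ acting by $0$ and $K$ by $1$. For $a\in 2\mathbb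 Z$ the two-dimensional evaluation module, denoted simply $a$, has basis $v_+,v_-$ with $Kv_\pm=q^{\pm1}v_\pm$, $e_1v_-=v_+$, $e_1v_+=0$, $f_1v_+=v_-$, $f_1v_-=0$, and $e_0,f_0$ acting as $q^{a}f_1$, $q^{-a}e_1$ respectively. A word $w=(a_1,\dots,a_k)$ is a sequence of even integers, also regarded as the $U$-module $a_1\otimes\cdots\otimes a_k$. Put $H(w)=\mathrm{Hom}_U(\mathbb C,w)$ (a $\mathbb C$-vector space) and $h(w)=\dim H(w)$. A word $w$ is a shuffle of $w_1$ and $w_2$ if $w$ contains $w_1$ as a (not necessarily contiguous) subword and deleting that subword from $w$ leaves $w_2$. *)

theory Defs
  imports
    Complex_Main
    "HOL-Library.Function_Algebras"
    "HOL-Library.Poly_Mapping"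
    "HOL-Algebra.QuotRing"
begin

section \<open>Complex vector spaces\<close>

class complex_vs = ab_group_add +
  fixes scaleC :: "complex \<Rightarrow> 'a \<Rightarrow> 'a" (infixr "*\<^sub>C" 75)
  assumes scaleC_add_right: "c *\<^sub>C (x + y) = c *\<^sub>C x + c *\<^sub>C y"
    and scaleC_add_left: "(c + d) *\<^sub>C x = c *\<^sub>C x + d *\<^sub>C x"
    and scaleC_scaleC: "c *\<^sub>C (d *\<^sub>C x) = (c * d) *\<^sub>C x"
    and scaleC_one: "1 *\<^sub>C x = x"

global_interpretation cvs: vector_space "scaleC :: complex \<Rightarrow> 'a \<Rightarrow> 'a::complex_vs"
  by standard (simp_all add: scaleC_add_right scaleC_add_left scaleC_scaleC scaleC_one)

instantiation complex :: complex_vs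
begin
definition "c *\<^sub>C (z::complex) = c * z"
instance by standard (simp_all add: scaleC_complex_def algebra_simps)
end

instantiation "fun" :: (type, complex_vs) complex_vs
begin
definition "c *\<^sub>C f = (\<lambda>x. c *\<^sub>C f x)"
instance
  by standard
    (simp_all add: scaleC_fun_def fun_eq_iff scaleC_add_right scaleC_add_left scaleC_scaleC scaleC_one)
end

instantiation poly_mapping :: (type, complex_vs) complex_vs
begin
lift_definition scaleC_poly_mapping :: "complex \<Rightarrow> ('a \<Rightarrow>\<^sub>0 'b) \<Rightarrow> 'a \<Rightarrow>\<^sub>0 'b"
  is "\<lambda>c f x. c *\<^sub>C f x"
  by (rule rev_finite_subset) auto
instance
  by standard
    (transfer, simp add: fun_eq_iff scaleC_add_right scaleC_add_left scaleC_scaleC scaleC_one)+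
end

definition linear_on :: "'v::complex_vs set \<Rightarrow> ('v \<Rightarrow> 'w::complex_vs) \<Rightarrow> bool" where
  "linear_on V f \<longleftrightarrow>
     (\<forall>x\<in>V. \<forall>y\<in>V. f (x + y) = f x + f y) \<and> (\<forall>c. \<forall>x\<in>V. f (c *\<^sub>C x) = c *\<^sub>C f x)"

definition vs_iso :: "'v::complex_vs set \<Rightarrow> 'w::complex_vs set \<Rightarrow> bool" (infix "\<cong>\<^sub>C" 50) where
  "V \<cong>\<^sub>C W \<longleftrightarrow> (\<exists>f. linear_on V f \<and> bij_betw f V W)"


section \<open>Tensor products of vector spaces\<close>

definition bilinear_relations :: "(('v::complex_vs \<times> 'w::complex_vs) \<Rightarrow>\<^sub>0 complex) set" where
  "bilinear_relations =
     {Poly_Mapping.single (u + v, w) 1 - Poly_Mapping.single (u, w) 1 - Poly_Mapping.single (v, w) 1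
        |u v w. True} \<union>
     {Poly_Mapping.single (v, w + x) 1 - Poly_Mapping.single (v, w) 1 - Poly_Mapping.single (v, x) 1
        |v w x. True} \<union>
     {Poly_Mapping.single (c *\<^sub>C v, w) 1 - c *\<^sub>C Poly_Mapping.single (v, w) 1 |c v w. True} \<union>
     {Poly_Mapping.single (v, c *\<^sub>C w) 1 - c *\<^sub>C Poly_Mapping.single (v, w) 1 |c v w. True}"

definition tensor_eq ::
  "(('v::complex_vs \<times> 'w::complex_vs) \<Rightarrow>\<^sub>0 complex) \<Rightarrow> (('v \<times> 'w) \<Rightarrow>\<^sub>0 complex) \<Rightarrow> bool" where
  "tensor_eq p r \<longleftrightarrow> p - r \<in> cvs.span bilinear_relations"

lemma equivp_tensor_eq:
  "equivp (tensor_eq :: (('v::complex_vs \<times> 'w::complex_vs) \<Rightarrow>\<^sub>0 complex) \<Rightarrow> _ \<Rightarrow> bool)"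
proof (rule equivpI)
  show "reflp (tensor_eq :: (('v \<times> 'w) \<Rightarrow>\<^sub>0 complex) \<Rightarrow> _ \<Rightarrow> bool)"
    by (simp add: reflp_def tensor_eq_def cvs.span_zero)
  show "symp (tensor_eq :: (('v \<times> 'w) \<Rightarrow>\<^sub>0 complex) \<Rightarrow> _ \<Rightarrow> bool)"
    unfolding symp_def tensor_eq_def by (metis cvs.span_neg minus_diff_eq)
  show "transp (tensor_eq :: (('v \<times> 'w) \<Rightarrow>\<^sub>0 complex) \<Rightarrow> _ \<Rightarrow> bool)"
    unfolding transp_def tensor_eq_def
  proof (intro allI impI)
    fix x y z :: "('v \<times> 'w) \<Rightarrow>\<^sub>0 complex"
    assume "x - y \<in> cvs.span bilinear_relations" "y - z \<in> cvs.span bilinear_relations"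
    from cvs.span_add [OF this] show "x - z \<in> cvs.span bilinear_relations" by simp
  qed
qed

quotient_type (overloaded) ('v, 'w) tensor =
  "('v::complex_vs \<times> 'w::complex_vs) \<Rightarrow>\<^sub>0 complex" / tensor_eq
  by (rule equivp_tensor_eq)

instantiation tensor :: (complex_vs, complex_vs) complex_vs
begin
lift_definition zero_tensor :: "('a, 'b) tensor" is 0 .
lift_definition plus_tensor :: "('a, 'b) tensor \<Rightarrow> ('a, 'b) tensor \<Rightarrow> ('a, 'b) tensor" is "(+)"
  unfolding tensor_eq_def by (subst add_diff_add) (rule cvs.span_add)
lift_definition uminus_tensor :: "('a, 'b) tensor \<Rightarrow> ('a, 'b) tensor" is uminus
  unfolding tensor_eq_def by (subst minus_diff_minus) (rule cvs.span_neg)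
lift_definition minus_tensor :: "('a, 'b) tensor \<Rightarrow> ('a, 'b) tensor \<Rightarrow> ('a, 'b) tensor" is "(-)"
  unfolding tensor_eq_def
proof -
  fix p p' r r' :: "('a \<times> 'b) \<Rightarrow>\<^sub>0 complex"
  assume "p - p' \<in> cvs.span bilinear_relations" "r - r' \<in> cvs.span bilinear_relations"
  from cvs.span_diff [OF this] show "p - r - (p' - r') \<in> cvs.span bilinear_relations"
    by (simp add: algebra_simps)
qed
lift_definition scaleC_tensor :: "complex \<Rightarrow> ('a, 'b) tensor \<Rightarrow> ('a, 'b) tensor" is scaleC
  unfolding tensor_eq_def by (subst cvs.scale_right_diff_distrib [symmetric]) (rule cvs.span_scale)
instance
  by standard
    (transfer, simp add: tensor_eq_def algebra_simps cvs.span_zero scaleC_add_right scaleC_add_left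
       scaleC_scaleC scaleC_one)+
end

lift_definition pure_tensor :: "'v::complex_vs \<Rightarrow> 'w::complex_vs \<Rightarrow> ('v, 'w) tensor"
  is "\<lambda>v w. Poly_Mapping.single (v, w) 1" .

text \<open>
  Over a field the tensor product of subspaces \<open>V\<close> of \<open>'v\<close> and \<open>W\<close> of \<open>'w\<close> embeds into the tensor
  product of the ambient spaces; its image is the span of the pure tensors.
\<close>

definition tensor_product :: "'v::complex_vs set \<Rightarrow> 'w::complex_vs set \<Rightarrow> ('v, 'w) tensor set"
    (infixr "\<otimes>\<^sub>C" 70) where
  "V \<otimes>\<^sub>C W = cvs.span {pure_tensor v w |v w. v \<in> V \<and> w \<in> W}"


section \<open>The algebra $U$\<close>

text \<open>\<open>Kp\<close> and \<open>Km\<close> are $K$ and $K^{-1}$.\<close>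

datatype gen = E0 | E1 | F0 | F1 | Kp | Km

text \<open>Noncommutative monomials: the free monoid on the generators, written additively so that
  \<open>Poly_Mapping\<close> supplies the free associative algebra \<open>free\<close>.\<close>

datatype monomial = Monomial (letters: "gen list")

instantiation monomial :: monoid_add
begin
definition "0 = Monomial []"
definition "m + n = Monomial (letters m @ letters n)"
instance
proof
  fix a b c :: monomial
  show "a + b + c = a + (b + c)" by (simp add: plus_monomial_def)
  show "0 + a = a" "a + 0 = a" by (cases a; simp add: plus_monomial_def zero_monomial_def)+
qed
end

type_synonym free = "monomial \<Rightarrow>\<^sub>0 complex"

definition free_alg :: "free ring" where
  "free_alg = \<lparr>carrier = UNIV, mult = (*), one = 1, zero = 0, add = (+)\<rparr>"

definition word_elt :: "gen list \<Rightarrow> free" where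
  "word_elt xs = Poly_Mapping.single (Monomial xs) 1"

abbreviation gen_elt :: "gen \<Rightarrow> free" where
  "gen_elt g \<equiv> word_elt [g]"

definition commutator :: "'a::ring \<Rightarrow> 'a \<Rightarrow> 'a" where
  "commutator x y = x * y - y * x"

definition serre :: "complex \<Rightarrow> free \<Rightarrow> free \<Rightarrow> free" where
  "serre q x y =
     x ^ 3 * y - (q\<^sup>2 + 1 + inverse q ^ 2) *\<^sub>C (x\<^sup>2 * y * x)
       + (q\<^sup>2 + 1 + inverse q ^ 2) *\<^sub>C (x * y * x\<^sup>2) - y * x ^ 3"

definition relations :: "complex \<Rightarrow> free set" where
  "relations q =
    (let e0 = gen_elt E0; e1 = gen_elt E1; f0 = gen_elt F0; f1 = gen_elt F1;
         k = gen_elt Kp; k' = gen_elt Km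
     in {k * k' - 1, k' * k - 1,
         k * e1 * k' - q\<^sup>2 *\<^sub>C e1, k * f1 * k' - (inverse q ^ 2) *\<^sub>C f1,
         k * e0 * k' - (inverse q ^ 2) *\<^sub>C e0, k * f0 * k' - q\<^sup>2 *\<^sub>C f0,
         commutator e1 f1 - (1 / (q - inverse q)) *\<^sub>C (k - k'),
         - commutator e0 f0 - (1 / (q - inverse q)) *\<^sub>C (k - k'),
         commutator e1 f0, commutator e0 f1,
         serre q e0 e1, serre q e1 e0, serre q f0 f1, serre q f1 f0})"

definition U :: "complex \<Rightarrow> free set ring" where
  "U q = free_alg Quot (Idl\<^bsub>free_alg\<^esub> (relations q))"

definition cls :: "complex \<Rightarrow> free \<Rightarrow> free set" where
  "cls q p = Idl\<^bsub>free_alg\<^esub> (relations q) +>\<^bsub>free_alg\<^esub> p"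


section \<open>Modules over $U$\<close>

record 'v u_module = "'v partial_object" +
  act :: "free set \<Rightarrow> 'v \<Rightarrow> 'v"

definition is_U_module :: "complex \<Rightarrow> 'v::complex_vs u_module \<Rightarrow> bool" where
  "is_U_module q M \<longleftrightarrow>
     cvs.subspace (carrier M) \<and>
     (\<forall>X\<in>carrier (U q). linear_on (carrier M) (act M X) \<and> act M X ` carrier M \<subseteq> carrier M) \<and>
     (\<forall>v\<in>carrier M.
        act M \<one>\<^bsub>U q\<^esub> v = v \<and>
        (\<forall>X\<in>carrier (U q). \<forall>Y\<in>carrier (U q).
           act M (X \<otimes>\<^bsub>U q\<^esub> Y) v = act M X (act M Y v) \<and>
           act M (X \<oplus>\<^bsub>U q\<^esub> Y) v = act M X v + act M Y v) \<and>
        (\<forall>c p. act M (cls q (c *\<^sub>C p)) v = c *\<^sub>C act M (cls q p) v))"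

text \<open>Homomorphisms are normalised to vanish outside the carrier, so that they form a subspace of the
  space of all functions and equal maps on the carrier are equal.\<close>

definition Hom\<^sub>U ::
  "complex \<Rightarrow> 'v::complex_vs u_module \<Rightarrow> 'w::complex_vs u_module \<Rightarrow> ('v \<Rightarrow> 'w) set" where
  "Hom\<^sub>U q M N =
     {\<phi>. linear_on (carrier M) \<phi> \<and> \<phi> ` carrier M \<subseteq> carrier N \<and> (\<forall>v. v \<notin> carrier M \<longrightarrow> \<phi> v = 0) \<and>
         (\<forall>X\<in>carrier (U q). \<forall>v\<in>carrier M. \<phi> (act M X v) = act N X (\<phi> v))}"

definition free_act :: "(gen \<Rightarrow> 'v \<Rightarrow> 'v) \<Rightarrow> free \<Rightarrow> 'v \<Rightarrow> 'v::complex_vs" where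
  "free_act op p v = (\<Sum>m\<in>Poly_Mapping.keys p. Poly_Mapping.lookup p m *\<^sub>C foldr op (letters m) v)"

text \<open>
  The module on \<open>V\<close> in which each generator \<open>g\<close> acts by \<open>op g\<close>. This is meaningful when the
  operators \<open>op g\<close> satisfy the defining relations on \<open>V\<close>; then \<open>free_act op p v\<close> depends only on the
  class of \<open>p\<close>. For the modules used here this is shown in the last section.
\<close>

definition module_of :: "'v set \<Rightarrow> (gen \<Rightarrow> 'v \<Rightarrow> 'v::complex_vs) \<Rightarrow> 'v u_module" where
  "module_of V op = \<lparr>carrier = V, act = (\<lambda>X v. the_elem ((\<lambda>p. free_act op p v) ` X))\<rparr>"

definition triv_op :: "gen \<Rightarrow> 'v \<Rightarrow> 'v::complex_vs" where
  "triv_op g v = (if g \<in> {Kp, Km} then v else 0)"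

definition trivial_module :: "complex u_module" where
  "trivial_module = module_of UNIV triv_op"

datatype sign = Plus | Minus

text \<open>A vector \<open>x Plus\<close>$\,v_+ + {}$\<open>x Minus\<close>$\,v_-$ of the evaluation module is the function \<open>x\<close>.\<close>

fun eval_op :: "complex \<Rightarrow> int \<Rightarrow> gen \<Rightarrow> (sign \<Rightarrow> complex) \<Rightarrow> sign \<Rightarrow> complex" where
  "eval_op q a E1 x = (\<lambda>s. case s of Plus \<Rightarrow> x Minus | Minus \<Rightarrow> 0)"
| "eval_op q a F1 x = (\<lambda>s. case s of Plus \<Rightarrow> 0 | Minus \<Rightarrow> x Plus)"
| "eval_op q a E0 x = (\<lambda>s. case s of Plus \<Rightarrow> 0 | Minus \<Rightarrow> q powi a * x Plus)"
| "eval_op q a F0 x = (\<lambda>s. case s of Plus \<Rightarrow> q powi (- a) * x Minus | Minus \<Rightarrow> 0)"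
| "eval_op q a Kp x = (\<lambda>s. case s of Plus \<Rightarrow> q * x Plus | Minus \<Rightarrow> inverse q * x Minus)"
| "eval_op q a Km x = (\<lambda>s. case s of Plus \<Rightarrow> inverse q * x Plus | Minus \<Rightarrow> q * x Minus)"

definition eval_module :: "complex \<Rightarrow> int \<Rightarrow> (sign \<Rightarrow> complex) u_module" where
  "eval_module q a = module_of UNIV (eval_op q a)"

text \<open>The coproduct of a generator, as a list of pairs \<open>(x, y)\<close> of monomials standing for the sum of
  the $x \otimes y$.\<close>

fun coproduct :: "gen \<Rightarrow> (gen list \<times> gen list) list" where
  "coproduct E0 = [([E0], [Km]), ([], [E0])]"
| "coproduct F0 = [([F0], []), ([Kp], [F0])]"
| "coproduct E1 = [([E1], [Kp]), ([], [E1])]"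
| "coproduct F1 = [([F1], []), ([Km], [F1])]"
| "coproduct Kp = [([Kp], [Kp])]"
| "coproduct Km = [([Km], [Km])]"

text \<open>
  The vectors of a word of length \<open>k\<close> are the functions on sign lists supported on lists of length
  \<open>k\<close>: such an \<open>x\<close> stands for the sum of the $x(s_1 \dots s_k)\, v_{s_1} \otimes \dots \otimes v_{s_k}$.
  Accordingly $\mathbb C^2 \otimes N$ consists of the functions \<open>x\<close> all of whose components
  \<open>\<lambda>t. x (s # t)\<close> lie in \<open>N\<close>.
\<close>

definition tensor_op ::
  "((sign \<Rightarrow> complex) \<Rightarrow> sign \<Rightarrow> complex) \<Rightarrow> ((sign list \<Rightarrow> complex) \<Rightarrow> sign list \<Rightarrow> complex) \<Rightarrow>
   (sign list \<Rightarrow> complex) \<Rightarrow> sign list \<Rightarrow> complex" where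
  "tensor_op A B x = (\<lambda>u. case u of [] \<Rightarrow> 0 | s # t \<Rightarrow> A (\<lambda>s'. B (\<lambda>t'. x (s' # t')) t) s)"

definition tensor_module ::
  "complex \<Rightarrow> (sign \<Rightarrow> complex) u_module \<Rightarrow> (sign list \<Rightarrow> complex) u_module \<Rightarrow>
   (sign list \<Rightarrow> complex) u_module" where
  "tensor_module q M N =
     module_of
       {x. x [] = 0 \<and> (\<forall>s. (\<lambda>t. x (s # t)) \<in> carrier N)}
       (\<lambda>g x. \<Sum>(m, n) \<leftarrow> coproduct g.
          tensor_op (act M (cls q (word_elt m))) (act N (cls q (word_elt n))) x)"

fun word_module :: "complex \<Rightarrow> int list \<Rightarrow> (sign list \<Rightarrow> complex) u_module" where
  "word_module q [] = module_of {x. \<forall>t. t \<noteq> [] \<longrightarrow> x t = 0} triv_op"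
| "word_module q (a # w) = tensor_module q (eval_module q a) (word_module q w)"

definition H :: "complex \<Rightarrow> int list \<Rightarrow> (complex \<Rightarrow> sign list \<Rightarrow> complex) set" where
  "H q w = Hom\<^sub>U q trivial_module (word_module q w)"

definition h :: "complex \<Rightarrow> int list \<Rightarrow> nat" where
  "h q w = cvs.dim (H q w)"


section \<open>Words are modules over $U$\<close>

lemma ring_free_alg: "ring free_alg"
proof (intro ringI abelian_groupI monoidI)
  fix x :: free
  show "\<exists>y\<in>carrier free_alg. y \<oplus>\<^bsub>free_alg\<^esub> x = \<zero>\<^bsub>free_alg\<^esub>"
    by (rule bexI [of _ "- x"]) (simp_all add: free_alg_def)
qed (simp_all add: free_alg_def algebra_simps)

lemma relations_ideal: "ideal (Idl\<^bsub>free_alg\<^esub> (relations q)) free_alg"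
  by (rule ring.genideal_ideal [OF ring_free_alg]) (simp add: free_alg_def)

lemma cls_eq: "cls q p = {i + p |i. i \<in> Idl\<^bsub>free_alg\<^esub> (relations q)}"
  by (auto simp: cls_def a_r_coset_def r_coset_def free_alg_def)

lemma carrier_U: "carrier (U q) = range (cls q)"
  by (auto simp: U_def FactRing_def A_RCOSETS_def RCOSETS_def cls_def a_r_coset_def free_alg_def)

lemma U_one: "\<one>\<^bsub>U q\<^esub> = cls q 1"
  by (simp add: U_def FactRing_def cls_def free_alg_def)

lemma U_mult: "cls q p \<otimes>\<^bsub>U q\<^esub> cls q r = cls q (p * r)"
  using ideal.rcoset_mult_add [OF relations_ideal, of p r q]
  by (simp add: U_def FactRing_def cls_def free_alg_def)

lemma U_add: "cls q p \<oplus>\<^bsub>U q\<^esub> cls q r = cls q (p + r)"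
  using abelian_subgroup.a_rcos_sum [OF abelian_subgroupI3 [OF ideal.axioms(1) [OF relations_ideal] ring.is_abelian_group [OF ring_free_alg]], of p r q]
  by (simp add: U_def FactRing_def cls_def free_alg_def)

lemma free_act_sup:
  assumes "finite S" "Poly_Mapping.keys p \<subseteq> S"
  shows "free_act op p v = (\<Sum>m\<in>S. Poly_Mapping.lookup p m *\<^sub>C foldr op (letters m) v)"
  unfolding free_act_def using assms
  by (intro sum.mono_neutral_left) (auto simp: in_keys_iff)

lemma free_act_add: "free_act op (p + r) v = free_act op p v + free_act op r v"
proof -
  let ?S = "Poly_Mapping.keys p \<union> Poly_Mapping.keys r"
  have "Poly_Mapping.keys (p + r) \<subseteq> ?S" by (rule Poly_Mapping.keys_add)
  then show ?thesis
    by (simp add: free_act_sup [where S = ?S] lookup_add scaleC_add_left sum.distrib)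
qed

lemma lookup_scaleC: "Poly_Mapping.lookup (c *\<^sub>C p) m = c *\<^sub>C Poly_Mapping.lookup p m"
  by transfer simp

lemma free_act_scale: "free_act op (c *\<^sub>C p) v = c *\<^sub>C free_act op p v"
proof -
  have "Poly_Mapping.keys (c *\<^sub>C p) \<subseteq> Poly_Mapping.keys p"
    by (auto simp: in_keys_iff lookup_scaleC)
  then show ?thesis
    by (simp add: free_act_sup [where S = "Poly_Mapping.keys p"] lookup_scaleC scaleC_complex_def
        scaleC_scaleC cvs.scale_sum_right)
qed

lemma free_act_zero: "free_act op 0 v = 0"
  by (simp add: free_act_def)

lemma free_act_minus: "free_act op (- p) v = - free_act op p v"
  using free_act_add [of op p "- p" v] by (simp add: free_act_zero eq_neg_iff_add_eq_0 add.commute)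

lemma free_act_diff: "free_act op (p - r) v = free_act op p v - free_act op r v"
  using free_act_add [of op p "- r" v] by (simp add: free_act_minus)

lemma free_act_word: "free_act op (word_elt xs) v = foldr op xs v"
  by (simp add: free_act_def word_elt_def scaleC_one)

lemma free_act_one: "free_act op 1 v = v"
  using free_act_word [of op "[]" v] by (simp add: word_elt_def zero_monomial_def flip: single_one)

lemma free_act_sum: "free_act op (sum f S) v = (\<Sum>i\<in>S. free_act op (f i) v)"
  by (induction S rule: infinite_finite_induct) (simp_all add: free_act_zero free_act_add)

lemma free_expand: "p = (\<Sum>m\<in>Poly_Mapping.keys p. Poly_Mapping.lookup p m *\<^sub>C word_elt (letters m))"
  for p :: free
proof (rule poly_mapping_eqI)
  fix k
  have "(\<Sum>m\<in>Poly_Mapping.keys p. Poly_Mapping.lookup (Poly_Mapping.lookup p m *\<^sub>C word_elt (letters m)) k)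
     = (\<Sum>m\<in>Poly_Mapping.keys p. if k = m then Poly_Mapping.lookup p m else 0)"
    by (rule sum.cong) (auto simp: lookup_scaleC word_elt_def lookup_single scaleC_complex_def when_def)
  also have "\<dots> = Poly_Mapping.lookup p k" by (auto simp: in_keys_iff)
  finally show "Poly_Mapping.lookup p k = Poly_Mapping.lookup (\<Sum>m\<in>Poly_Mapping.keys p. Poly_Mapping.lookup p m *\<^sub>C word_elt (letters m)) k"
    by (simp add: lookup_sum)
qed

lemma word_mult: "word_elt xs * word_elt ys = word_elt (xs @ ys)"
  by (simp add: word_elt_def mult_single plus_monomial_def)

lemma scaleC_free: "c *\<^sub>C p = Poly_Mapping.single 0 c * p" for p :: free
proof -
  have *: "c *\<^sub>C word_elt xs = Poly_Mapping.single (Monomial xs) c" for c xs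
    by (rule poly_mapping_eqI)
      (simp add: word_elt_def lookup_scaleC lookup_single scaleC_complex_def when_def)
  have "Poly_Mapping.single 0 c * (d *\<^sub>C word_elt xs) = c *\<^sub>C d *\<^sub>C word_elt xs" for d xs
    by (simp only: scaleC_scaleC) (simp add: * mult_single)
  then show ?thesis
    by (subst (1 2) free_expand) (simp add: sum_distrib_left cvs.scale_sum_right)
qed

lemma scaleC_mult_left: "(c *\<^sub>C p) * r = c *\<^sub>C (p * r)" for p r :: free
  by (simp add: scaleC_free mult.assoc)

lemma scaleC_mult_right: "p * (c *\<^sub>C r) = c *\<^sub>C (p * r)" for p r :: free
proof -
  have *: "word_elt xs * Poly_Mapping.single 0 c = Poly_Mapping.single 0 c * word_elt xs" for xs
    by (simp add: word_elt_def mult_single)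
  have "p * Poly_Mapping.single 0 c = (\<Sum>m\<in>Poly_Mapping.keys p. Poly_Mapping.single 0 (Poly_Mapping.lookup p m) * (word_elt (letters m) * Poly_Mapping.single 0 c))"
    by (subst free_expand [of p]) (simp only: sum_distrib_right scaleC_free mult.assoc)
  also have "\<dots> = (\<Sum>m\<in>Poly_Mapping.keys p. Poly_Mapping.single 0 c * (Poly_Mapping.lookup p m *\<^sub>C word_elt (letters m)))"
    by (simp add: * scaleC_free mult_single mult.commute flip: mult.assoc)
  also have "\<dots> = Poly_Mapping.single 0 c * p"
    by (subst (2) free_expand [of p]) (simp only: sum_distrib_left)
  finally have "p * Poly_Mapping.single 0 c = Poly_Mapping.single 0 c * p" .
  then show ?thesis by (simp add: scaleC_free flip: mult.assoc)
qed

locale gen_ops =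
  fixes V :: "'v::complex_vs set" and op :: "gen \<Rightarrow> 'v \<Rightarrow> 'v"
  assumes V: "cvs.subspace V"
    and lin: "linear_on V (op g)"
    and closed: "v \<in> V \<Longrightarrow> op g v \<in> V"
begin

lemma op_simps:
  "v \<in> V \<Longrightarrow> w \<in> V \<Longrightarrow> op g (v + w) = op g v + op g w"
  "v \<in> V \<Longrightarrow> op g (c *\<^sub>C v) = c *\<^sub>C op g v"
  using lin by (auto simp: linear_on_def)

lemma foldr_closed: "v \<in> V \<Longrightarrow> foldr op xs v \<in> V"
  by (induction xs) (auto simp: closed)

lemma foldr_lin:
  "v \<in> V \<Longrightarrow> w \<in> V \<Longrightarrow> foldr op xs (v + w) = foldr op xs v + foldr op xs w"
  "v \<in> V \<Longrightarrow> foldr op xs (c *\<^sub>C v) = c *\<^sub>C foldr op xs v"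
  by (induction xs) (simp_all add: op_simps foldr_closed)

lemma foldr_sum: "(\<And>i. i \<in> S \<Longrightarrow> f i \<in> V) \<Longrightarrow> foldr op xs (sum f S) = (\<Sum>i\<in>S. foldr op xs (f i))"
proof (induction S rule: infinite_finite_induct)
  case (insert x F)
  then show ?case by (simp add: foldr_lin cvs.subspace_sum [OF V])
qed (use foldr_lin(2) [of 0 xs 0] cvs.subspace_0 [OF V] in simp_all)

lemma act_closed: "v \<in> V \<Longrightarrow> free_act op p v \<in> V"
  unfolding free_act_def by (intro cvs.subspace_sum [OF V] cvs.subspace_scale [OF V] foldr_closed)

lemma act_linear: "linear_on V (free_act op p)"
  by (auto simp: linear_on_def free_act_def foldr_lin scaleC_add_right sum.distrib cvs.scale_sum_right scaleC_scaleC mult.commute)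

lemma act_word_mult: "v \<in> V \<Longrightarrow> free_act op (word_elt xs * p) v = foldr op xs (free_act op p v)"
  apply (subst free_expand [of p])
  by (simp add: sum_distrib_left scaleC_mult_right word_mult free_act_sum free_act_scale free_act_word)
     (simp add: free_act_def foldr_sum foldr_lin foldr_closed cvs.subspace_scale [OF V])

lemma act_mult: "v \<in> V \<Longrightarrow> free_act op (p * r) v = free_act op p (free_act op r v)"
  apply (subst free_expand [of p])
  by (simp add: sum_distrib_right scaleC_mult_left free_act_sum free_act_scale act_word_mult)
     (simp add: free_act_def)

lemma act_gen: "free_act op (gen_elt g) v = op g v"
  by (simp add: free_act_word)

end

locale U_ops = gen_ops +
  fixes q :: complex
  assumes rel: "r \<in> relations q \<Longrightarrow> v \<in> V \<Longrightarrow> free_act op r v = 0"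
begin

lemma act_ideal:
  assumes "p \<in> Idl\<^bsub>free_alg\<^esub> (relations q)" "v \<in> V"
  shows "free_act op p v = 0"
proof -
  have "ideal {p. \<forall>v\<in>V. free_act op p v = 0} free_alg"
  proof (rule idealI [OF ring_free_alg])
    have "a_inv free_alg x = - x" for x
      by (rule abelian_group.minus_equality [OF ring.is_abelian_group [OF ring_free_alg]])
        (simp_all add: free_alg_def)
    then have inv: "inv\<^bsub>add_monoid free_alg\<^esub> x = - x" for x
      by (simp add: a_inv_def)
    show "subgroup {p. \<forall>v\<in>V. free_act op p v = 0} (add_monoid free_alg)"
    proof
      fix x assume "x \<in> {p. \<forall>v\<in>V. free_act op p v = 0}"
      then show "inv\<^bsub>add_monoid free_alg\<^esub> x \<in> {p. \<forall>v\<in>V. free_act op p v = 0}"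
        unfolding inv by (simp add: free_act_minus)
    qed (auto simp: free_alg_def free_act_add free_act_zero)
    have z: "free_act op x 0 = 0" for x
      using act_linear [of x] cvs.subspace_0 [OF V] unfolding linear_on_def
      by (metis cvs.scale_zero_left)
    fix a x
    assume "a \<in> {p. \<forall>v\<in>V. free_act op p v = 0}"
    then show "x \<otimes>\<^bsub>free_alg\<^esub> a \<in> {p. \<forall>v\<in>V. free_act op p v = 0}"
        "a \<otimes>\<^bsub>free_alg\<^esub> x \<in> {p. \<forall>v\<in>V. free_act op p v = 0}"
      by (auto simp: free_alg_def act_mult act_closed z)
  qed
  then have "Idl\<^bsub>free_alg\<^esub> (relations q) \<subseteq> {p. \<forall>v\<in>V. free_act op p v = 0}"
    by (rule ring.genideal_minimal [OF ring_free_alg]) (auto simp: rel)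
  with assms show ?thesis by blast
qed

lemma act_cls:
  assumes "v \<in> V"
  shows "act (module_of V op) (cls q p) v = free_act op p v"
proof -
  have "0 \<in> Idl\<^bsub>free_alg\<^esub> (relations q)"
    using additive_subgroup.zero_closed [OF ideal.axioms(1) [OF relations_ideal]]
    by (simp add: free_alg_def)
  then have "p \<in> cls q p"
    unfolding cls_eq by (metis (mono_tags, lifting) add_0 mem_Collect_eq)
  moreover have "free_act op x v = free_act op p v" if "x \<in> cls q p" for x
    using that unfolding cls_eq by (clarsimp simp: free_act_add act_ideal assms)
  ultimately have "(\<lambda>x. free_act op x v) ` cls q p = (\<lambda>_. free_act op p v) ` cls q p"
    by (intro image_cong) blast+
  also have "\<dots> = {free_act op p v}"
    using \<open>p \<in> cls q p\<close> by (rule image_constant)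
  finally have "(\<lambda>x. free_act op x v) ` cls q p = {free_act op p v}" .
  then show ?thesis by (simp add: module_of_def)
qed

lemma carrier_module_of: "carrier (module_of V op) = V"
  by (simp add: module_of_def)

theorem is_U_module: "is_U_module q (module_of V op)"
proof -
  have "linear_on V (act (module_of V op) (cls q p))" for p
    using act_linear [of p] V
    by (simp add: linear_on_def act_cls cvs.subspace_add cvs.subspace_scale)
  moreover have "act (module_of V op) (cls q p) ` V \<subseteq> V" for p
    by (simp add: image_subset_iff act_cls act_closed)
  ultimately show ?thesis
    unfolding is_U_module_def carrier_module_of carrier_U
    by (simp add: V U_one U_mult U_add act_cls act_closed free_act_one act_mult free_act_add free_act_scale)
qed

end


lemma (in gen_ops) rel_iff:
  "(\<forall>r\<in>relations q. \<forall>v\<in>V. free_act op r v = 0) \<longleftrightarrow> (\<forall>v\<in>V.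
     op Kp (op Km v) = v \<and> op Km (op Kp v) = v \<and>
     op Kp (op E1 (op Km v)) = q\<^sup>2 *\<^sub>C op E1 v \<and>
     op Kp (op F1 (op Km v)) = (inverse q ^ 2) *\<^sub>C op F1 v \<and>
     op Kp (op E0 (op Km v)) = (inverse q ^ 2) *\<^sub>C op E0 v \<and>
     op Kp (op F0 (op Km v)) = q\<^sup>2 *\<^sub>C op F0 v \<and>
     op E1 (op F1 v) - op F1 (op E1 v) = (1 / (q - inverse q)) *\<^sub>C (op Kp v - op Km v) \<and>
     op F0 (op E0 v) - op E0 (op F0 v) = (1 / (q - inverse q)) *\<^sub>C (op Kp v - op Km v) \<and>
     op E1 (op F0 v) = op F0 (op E1 v) \<and> op E0 (op F1 v) = op F1 (op E0 v) \<and>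
     (\<forall>(x, y) \<in> {(E0, E1), (E1, E0), (F0, F1), (F1, F0)}.
       op x (op x (op x (op y v))) - (q\<^sup>2 + 1 + inverse q ^ 2) *\<^sub>C op x (op x (op y (op x v)))
       + (q\<^sup>2 + 1 + inverse q ^ 2) *\<^sub>C op x (op y (op x (op x v))) - op y (op x (op x (op x v))) = 0))"
  by (simp add: relations_def Let_def serre_def commutator_def power2_eq_square power3_eq_cube word_mult
      free_act_add free_act_diff free_act_scale free_act_minus free_act_one free_act_word ball_conj_distrib)

lemma eval_U_ops:
  assumes "q \<noteq> 0" "q\<^sup>2 \<noteq> 1"
  shows "U_ops UNIV (eval_op q a) q"
proof -
  interpret gen_ops UNIV "eval_op q a"
  proof
    fix g show "linear_on UNIV (eval_op q a g)"
      by (cases g) (auto simp: linear_on_def fun_eq_iff scaleC_fun_def scaleC_complex_def algebra_simps split: sign.splits)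
  qed simp_all
  have "q - inverse q \<noteq> 0" using assms by (simp add: field_simps power2_eq_square)
  then have "\<forall>r\<in>relations q. \<forall>v\<in>UNIV. free_act (eval_op q a) r v = 0"
    unfolding rel_iff using assms
    by (auto simp: fun_eq_iff scaleC_fun_def scaleC_complex_def power_int_minus field_simps power2_eq_square split: sign.splits)
  then show ?thesis by unfold_locales auto
qed

definition sign_cons :: "(sign list \<Rightarrow> complex) \<Rightarrow> (sign list \<Rightarrow> complex) \<Rightarrow> sign list \<Rightarrow> complex" where
  "sign_cons P M = (\<lambda>u. case u of [] \<Rightarrow> 0 | s # t \<Rightarrow> (case s of Plus \<Rightarrow> P t | Minus \<Rightarrow> M t))"

lemma sign_cons_alg:
  "sign_cons P M + sign_cons P' M' = sign_cons (P + P') (M + M')" "c *\<^sub>C sign_cons P M = sign_cons (c *\<^sub>C P) (c *\<^sub>C M)"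
  "sign_cons P M - sign_cons P' M' = sign_cons (P - P') (M - M')" "sign_cons 0 0 = 0"
  "sign_cons P M = sign_cons P' M' \<longleftrightarrow> P = P' \<and> M = M'"
  by (auto simp: sign_cons_def fun_eq_iff scaleC_fun_def scaleC_complex_def split: list.splits sign.splits)

locale eval_tensor = U_ops V op q for V :: "(sign list \<Rightarrow> complex) set" and op q +
  fixes a :: int
  assumes q: "q \<noteq> 0" "q\<^sup>2 \<noteq> 1"
begin

definition "T = {x. x [] = 0 \<and> (\<forall>s. (\<lambda>t. x (s # t)) \<in> V)}"

definition "opT = (\<lambda>g x. \<Sum>(m, n) \<leftarrow> coproduct g.
          tensor_op (act (eval_module q a) (cls q (word_elt m))) (act (module_of V op) (cls q (word_elt n))) x)"

lemma tensor_module_eq: "tensor_module q (eval_module q a) (module_of V op) = module_of T opT"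
  by (simp add: tensor_module_def T_def opT_def carrier_module_of)

lemma T_iff: "x \<in> T \<longleftrightarrow> (\<exists>P\<in>V. \<exists>M\<in>V. x = sign_cons P M)"
proof
  assume x: "x \<in> T"
  then have "x = sign_cons (\<lambda>t. x (Plus # t)) (\<lambda>t. x (Minus # t))"
    by (auto simp: T_def sign_cons_def fun_eq_iff split: list.splits sign.splits)
  with x show "\<exists>P\<in>V. \<exists>M\<in>V. x = sign_cons P M" unfolding T_def by blast
next
  assume "\<exists>P\<in>V. \<exists>M\<in>V. x = sign_cons P M"
  moreover have "(\<lambda>t. sign_cons P M (s # t)) = (case s of Plus \<Rightarrow> P | Minus \<Rightarrow> M)" for P M s
    by (auto simp: sign_cons_def split: sign.splits)
  ultimately show "x \<in> T" by (auto simp: T_def sign_cons_def split: sign.splits)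
qed

lemma eval_act: "act (eval_module q a) (cls q (word_elt xs)) v = foldr (eval_op q a) xs v"
  using U_ops.act_cls [OF eval_U_ops [OF q], of v a "word_elt xs"] by (simp add: eval_module_def free_act_word)

lemma N_act: "v \<in> V \<Longrightarrow> act (module_of V op) (cls q (word_elt xs)) v = foldr op xs v"
  by (simp add: act_cls free_act_word)

lemma tensor_op_cons:
  assumes "P \<in> V" "M \<in> V"
  shows "tensor_op A (act (module_of V op) (cls q (word_elt n))) (sign_cons P M) =
     (\<lambda>u. case u of [] \<Rightarrow> 0 | s # t \<Rightarrow> A (\<lambda>s'. case s' of Plus \<Rightarrow> foldr op n P t | Minus \<Rightarrow> foldr op n M t) s)"
proof -
  have "(\<lambda>t. sign_cons P M (s # t)) = (case s of Plus \<Rightarrow> P | Minus \<Rightarrow> M)" for s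
    by (auto simp: sign_cons_def split: sign.splits)
  then have "(\<lambda>s. act (module_of V op) (cls q (word_elt n)) (\<lambda>t'. sign_cons P M (s # t')) t)
    = (\<lambda>s. case s of Plus \<Rightarrow> foldr op n P t | Minus \<Rightarrow> foldr op n M t)" for t
    using assms by (auto simp: fun_eq_iff N_act split: sign.splits)
  then show ?thesis unfolding tensor_op_def by (intro ext) (simp split: list.split)
qed

lemma opT:
  assumes "P \<in> V" "M \<in> V"
  shows "opT E0 (sign_cons P M) = sign_cons (op E0 P) ((q powi a) *\<^sub>C op Km P + op E0 M)"
    "opT F0 (sign_cons P M) = sign_cons ((q powi (- a)) *\<^sub>C M + q *\<^sub>C op F0 P) (inverse q *\<^sub>C op F0 M)"
    "opT E1 (sign_cons P M) = sign_cons (op Kp M + op E1 P) (op E1 M)"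
    "opT F1 (sign_cons P M) = sign_cons (inverse q *\<^sub>C op F1 P) (P + q *\<^sub>C op F1 M)"
    "opT Kp (sign_cons P M) = sign_cons (q *\<^sub>C op Kp P) (inverse q *\<^sub>C op Kp M)"
    "opT Km (sign_cons P M) = sign_cons (inverse q *\<^sub>C op Km P) (q *\<^sub>C op Km M)"
  unfolding opT_def
  by (simp_all add: tensor_op_cons [OF assms] eval_act)
    (auto simp: fun_eq_iff sign_cons_def scaleC_fun_def scaleC_complex_def
      split: list.splits sign.splits)

lemma opT_closed: "x \<in> T \<Longrightarrow> opT g x \<in> T"
  unfolding T_iff
  by (cases g) (auto simp: opT sign_cons_alg(5) intro!: closed cvs.subspace_add [OF V] cvs.subspace_scale [OF V])

lemmas sub = cvs.subspace_add [OF V] cvs.subspace_scale [OF V] cvs.subspace_diff [OF V] closed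

lemma ops_T: "gen_ops T opT"
proof
  show "cvs.subspace T"
  proof (rule cvs.subspaceI)
    show "0 \<in> T" unfolding T_iff using cvs.subspace_0 [OF V] sign_cons_alg(4) by metis
    show "x + y \<in> T" if "x \<in> T" "y \<in> T" for x y
      using that sub(1) unfolding T_iff by (metis sign_cons_alg(1))
    show "c *\<^sub>C x \<in> T" if "x \<in> T" for x c
      using that sub(2) unfolding T_iff by (metis sign_cons_alg(2))
  qed
  show "linear_on T (opT g)" for g
    unfolding linear_on_def
    by (cases g) (auto simp: T_iff sign_cons_alg opT sub op_simps scaleC_add_right scaleC_scaleC mult.commute algebra_simps)
qed (rule opT_closed)

lemma rels: "v \<in> V \<Longrightarrow>
     op Kp (op Km v) = v \<and> op Km (op Kp v) = v \<and>
     op Kp (op E1 (op Km v)) = q\<^sup>2 *\<^sub>C op E1 v \<and>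
     op Kp (op F1 (op Km v)) = (inverse q ^ 2) *\<^sub>C op F1 v \<and>
     op Kp (op E0 (op Km v)) = (inverse q ^ 2) *\<^sub>C op E0 v \<and>
     op Kp (op F0 (op Km v)) = q\<^sup>2 *\<^sub>C op F0 v \<and>
     op E1 (op F1 v) - op F1 (op E1 v) = (1 / (q - inverse q)) *\<^sub>C (op Kp v - op Km v) \<and>
     op F0 (op E0 v) - op E0 (op F0 v) = (1 / (q - inverse q)) *\<^sub>C (op Kp v - op Km v) \<and>
     op E1 (op F0 v) = op F0 (op E1 v) \<and> op E0 (op F1 v) = op F1 (op E0 v) \<and>
     (\<forall>(x, y) \<in> {(E0, E1), (E1, E0), (F0, F1), (F1, F0)}.
       op x (op x (op x (op y v))) - (q\<^sup>2 + 1 + inverse q ^ 2) *\<^sub>C op x (op x (op y (op x v)))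
       + (q\<^sup>2 + 1 + inverse q ^ 2) *\<^sub>C op x (op y (op x (op x v))) - op y (op x (op x (op x v))) = 0)"
  using rel_iff [of q] rel by blast

lemma KK: "v \<in> V \<Longrightarrow> op Kp (op Km v) = v" "v \<in> V \<Longrightarrow> op Km (op Kp v) = v"
  using rels by blast+

lemma Kp_move:
  assumes v: "v \<in> V"
  shows "op Kp (op E1 v) = q\<^sup>2 *\<^sub>C op E1 (op Kp v)" "op Kp (op F1 v) = (inverse q ^ 2) *\<^sub>C op F1 (op Kp v)"
    "op Kp (op E0 v) = (inverse q ^ 2) *\<^sub>C op E0 (op Kp v)" "op Kp (op F0 v) = q\<^sup>2 *\<^sub>C op F0 (op Kp v)"
  using rels [OF closed [OF v, of Kp]] KK [OF v] by simp_all

lemma Km_move: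
  assumes v: "v \<in> V"
  shows "op Km (op E1 v) = (inverse q ^ 2) *\<^sub>C op E1 (op Km v)" "op Km (op F1 v) = q\<^sup>2 *\<^sub>C op F1 (op Km v)"
    "op Km (op E0 v) = q\<^sup>2 *\<^sub>C op E0 (op Km v)" "op Km (op F0 v) = (inverse q ^ 2) *\<^sub>C op F0 (op Km v)"
proof -
  have *: "op Km (op g v) = inverse c *\<^sub>C op g (op Km v)" if "op Kp (op g (op Km v)) = c *\<^sub>C op g v" "c \<noteq> 0" for g c
  proof -
    have "op g (op Km v) = c *\<^sub>C op Km (op g v)"
      using arg_cong [OF that(1), of "op Km"] by (simp add: v closed KK op_simps)
    then show ?thesis using that(2) by (simp add: scaleC_scaleC scaleC_one)
  qed
  show "op Km (op E1 v) = (inverse q ^ 2) *\<^sub>C op E1 (op Km v)" "op Km (op F1 v) = q\<^sup>2 *\<^sub>C op F1 (op Km v)"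
    "op Km (op E0 v) = q\<^sup>2 *\<^sub>C op E0 (op Km v)" "op Km (op F0 v) = (inverse q ^ 2) *\<^sub>C op F0 (op Km v)"
    using * [of E1 "q\<^sup>2"] * [of F1 "inverse q ^ 2"] * [of E0 "inverse q ^ 2"] * [of F0 "q\<^sup>2"] rels [OF v] q
    by (simp_all add: power_inverse)
qed

lemma serre': "v \<in> V \<Longrightarrow> (x, y) \<in> {(E0, E1), (E1, E0), (F0, F1), (F1, F0)} \<Longrightarrow>
       op x (op x (op x (op y v))) = (q\<^sup>2 + 1 + inverse q ^ 2) *\<^sub>C op x (op x (op y (op x v)))
       - (q\<^sup>2 + 1 + inverse q ^ 2) *\<^sub>C op x (op y (op x (op x v))) + op y (op x (op x (op x v)))"
  using rels [of v] by (auto simp: algebra_simps)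

lemma op_diff: "v \<in> V \<Longrightarrow> w \<in> V \<Longrightarrow> op g (v - w) = op g v - op g w"
  using op_simps(1) [of "v - w" w g] sub by simp

lemmas NF = opT sign_cons_alg sub op_simps op_diff KK Kp_move Km_move scaleC_scaleC scaleC_add_right cvs.scale_right_diff_distrib scaleC_one

lemma rels1: "v \<in> V \<Longrightarrow> op E1 (op F1 v) = op F1 (op E1 v) + (1 / (q - inverse q)) *\<^sub>C (op Kp v - op Km v)"
  "v \<in> V \<Longrightarrow> op F0 (op E0 v) = op E0 (op F0 v) + (1 / (q - inverse q)) *\<^sub>C (op Kp v - op Km v)"
  "v \<in> V \<Longrightarrow> op E1 (op F0 v) = op F0 (op E1 v)" "v \<in> V \<Longrightarrow> op E0 (op F1 v) = op F1 (op E0 v)"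
  using rels [of v] by (auto simp: algebra_simps)

lemma q': "q * q \<noteq> 1" "q * q - 1 \<noteq> 0" "1 - q * q \<noteq> 0"
  using q by (auto simp: power2_eq_square)

lemmas PT = fun_eq_iff scaleC_fun_def scaleC_complex_def

lemma T_K:
  assumes v: "P \<in> V" "M \<in> V"
  shows "opT Kp (opT Km (sign_cons P M)) = sign_cons P M" "opT Km (opT Kp (sign_cons P M)) = sign_cons P M"
     "opT Kp (opT E1 (opT Km (sign_cons P M))) = q\<^sup>2 *\<^sub>C opT E1 (sign_cons P M)"
     "opT Kp (opT F1 (opT Km (sign_cons P M))) = (inverse q ^ 2) *\<^sub>C opT F1 (sign_cons P M)"
     "opT Kp (opT E0 (opT Km (sign_cons P M))) = (inverse q ^ 2) *\<^sub>C opT E0 (sign_cons P M)"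
     "opT Kp (opT F0 (opT Km (sign_cons P M))) = q\<^sup>2 *\<^sub>C opT F0 (sign_cons P M)"
  using q by (simp_all add: NF v) (simp_all add: PT field_simps power2_eq_square)

lemma T_C:
  assumes v: "P \<in> V" "M \<in> V"
  shows "opT E1 (opT F1 (sign_cons P M)) - opT F1 (opT E1 (sign_cons P M)) = (1 / (q - inverse q)) *\<^sub>C (opT Kp (sign_cons P M) - opT Km (sign_cons P M))"
     "opT F0 (opT E0 (sign_cons P M)) - opT E0 (opT F0 (sign_cons P M)) = (1 / (q - inverse q)) *\<^sub>C (opT Kp (sign_cons P M) - opT Km (sign_cons P M))"
     "opT E1 (opT F0 (sign_cons P M)) = opT F0 (opT E1 (sign_cons P M))" "opT E0 (opT F1 (sign_cons P M)) = opT F1 (opT E0 (sign_cons P M))"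
  using q q' by (simp_all add: NF v rels1) (simp_all add: PT field_simps power2_eq_square power_int_minus)

lemma T_S:
  assumes v: "P \<in> V" "M \<in> V"
   and xy: "(x, y) \<in> {(E0, E1), (E1, E0), (F0, F1), (F1, F0)}"
  shows "opT x (opT x (opT x (opT y (sign_cons P M)))) - (q\<^sup>2 + 1 + inverse q ^ 2) *\<^sub>C opT x (opT x (opT y (opT x (sign_cons P M))))
       + (q\<^sup>2 + 1 + inverse q ^ 2) *\<^sub>C opT x (opT y (opT x (opT x (sign_cons P M)))) - opT y (opT x (opT x (opT x (sign_cons P M)))) = 0"
proof -
  note s = serre' [OF v(1) xy] serre' [OF v(2) xy]
  define r where "r = inverse q"
  have qr: "q * r = 1" "q * (r * z) = z" for z
    using q by (simp_all add: r_def)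
  note r = r_def [symmetric]
  from xy show ?thesis
    apply (elim insertE; clarsimp)
    subgoal using s by (simp_all add: NF v r) (simp add: PT eval_nat_numeral algebra_simps qr)
    subgoal using s by (simp_all add: NF v r) (simp add: PT eval_nat_numeral algebra_simps qr)
    subgoal using s by (simp_all add: NF v r) (simp add: PT eval_nat_numeral algebra_simps qr)
    subgoal using s by (simp_all add: NF v r) (simp add: PT eval_nat_numeral algebra_simps qr)
    done
qed

theorem T_U_ops: "U_ops T opT q"
proof -
  interpret T: gen_ops T opT by (rule ops_T)
  have "\<forall>r\<in>relations q. \<forall>v\<in>T. free_act opT r v = 0"
    unfolding T.rel_iff using T_S by (auto simp: T_iff T_K T_C)
  then show ?thesis by unfold_locales auto
qed

end

lemma triv_U_ops: "cvs.subspace V \<Longrightarrow> U_ops V triv_op q"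
proof -
  assume "cvs.subspace V"
  then interpret gen_ops V triv_op
    by unfold_locales (auto simp: linear_on_def triv_op_def cvs.subspace_0)
  have "\<forall>r\<in>relations q. \<forall>v\<in>V. free_act triv_op r v = 0"
    unfolding rel_iff by (auto simp: triv_op_def)
  then show ?thesis by unfold_locales auto
qed

theorem word_U_ops:
  assumes "q \<noteq> 0" "q\<^sup>2 \<noteq> 1"
  shows "\<exists>V op. U_ops V op q \<and> word_module q w = module_of V op"
proof (induction w)
  case Nil
  have "cvs.subspace {x :: sign list \<Rightarrow> complex. \<forall>t. t \<noteq> [] \<longrightarrow> x t = 0}"
    by (auto simp: cvs.subspace_def scaleC_fun_def scaleC_complex_def)
  from triv_U_ops [OF this] show ?case unfolding word_module.simps by blast
next
  case (Cons a w)
  then obtain V op where *: "U_ops V op q" "word_module q w = module_of V op" by blast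
  interpret eval_tensor V op q a using * assms by (simp add: eval_tensor_def eval_tensor_axioms_def)
  show ?case unfolding word_module.simps *(2) tensor_module_eq using T_U_ops by blast
qed

corollary word_module_is_U_module:
  assumes "q \<noteq> 0" "q\<^sup>2 \<noteq> 1"
  shows "is_U_module q (word_module q w)"
proof -
  obtain V op where "U_ops V op q" "word_module q w = module_of V op"
    using word_U_ops [OF assms] by blast
  then show ?thesis by (simp add: U_ops.is_U_module)
qed

lemma trivial_module_is_U_module: "is_U_module q trivial_module"
  unfolding trivial_module_def
  by (rule U_ops.is_U_module [OF triv_U_ops]) (rule cvs.subspace_UNIV)


end

theory Submission
  imports Defs
begin

text \<open>
  Exchanging two adjacent letters \<open>a\<close> and \<open>b\<close> with $b \neq a \pm 2$ is an isomorphism of modules, so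
  \<open>w\<close> may be replaced by the concatenation of \<open>w1\<close> and \<open>w2\<close>. An invariant \<open>x\<close> of
  $w_1 \otimes w_2$ is a homomorphism from the dual of $w_1$ to $w_2$. A simple subquotient of a word
  is the image of the exchange map from an increasing to a decreasing word in some of its letters,
  and it remembers the sum of these letters. The letters of $w_2$ are too far from those of the dual
  of $w_1$ for a common nontrivial simple subquotient, hence \<open>U\<close> acts trivially on the image of the
  homomorphism; that is, \<open>x\<close> lies in $w_1 \otimes H(w_2)$ and therefore in $H(w_1) \otimes H(w_2)$.
\<close>

section \<open>Explicit operators on words\<close>

text \<open>Words are not semisimple: \<open>a \<otimes> (a + 2)\<close> has the invariant q v_+ v_-
  - v_- v_+ although neither letter has one. So distance 2 must be excluded, and H(w) cannot be read
  off from simple summands; only subquotients are available. They are told apart without a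
  classification: for y of lowest weight -k the vectors e_1^k y and f_0^k y are proportional, and
  their ratio q^{-s} gives the sum s of the k surviving letters. Letters disappear only in pairs of
  difference 2, where an exchange has a kernel and a cokernel. Duality swaps e_1 and f_0, which
  inverts the ratio and costs q^{-2k}; hence a common subquotient needs k differences b - a with
  total 2k, against a total of at least 4k. The image of the sorting map is simple because v_+^n
  generates every increasing word and, dually, v_-^n lies in every nonzero submodule of a decreasing
  word. For the final step x is expanded over a basis of H(w_2): U acts on u \<otimes> v through u
  alone when v is invariant, so linear independence makes all coefficients in w_1 invariant.\<close>

definition level :: "nat \<Rightarrow> (sign list \<Rightarrow> complex) set" where
  "level n = {x. \<forall>t. length t \<noteq> n \<longrightarrow> x t = 0}"

definition component :: "sign \<Rightarrow> (sign list \<Rightarrow> complex) \<Rightarrow> sign list \<Rightarrow> complex" where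
  "component s x = (\<lambda>t. x (s # t))"

text \<open>
  The action on a word module passes through classes in $U$ and is controlled on the carrier only;
  \<open>word_op\<close> is the same action written out for all functions, where \<open>component s x\<close> is the
  coefficient of $v_s$ in the first tensor factor.
\<close>

fun word_op :: "complex \<Rightarrow> int list \<Rightarrow> gen \<Rightarrow> (sign list \<Rightarrow> complex) \<Rightarrow> sign list \<Rightarrow> complex" where
  "word_op q [] g x = triv_op g x"
| "word_op q (a # w) E0 x =
     sign_cons (word_op q w E0 (component Plus x)) ((q powi a) *\<^sub>C word_op q w Km (component Plus x) + word_op q w E0 (component Minus x))"
| "word_op q (a # w) F0 x =
     sign_cons ((q powi (- a)) *\<^sub>C component Minus x + q *\<^sub>C word_op q w F0 (component Plus x)) (inverse q *\<^sub>C word_op q w F0 (component Minus x))"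
| "word_op q (a # w) E1 x =
     sign_cons (word_op q w Kp (component Minus x) + word_op q w E1 (component Plus x)) (word_op q w E1 (component Minus x))"
| "word_op q (a # w) F1 x =
     sign_cons (inverse q *\<^sub>C word_op q w F1 (component Plus x)) (component Plus x + q *\<^sub>C word_op q w F1 (component Minus x))"
| "word_op q (a # w) Kp x = sign_cons (q *\<^sub>C word_op q w Kp (component Plus x)) (inverse q *\<^sub>C word_op q w Kp (component Minus x))"
| "word_op q (a # w) Km x = sign_cons (inverse q *\<^sub>C word_op q w Km (component Plus x)) (q *\<^sub>C word_op q w Km (component Minus x))"

lemma component_sign_cons [simp]: "component Plus (sign_cons P M) = P" "component Minus (sign_cons P M) = M"
  by (simp_all add: component_def sign_cons_def)

lemma component_linear [simp]:
  "component s (x + y) = component s x + component s y" "component s (x - y) = component s x - component s y"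
  "component s (c *\<^sub>C x) = c *\<^sub>C component s x" "component s 0 = 0" "component s (- x) = - component s x"
  by (simp_all add: component_def scaleC_fun_def fun_eq_iff)

lemma subspace_level: "cvs.subspace (level n)"
  by (auto simp: cvs.subspace_def level_def scaleC_fun_def scaleC_complex_def)

lemma level_alg [intro, simp]:
  "0 \<in> level n" "x \<in> level n \<Longrightarrow> y \<in> level n \<Longrightarrow> x + y \<in> level n" "x \<in> level n \<Longrightarrow> y \<in> level n \<Longrightarrow> x - y \<in> level n"
  "x \<in> level n \<Longrightarrow> c *\<^sub>C x \<in> level n"
  using subspace_level by (auto simp: cvs.subspace_0 cvs.subspace_add cvs.subspace_diff cvs.subspace_scale)

lemma component_level [intro, simp]: "x \<in> level (Suc n) \<Longrightarrow> component s x \<in> level n"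
  by (auto simp: component_def level_def)

lemma sign_cons_level [simp]: "sign_cons P M \<in> level (Suc n) \<longleftrightarrow> P \<in> level n \<and> M \<in> level n"
proof
  assume "sign_cons P M \<in> level (Suc n)"
  from component_level [OF this, of Plus] component_level [OF this, of Minus] show "P \<in> level n \<and> M \<in> level n" by simp
qed (auto simp: sign_cons_def level_def split: list.splits sign.splits)

lemma sign_cons_component: "x \<in> level (Suc n) \<Longrightarrow> sign_cons (component Plus x) (component Minus x) = x"
  by (auto simp: sign_cons_def level_def component_def fun_eq_iff split: list.splits sign.splits)

lemma level_Suc_cases:
  assumes "x \<in> level (Suc n)"
  obtains P M where "P \<in> level n" "M \<in> level n" "x = sign_cons P M"
  using assms sign_cons_component [OF assms] by (metis component_level)

lemma level_0_iff: "x \<in> level 0 \<longleftrightarrow> (\<exists>c. x = (\<lambda>t. if t = [] then c else 0))"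
  by (auto simp: level_def fun_eq_iff)

lemma triv_op_linear: "triv_op g (x + y) = triv_op g x + triv_op g y" "triv_op g (c *\<^sub>C x) = c *\<^sub>C triv_op g x"
  by (auto simp: triv_op_def)

lemma word_op_add: "word_op q w g (x + y) = word_op q w g x + word_op q w g y"
  apply (induction w arbitrary: g x y)
  subgoal by (simp add: triv_op_linear)
  subgoal for a w g x y by (cases g) (simp_all add: sign_cons_alg scaleC_add_right ac_simps)
  done

lemma word_op_scale: "word_op q w g (c *\<^sub>C x) = c *\<^sub>C word_op q w g x"
  apply (induction w arbitrary: g x)
  subgoal by (simp add: triv_op_linear)
  subgoal for a w g x by (cases g) (simp_all add: sign_cons_alg scaleC_add_right scaleC_scaleC ac_simps)
  done

lemma word_op_zero [simp]: "word_op q w g 0 = 0"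
  using word_op_scale [of q w g 0 0] by simp

lemma word_op_minus: "word_op q w g (- x) = - word_op q w g x"
  using word_op_scale [of q w g "-1" x] by (simp add: cvs.scale_minus_left scaleC_one)

lemma word_op_diff: "word_op q w g (x - y) = word_op q w g x - word_op q w g y"
  using word_op_add [of q w g x "- y"] by (simp add: word_op_minus)

lemmas word_op_lin = word_op_add word_op_scale word_op_diff word_op_minus

lemma word_op_level [simp]: "x \<in> level (length w) \<Longrightarrow> word_op q w g x \<in> level (length w)"
proof (induction w arbitrary: g x)
  case Nil
  then show ?case by (auto simp: triv_op_def)
next
  case (Cons a w)
  then have "component s x \<in> level (length w)" for s by simp
  with Cons.IH show ?case by (cases g) (simp_all)
qed

lemma free_act_cong:
  assumes "gen_ops V op" "\<And>g x. x \<in> V \<Longrightarrow> op' g x = op g x" "v \<in> V"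
  shows "free_act op' p v = free_act op p v"
proof -
  interpret gen_ops V op by fact
  have "foldr op' xs v = foldr op xs v" for xs
    by (induction xs) (auto simp: assms foldr_closed)
  then show ?thesis by (simp add: free_act_def)
qed

lemma U_ops_cong:
  assumes "U_ops V op q" "\<And>g x. x \<in> V \<Longrightarrow> op' g x = op g x"
  shows "U_ops V op' q"
proof -
  interpret U_ops V op q by fact
  have *: "linear_on V (op' g)" for g
    using lin [of g] V assms(2) by (simp add: linear_on_def cvs.subspace_add cvs.subspace_scale)
  show ?thesis
    by unfold_locales (use V closed assms(2) * rel free_act_cong [OF gen_ops_axioms assms(2)] in simp_all)
qed

text \<open>The bridge from the quotient algebra to explicit formulas. The recursive definition of
  \<open>word_module\<close> produces operators \<open>op\<close> through \<open>act\<close> on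
  classes; these are only known to agree with \<open>word_op\<close> on the level, hence the
  existential and the restricted equality.\<close>

lemma word_module_word_op:
  assumes "q \<noteq> 0" "q\<^sup>2 \<noteq> 1"
  shows "\<exists>op. U_ops (level (length w)) op q \<and> word_module q w = module_of (level (length w)) op \<and>
     (\<forall>g. \<forall>x\<in>level (length w). word_op q w g x = op g x)"
proof (induction w)
  case Nil
  have "{x :: sign list \<Rightarrow> complex. \<forall>t. t \<noteq> [] \<longrightarrow> x t = 0} = level 0" by (auto simp: level_def)
  with triv_U_ops [OF subspace_level [of 0]] show ?case by (auto intro!: exI [of _ triv_op])
next
  case (Cons a w)
  then obtain op where *: "U_ops (level (length w)) op q" "word_module q w = module_of (level (length w)) op"
     "\<And>g x. x\<in>level (length w) \<Longrightarrow> word_op q w g x = op g x" by blast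
  interpret eval_tensor "level (length w)" op q a using * assms by (simp add: eval_tensor_def eval_tensor_axioms_def)
  have T: "T = level (length (a # w))"
  proof (intro equalityI subsetI)
    show "x \<in> level (length (a # w))" if "x \<in> T" for x
      using that unfolding T_iff by auto
    show "x \<in> T" if "x \<in> level (length (a # w))" for x
      using that unfolding T_iff length_Cons by (elim level_Suc_cases) blast
  qed
  have "word_op q (a # w) g x = opT g x" if "x \<in> level (length (a # w))" for g x
  proof -
    from that obtain P M where "P \<in> level (length w)" "M \<in> level (length w)" "x = sign_cons P M"
      unfolding length_Cons by (elim level_Suc_cases)
    then show ?thesis by (cases g) (simp_all add: opT *(3))
  qed
  then show ?case unfolding word_module.simps *(2) tensor_module_eq using T_U_ops T by auto
qed

lemma word_op_U_ops:
  assumes "q \<noteq> 0" "q\<^sup>2 \<noteq> 1"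
  shows "U_ops (level (length w)) (word_op q w) q"
  using word_module_word_op [OF assms, of w] U_ops_cong by metis

lemma carrier_word_module:
  assumes "q \<noteq> 0" "q\<^sup>2 \<noteq> 1"
  shows "carrier (word_module q w) = level (length w)"
  using word_module_word_op [OF assms, of w] U_ops.carrier_module_of by metis

lemma act_word_module:
  assumes "q \<noteq> 0" "q\<^sup>2 \<noteq> 1" "x \<in> level (length w)"
  shows "act (word_module q w) (cls q p) x = free_act (word_op q w) p x"
proof -
  obtain op where *: "U_ops (level (length w)) op q" "word_module q w = module_of (level (length w)) op"
     "\<And>g x. x\<in>level (length w) \<Longrightarrow> word_op q w g x = op g x" using word_module_word_op [OF assms(1,2), of w] by blast
  interpret U_ops "level (length w)" op q by fact
  show ?thesis using *(2) free_act_cong [OF gen_ops_axioms *(3) assms(3)] act_cls [OF assms(3)] by simp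
qed

section \<open>Invariants as explicit vectors\<close>

definition invariants :: "complex \<Rightarrow> int list \<Rightarrow> (sign list \<Rightarrow> complex) set" where
  "invariants q w = {x \<in> level (length w). \<forall>g. word_op q w g x = triv_op g x}"

lemma subspace_invariants: "cvs.subspace (invariants q w)"
  by (auto simp: cvs.subspace_def invariants_def word_op_lin triv_op_linear) (simp_all add: triv_op_def)

lemma linear_on_complex:
  assumes "linear_on UNIV (\<phi> :: complex \<Rightarrow> 'v::complex_vs)"
  shows "\<phi> c = c *\<^sub>C \<phi> 1"
proof -
  have "\<phi> (c *\<^sub>C 1) = c *\<^sub>C \<phi> 1" using assms unfolding linear_on_def by blast
  then show ?thesis by (simp add: scaleC_complex_def)
qed

text \<open>A homomorphism out of the trivial module is its value at 1. Conversely, compatibility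
  with generators passes to monomials and, by linearity, to the whole algebra.\<close>

lemma H_iff:
  assumes "q \<noteq> 0" "q\<^sup>2 \<noteq> 1"
  shows "\<phi> \<in> H q w \<longleftrightarrow> \<phi> 1 \<in> invariants q w \<and> (\<forall>c. \<phi> c = c *\<^sub>C \<phi> 1)"
proof -
  interpret t: U_ops UNIV triv_op q by (rule triv_U_ops [OF cvs.subspace_UNIV])
  have tc: "carrier trivial_module = UNIV" by (simp add: trivial_module_def module_of_def)
  have ta: "act trivial_module (cls q p) c = free_act triv_op p c" for p c
    unfolding trivial_module_def by (simp add: t.act_cls)
  show ?thesis
  proof
    assume "\<phi> \<in> H q w"
    then have l: "linear_on UNIV \<phi>" and r: "range \<phi> \<subseteq> level (length w)"
      and e: "\<And>p c. \<phi> (free_act triv_op p c) = act (word_module q w) (cls q p) (\<phi> c)"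
      unfolding H_def Hom\<^sub>U_def by (auto simp: tc carrier_U ta carrier_word_module [OF assms])
    have s: "\<phi> c = c *\<^sub>C \<phi> 1" for c using linear_on_complex [OF l] .
    have "word_op q w g (\<phi> 1) = triv_op g (\<phi> 1)" for g
      using e [of "gen_elt g" 1] r s [of 0]
      by (cases g) (simp_all add: act_word_module assms free_act_word image_subset_iff triv_op_def)
    then have "\<phi> 1 \<in> invariants q w" unfolding invariants_def using r by auto
    with s show "\<phi> 1 \<in> invariants q w \<and> (\<forall>c. \<phi> c = c *\<^sub>C \<phi> 1)" by blast
  next
    assume a: "\<phi> 1 \<in> invariants q w \<and> (\<forall>c. \<phi> c = c *\<^sub>C \<phi> 1)"
    then have s: "\<phi> c = c *\<^sub>C \<phi> 1" for c by blast
    have i: "\<phi> c \<in> invariants q w" for c using a cvs.subspace_scale [OF subspace_invariants] s by metis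
    have l: "\<phi> (c + d) = \<phi> c + \<phi> d" "\<phi> (c *\<^sub>C d) = c *\<^sub>C \<phi> d" for c d
      by (subst (1 2 3) s, simp add: scaleC_add_left) (subst (1 2) s, simp add: scaleC_scaleC scaleC_complex_def)
    have p0: "\<phi> 0 = 0" using s [of 0] by (metis cvs.scale_zero_left)
    have tr: "word_op q w g (\<phi> y) = \<phi> (triv_op g y)" for g y
    proof -
      have "word_op q w g (\<phi> y) = triv_op g (\<phi> y)" using i [of y] unfolding invariants_def by blast
      also have "\<dots> = \<phi> (triv_op g y)" by (simp add: triv_op_def p0)
      finally show ?thesis .
    qed
    have f: "foldr (word_op q w) xs (\<phi> c) = \<phi> (foldr triv_op xs c)" for xs c
      by (induction xs) (simp_all only: foldr.simps o_apply id_apply tr)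
    have fs: "\<phi> (sum f S) = (\<Sum>i\<in>S. \<phi> (f i))" for f and S :: "monomial set"
      by (induction S rule: infinite_finite_induct) (simp_all add: l p0)
    have "free_act (word_op q w) p (\<phi> c) = \<phi> (free_act triv_op p c)" for p c
      by (simp add: free_act_def f fs l)
    then show "\<phi> \<in> H q w"
      unfolding H_def Hom\<^sub>U_def using i l
      by (auto simp: tc carrier_U ta carrier_word_module [OF assms] linear_on_def act_word_module [OF assms] invariants_def)
  qed
qed

section \<open>Exchanging adjacent letters\<close>

lemma uminus_level [simp]: "x \<in> level n \<Longrightarrow> - x \<in> level n"
  by (simp add: level_def)

lemma sign_cons_eq_0: "sign_cons P M = 0 \<longleftrightarrow> P = 0 \<and> M = 0"
  using sign_cons_alg(4,5) by metis

locale generic_q =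
  fixes q :: complex
  assumes q0: "q \<noteq> 0" and not_root: "n > 0 \<Longrightarrow> q ^ n \<noteq> 1"
begin

lemma q2: "q\<^sup>2 \<noteq> 1"
  using not_root [of 2] by simp

text \<open>The form in which "not a root of unity" is mostly used: weights and sums of letters can
  be recovered from the powers of q that they produce.\<close>

lemma powi_eq_1_iff: "q powi i = 1 \<longleftrightarrow> i = 0"
proof
  assume *: "q powi i = 1"
  show "i = 0"
  proof (rule ccontr)
    assume "i \<noteq> 0"
    then have "nat \<bar>i\<bar> > 0" by simp
    moreover from * have "q ^ nat \<bar>i\<bar> = 1"
      using q0 by (cases "i \<ge> 0") (auto simp: power_int_def power_inverse)
    ultimately show False using not_root by blast
  qed
qed simp

lemma powi_eq_iff: "q powi i = q powi j \<longleftrightarrow> i = j"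
proof
  assume "q powi i = q powi j"
  then have "q powi (i - j) = 1" using q0 by (simp add: power_int_diff)
  then show "i = j" using powi_eq_1_iff by auto
qed simp

text \<open>
  The intertwiner $a \otimes b \otimes N \to b \otimes a \otimes N$ is fixed up to a scalar by
  compatibility with $e_1$ and $f_0$. In this normalisation it is invertible unless $b = a \pm 2$,
  and for $b = a + 2$ its kernel and cokernel are spanned by the invariants of $a \otimes (a + 2)$
  and the coinvariants of $(a + 2) \otimes a$.
\<close>

definition Rmat :: "int \<Rightarrow> int \<Rightarrow> (sign list \<Rightarrow> complex) \<Rightarrow> sign list \<Rightarrow> complex" where
  "Rmat a b x =
    (let A = q powi a; B = q powi b;
         pp = component Plus (component Plus x); pm = component Minus (component Plus x); mp = component Plus (component Minus x); mm = component Minus (component Minus x)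
     in sign_cons
          (sign_cons ((A - q\<^sup>2 * B) *\<^sub>C pp) (((1 - q\<^sup>2) * A) *\<^sub>C pm + (q * (A - B)) *\<^sub>C mp))
          (sign_cons ((q * (A - B)) *\<^sub>C pm + ((1 - q\<^sup>2) * B) *\<^sub>C mp) ((A - q\<^sup>2 * B) *\<^sub>C mm)))"

text \<open>In every term at most one generator acts on \<open>w\<close>, and no two of them get
  composed; the identity is therefore a comparison of scalars for the first two letters.\<close>

lemma Rmat_word_op: "Rmat a b (word_op q (a # b # w) g x) = word_op q (b # a # w) g (Rmat a b x)"
proof -
  have A: "q powi a \<noteq> 0" "q powi b \<noteq> 0" using q0 by simp_all
  show ?thesis
    apply (cases g)
    using q0 A
    apply (simp_all add: Rmat_def Let_def word_op_lin sign_cons_alg)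
    apply (simp_all add: fun_eq_iff scaleC_fun_def scaleC_complex_def power_int_minus field_simps power2_eq_square)
    done
qed

text \<open>The vector (q v_+ v_- - v_- v_+) \<otimes> y.\<close>

definition singlet :: "(sign list \<Rightarrow> complex) \<Rightarrow> sign list \<Rightarrow> complex" where
  "singlet y = sign_cons (sign_cons 0 (q *\<^sub>C y)) (sign_cons (- y) 0)"

text \<open>The functional dual to the singlet, applied to the first two letters.\<close>

definition cosinglet :: "(sign list \<Rightarrow> complex) \<Rightarrow> sign list \<Rightarrow> complex" where
  "cosinglet x = q *\<^sub>C component Minus (component Plus x) - component Plus (component Minus x)"

text \<open>The combination q v_+ v_- - v_- v_+ is killed by e_1 and f_1 for any letters. In
  \<open>a \<otimes> b\<close> the generator e_0 sends it to (q^{a+2} - q^b) v_- v_-, which forces b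
  = a + 2.\<close>

lemma singlet_word_op: "singlet (word_op q w g y) = word_op q (a # (a + 2) # w) g (singlet y)"
proof -
  have A: "q powi a \<noteq> 0" using q0 by simp
  show ?thesis
    apply (cases g)
    using q0 A
    apply (simp_all add: singlet_def word_op_lin sign_cons_alg)
    apply (simp_all add: fun_eq_iff scaleC_fun_def scaleC_complex_def power_int_minus power_int_add power_int_diff field_simps power2_eq_square)
    done
qed

lemma cosinglet_word_op: "cosinglet (word_op q ((a + 2) # a # w) g x) = word_op q w g (cosinglet x)"
proof -
  have A: "q powi a \<noteq> 0" using q0 by simp
  show ?thesis
    apply (cases g)
    using q0 A
    apply (simp_all add: cosinglet_def word_op_lin sign_cons_alg)
    apply (simp_all add: fun_eq_iff scaleC_fun_def scaleC_complex_def power_int_minus power_int_add power_int_diff field_simps power2_eq_square)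
    done
qed

section \<open>Module maps between words\<close>

definition intertwiner :: "int list \<Rightarrow> int list \<Rightarrow> ((sign list \<Rightarrow> complex) \<Rightarrow> sign list \<Rightarrow> complex) \<Rightarrow> bool" where
  "intertwiner w w' T \<longleftrightarrow> (\<forall>x y. T (x + y) = T x + T y) \<and> (\<forall>c x. T (c *\<^sub>C x) = c *\<^sub>C T x) \<and>
     (\<forall>x\<in>level (length w). T x \<in> level (length w')) \<and> (\<forall>g. \<forall>x\<in>level (length w). T (word_op q w g x) = word_op q w' g (T x))"

lemma intertwD:
  assumes "intertwiner w w' T"
  shows "T (x + y) = T x + T y" "T (c *\<^sub>C x) = c *\<^sub>C T x" "T (x - y) = T x - T y" "T 0 = 0"
    "x \<in> level (length w) \<Longrightarrow> T x \<in> level (length w')" "x \<in> level (length w) \<Longrightarrow> T (word_op q w g x) = word_op q w' g (T x)"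
proof -
  show a: "T (x + y) = T x + T y" and c: "T (c *\<^sub>C x) = c *\<^sub>C T x" for x y c using assms by (auto simp: intertwiner_def)
  have "T (x + (-1) *\<^sub>C y) = T x - T y"
    unfolding a c by (simp add: cvs.scale_minus_left scaleC_one)
  then show "T (x - y) = T x - T y" by (simp add: cvs.scale_minus_left scaleC_one)
  show "T 0 = 0" using c [of 0 0] by simp
qed (use assms in \<open>auto simp: intertwiner_def\<close>)

definition lift_op :: "((sign list \<Rightarrow> complex) \<Rightarrow> sign list \<Rightarrow> complex) \<Rightarrow> (sign list \<Rightarrow> complex) \<Rightarrow> sign list \<Rightarrow> complex" where
  "lift_op T x = sign_cons (T (component Plus x)) (T (component Minus x))"

lemma intertwiner_zero: "intertwiner w w' (\<lambda>_. 0)"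
  by (simp add: intertwiner_def)

lemma intertwiner_id: "intertwiner w w (\<lambda>x. x)"
  by (simp add: intertwiner_def)

lemma intertwiner_comp: "intertwiner w w' T \<Longrightarrow> intertwiner w' w'' T' \<Longrightarrow> intertwiner w w'' (\<lambda>x. T' (T x))"
  by (simp add: intertwiner_def)

text \<open>The map 1 \<otimes> T: the coproduct acts on the second factor through generators, and T
  commutes with all of them, including K.\<close>

lemma intertwiner_lift:
  assumes "intertwiner w w' T"
  shows "intertwiner (a # w) (a # w') (lift_op T)"
proof -
  note T = intertwD [OF assms]
  have "lift_op T (word_op q (a # w) g x) = word_op q (a # w') g (lift_op T x)" if "x \<in> level (length (a # w))" for g x
  proof -
    have "component s x \<in> level (length w)" for s using that by simp
    then show ?thesis by (cases g) (simp_all add: lift_op_def T)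
  qed
  moreover have "lift_op T x \<in> level (length (a # w'))" if "x \<in> level (length (a # w))" for x
    using that by (simp add: lift_op_def T)
  ultimately show ?thesis
    unfolding intertwiner_def by (simp add: lift_op_def T sign_cons_alg)
qed

lemma intertwiner_Rmat: "intertwiner (a # b # w) (b # a # w) (Rmat a b)"
  unfolding intertwiner_def
  by (intro conjI allI ballI Rmat_word_op)
    (simp_all add: Rmat_def Let_def sign_cons_alg scaleC_add_right scaleC_scaleC ac_simps)

lemma intertwiner_singlet: "intertwiner w (a # (a + 2) # w) singlet"
  unfolding intertwiner_def
  by (intro conjI allI ballI singlet_word_op)
    (simp_all add: singlet_def sign_cons_alg scaleC_add_right scaleC_scaleC ac_simps cvs.scale_minus_right uminus_level)

lemma intertwiner_cosinglet: "intertwiner ((a + 2) # a # w) w cosinglet"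
  unfolding intertwiner_def
  by (intro conjI allI ballI cosinglet_word_op)
    (simp_all add: cosinglet_def algebra_simps scaleC_add_right scaleC_scaleC cvs.scale_right_diff_distrib)

text \<open>The scalar is the product of the two eigenvalues on v_+ v_+; it vanishes exactly for b =
  a + 2 and b = a - 2.\<close>

lemma Rmat_inverse:
  assumes "x \<in> level (Suc (Suc n))"
  shows "Rmat b a (Rmat a b x) = ((q powi a - q\<^sup>2 * q powi b) * (q powi b - q\<^sup>2 * q powi a)) *\<^sub>C x"
proof -
  obtain P M where "P \<in> level (Suc n)" "M \<in> level (Suc n)" "x = sign_cons P M" using assms by (rule level_Suc_cases)
  moreover obtain pp pm where "P = sign_cons pp pm" using \<open>P \<in> level (Suc n)\<close> by (rule level_Suc_cases)
  moreover obtain mp mm where "M = sign_cons mp mm" using \<open>M \<in> level (Suc n)\<close> by (rule level_Suc_cases)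
  ultimately show ?thesis
    by (simp add: Rmat_def Let_def sign_cons_alg)
       (simp add: fun_eq_iff scaleC_fun_def scaleC_complex_def algebra_simps power2_eq_square)
qed

lemma rho_nonzero: "b \<noteq> a - 2 \<Longrightarrow> q powi a - q\<^sup>2 * q powi b \<noteq> 0"
proof -
  assume "b \<noteq> a - 2"
  then have "q powi a \<noteq> q powi (b + 2)" unfolding powi_eq_iff by simp
  then show ?thesis using q0 by (simp add: power_int_add mult.commute)
qed

text \<open>For b = a + 2 the block on v_+ v_- and v_- v_+ has rank one: its rows are proportional
  to (1, q), so the kernel is given by \<open>pm = - q mp\<close>. The outer entries stay
  invertible.\<close>

lemma Rmat_kernel:
  assumes "x \<in> level (Suc (Suc n))" "Rmat a (a + 2) x = 0"
  shows "\<exists>y\<in>level n. x = singlet y"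
proof -
  obtain P M where x: "P \<in> level (Suc n)" "M \<in> level (Suc n)" "x = sign_cons P M" using assms(1) by (rule level_Suc_cases)
  obtain pp pm where P: "P = sign_cons pp pm" using x(1) by (rule level_Suc_cases)
  obtain mp mm where M: "M = sign_cons mp mm" "mp \<in> level n" using x(2) by (rule level_Suc_cases)
  have B: "q powi (a + 2) = q\<^sup>2 * q powi a" using q0 by (simp add: power_int_add)
  have A: "q powi a - q\<^sup>2 * q powi (a + 2) \<noteq> 0" by (rule rho_nonzero) simp
  from assms(2) have z: "(q powi a - q\<^sup>2 * q powi (a + 2)) *\<^sub>C pp = 0" "(q powi a - q\<^sup>2 * q powi (a + 2)) *\<^sub>C mm = 0"
     "((1 - q\<^sup>2) * q powi a) *\<^sub>C pm + (q * (q powi a - q powi (a + 2))) *\<^sub>C mp = 0"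
    unfolding x(3) P M(1) by (simp_all only: Rmat_def Let_def component_sign_cons sign_cons_eq_0)
  have "((1 - q\<^sup>2) * q powi a) *\<^sub>C (pm + q *\<^sub>C mp) = 0"
    using z(3) by (simp add: B scaleC_add_right scaleC_scaleC algebra_simps)
  then have "pm = - (q *\<^sub>C mp)" using q0 q2 by (simp add: eq_neg_iff_add_eq_0)
  moreover have "pp = 0" "mm = 0" using z(1,2) A by simp_all
  ultimately have "x = singlet (- mp)" by (simp add: x(3) P M singlet_def cvs.scale_minus_right)
  then show ?thesis using M(2) by (metis uminus_level)
qed

lemma Rmat_image:
  assumes "x \<in> level (Suc (Suc n))" "cosinglet x = 0"
  shows "\<exists>y\<in>level (Suc (Suc n)). x = Rmat a (a + 2) y"
proof -
  obtain P M where x: "P \<in> level (Suc n)" "M \<in> level (Suc n)" "x = sign_cons P M" using assms(1) by (rule level_Suc_cases)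
  obtain pp pm where P: "P = sign_cons pp pm" "pp \<in> level n" "pm \<in> level n" using x(1) by (rule level_Suc_cases)
  obtain mp mm where M: "M = sign_cons mp mm" "mp \<in> level n" "mm \<in> level n" using x(2) by (rule level_Suc_cases)
  have B: "q powi (a + 2) = q\<^sup>2 * q powi a" using q0 by (simp add: power_int_add)
  define r where "r = q powi a - q\<^sup>2 * q powi (a + 2)"
  have r: "r \<noteq> 0" unfolding r_def by (rule rho_nonzero) simp
  define s where "s = (1 - q\<^sup>2) * q powi a"
  have s: "s \<noteq> 0" using q0 q2 by (simp add: s_def)
  have mp: "mp = q *\<^sub>C pm" using assms(2) by (simp add: cosinglet_def x P M)
  \<comment> \<open>The middle block has rank one, so a preimage may be sought with zero coefficient
    at v_- v_+.\<close>
  let ?y = "sign_cons (sign_cons (inverse r *\<^sub>C pp) (inverse s *\<^sub>C pm)) (sign_cons 0 (inverse r *\<^sub>C mm))"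
  have e: "q powi a - q powi (a + 2) = s" by (simp add: s_def B algebra_simps)
  then have "x = Rmat a (a + 2) ?y"
    unfolding Rmat_def Let_def r_def [symmetric] s_def [symmetric] component_sign_cons e
    using r s by (simp add: x P M mp scaleC_scaleC scaleC_one sign_cons_alg)
  moreover have "?y \<in> level (Suc (Suc n))" using P M by simp
  ultimately show ?thesis by blast
qed

definition top_vec :: "nat \<Rightarrow> sign list \<Rightarrow> complex" where
  "top_vec n = (\<lambda>t. if t = replicate n Plus then 1 else 0)"

definition bottom_vec :: "nat \<Rightarrow> sign list \<Rightarrow> complex" where
  "bottom_vec n = (\<lambda>t. if t = replicate n Minus then 1 else 0)"

lemma top_vec_level [simp]: "top_vec n \<in> level n" and bottom_vec_level [simp]: "bottom_vec n \<in> level n"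
  by (auto simp: top_vec_def bottom_vec_def level_def)

lemma top_vec_Suc: "top_vec (Suc n) = sign_cons (top_vec n) 0" and bottom_vec_Suc: "bottom_vec (Suc n) = sign_cons 0 (bottom_vec n)"
  by (auto simp: top_vec_def bottom_vec_def sign_cons_def fun_eq_iff split: list.splits sign.splits)

lemma top_vec_nonzero [simp]: "top_vec n \<noteq> 0" and bottom_vec_nonzero [simp]: "bottom_vec n \<noteq> 0"
  by (auto simp: top_vec_def bottom_vec_def fun_eq_iff)

text \<open>
  For an ascending adjacent pair, $v \to w \to w' \to v$ is exact at $w$ and $w'$; when the exchange of
  the two letters is invertible, \<open>\<iota>\<close> and \<open>\<pi>\<close> are zero.
\<close>

definition exchange_maps :: "int list \<Rightarrow> int list \<Rightarrow> int list \<Rightarrow> ((sign list \<Rightarrow> complex) \<Rightarrow> sign list \<Rightarrow> complex) \<Rightarrow>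
   ((sign list \<Rightarrow> complex) \<Rightarrow> sign list \<Rightarrow> complex) \<Rightarrow> ((sign list \<Rightarrow> complex) \<Rightarrow> sign list \<Rightarrow> complex) \<Rightarrow> bool" where
  "exchange_maps w w' v T \<iota> \<pi> \<longleftrightarrow> intertwiner w w' T \<and> intertwiner v w \<iota> \<and> intertwiner w' v \<pi> \<and>
     (\<exists>c. c \<noteq> 0 \<and> T (top_vec (length w)) = c *\<^sub>C top_vec (length w)) \<and>
     (\<forall>x\<in>level (length w). T x = 0 \<longrightarrow> (\<exists>y\<in>level (length v). x = \<iota> y)) \<and>
     (\<forall>x\<in>level (length w'). \<pi> x = 0 \<longrightarrow> (\<exists>y\<in>level (length w). x = T y))"

lemma exchange_maps_lift:
  assumes "exchange_maps w w' v T \<iota> \<pi>"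
  shows "exchange_maps (a # w) (a # w') (a # v) (lift_op T) (lift_op \<iota>) (lift_op \<pi>)"
proof -
  have T: "intertwiner w w' T" and i: "intertwiner v w \<iota>" and p: "intertwiner w' v \<pi>"
    and c: "\<exists>c. c \<noteq> 0 \<and> T (top_vec (length w)) = c *\<^sub>C top_vec (length w)"
    and k: "\<And>x. x\<in>level (length w) \<Longrightarrow> T x = 0 \<Longrightarrow> \<exists>y\<in>level (length v). x = \<iota> y"
    and m: "\<And>x. x\<in>level (length w') \<Longrightarrow> \<pi> x = 0 \<Longrightarrow> \<exists>y\<in>level (length w). x = T y"
    using assms by (auto simp: exchange_maps_def)
  have "\<exists>y\<in>level (length (a # v)). x = lift_op \<iota> y" if "x \<in> level (length (a # w))" "lift_op T x = 0" for x
  proof -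
    from that(1) obtain P M where x: "P \<in> level (length w)" "M \<in> level (length w)" "x = sign_cons P M"
      unfolding length_Cons by (rule level_Suc_cases)
    then have "T P = 0" "T M = 0" using that(2) by (simp_all add: lift_op_def sign_cons_eq_0)
    then obtain P' M' where "P' \<in> level (length v)" "P = \<iota> P'" "M' \<in> level (length v)" "M = \<iota> M'"
      using k x by metis
    then show ?thesis by (intro bexI [of _ "sign_cons P' M'"]) (simp_all add: lift_op_def x)
  qed
  moreover have "\<exists>y\<in>level (length (a # w)). x = lift_op T y" if "x \<in> level (length (a # w'))" "lift_op \<pi> x = 0" for x
  proof -
    from that(1) obtain P M where x: "P \<in> level (length w')" "M \<in> level (length w')" "x = sign_cons P M"
      unfolding length_Cons by (rule level_Suc_cases)
    then have "\<pi> P = 0" "\<pi> M = 0" using that(2) by (simp_all add: lift_op_def sign_cons_eq_0)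
    then obtain P' M' where "P' \<in> level (length w)" "P = T P'" "M' \<in> level (length w)" "M = T M'"
      using m x by metis
    then show ?thesis by (intro bexI [of _ "sign_cons P' M'"]) (simp_all add: lift_op_def x)
  qed
  moreover have "\<exists>c. c \<noteq> 0 \<and> lift_op T (top_vec (length (a # w))) = c *\<^sub>C top_vec (length (a # w))"
    using c by (auto simp: top_vec_Suc lift_op_def sign_cons_alg intertwD(4) [OF T])
  ultimately show ?thesis
    unfolding exchange_maps_def using intertwiner_lift [OF T] intertwiner_lift [OF i] intertwiner_lift [OF p] by blast
qed

text \<open>The condition a < b rules out b = a - 2, where the exchange would kill the top vector.
  Thus b = a + 2 is the only degenerate case, and there singlet and cosinglet supply kernel and
  cokernel.\<close>

lemma exchange_maps_exists:
  assumes "a < b"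
  shows "\<exists>T \<iota> \<pi>. exchange_maps (u @ a # b # v) (u @ b # a # v) (u @ v) T \<iota> \<pi>"
proof (induction u)
  case Nil
  have top_vec: "Rmat a b (top_vec (length (a # b # v))) = (q powi a - q\<^sup>2 * q powi b) *\<^sub>C top_vec (length (a # b # v))"
    by (simp add: top_vec_Suc Rmat_def sign_cons_alg)
  have r: "q powi a - q\<^sup>2 * q powi b \<noteq> 0" using assms by (intro rho_nonzero) simp
  show ?case
  proof (cases "b = a + 2")
    case True
    then have "exchange_maps (a # b # v) (b # a # v) v (Rmat a b) singlet cosinglet"
      unfolding exchange_maps_def using top_vec r intertwiner_Rmat [of a b v] intertwiner_singlet [of v a] intertwiner_cosinglet [of a v]
        Rmat_kernel [of _ "length v" a] Rmat_image [of _ "length v" a] by (auto simp del: intertwiner_def)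
    then show ?thesis by auto
  next
    case False
    define d where "d = (q powi a - q\<^sup>2 * q powi b) * (q powi b - q\<^sup>2 * q powi a)"
    have d: "d \<noteq> 0" unfolding d_def using r rho_nonzero [of a b] False by simp
    have inv: "Rmat b a (Rmat a b x) = d *\<^sub>C x" "Rmat a b (Rmat b a x) = d *\<^sub>C x"
      if "x \<in> level (length (a # b # v))" for x
      using that Rmat_inverse [of x "length v"] by (simp_all add: d_def mult.commute)
    have "x = 0" if "x \<in> level (length (a # b # v))" "Rmat a b x = 0" for x
      using inv(1) [OF that(1)] that(2) d intertwD(4) [OF intertwiner_Rmat, of b a] by simp
    moreover have "\<exists>y\<in>level (length (a # b # v)). x = Rmat a b y" if "x \<in> level (length (b # a # v))" for x
    proof (intro bexI)
      show "x = Rmat a b (inverse d *\<^sub>C Rmat b a x)"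
        using inv(2) [of x] that d intertwD(2) [OF intertwiner_Rmat] by (simp add: scaleC_scaleC scaleC_one)
      show "inverse d *\<^sub>C Rmat b a x \<in> level (length (a # b # v))"
        using intertwD(5) [OF intertwiner_Rmat that] by simp
    qed
    ultimately have "exchange_maps (a # b # v) (b # a # v) v (Rmat a b) (\<lambda>_. 0) (\<lambda>_. 0)"
      unfolding exchange_maps_def using top_vec r by (intro conjI intertwiner_Rmat intertwiner_zero) (auto intro: level_alg(1))
    then show ?thesis by auto
  qed
next
  case (Cons c u)
  then show ?case using exchange_maps_lift by (metis append_Cons)
qed

section \<open>Isomorphism of a shuffle with the concatenation\<close>

definition word_iso :: "int list \<Rightarrow> int list \<Rightarrow> bool" where
  "word_iso w w' \<longleftrightarrow> (\<exists>T. intertwiner w w' T \<and> bij_betw T (level (length w)) (level (length w')))"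

lemma word_iso_refl: "word_iso w w"
  unfolding word_iso_def using intertwiner_id bij_betw_id unfolding id_def by blast

lemma word_iso_trans: "word_iso w w' \<Longrightarrow> word_iso w' w'' \<Longrightarrow> word_iso w w''"
  unfolding word_iso_def using intertwiner_comp bij_betw_trans unfolding comp_def by metis

lemma word_iso_Cons: "word_iso w w' \<Longrightarrow> word_iso (a # w) (a # w')"
proof -
  assume "word_iso w w'"
  then obtain T where T: "intertwiner w w' T" "bij_betw T (level (length w)) (level (length w'))" by (auto simp: word_iso_def)
  have "bij_betw (lift_op T) (level (length (a # w))) (level (length (a # w')))"
  proof (rule bij_betw_imageI)
    show "inj_on (lift_op T) (level (length (a # w)))"
    proof (rule inj_onI)
      fix x y assume xy: "x \<in> level (length (a # w))" "y \<in> level (length (a # w))" "lift_op T x = lift_op T y"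
      then have "component s x \<in> level (length w)" "component s y \<in> level (length w)" for s by simp_all
      moreover have "T (component s x) = T (component s y)" for s
        using xy(3) by (cases s) (simp_all add: lift_op_def sign_cons_alg)
      ultimately have "component s x = component s y" for s
        using T(2) by (meson bij_betw_def inj_onD)
      then show "x = y" using sign_cons_component xy(1,2) unfolding length_Cons by metis
    qed
    show "lift_op T ` level (length (a # w)) = level (length (a # w'))"
    proof (intro equalityI subsetI)
      fix x assume "x \<in> lift_op T ` level (length (a # w))"
      then show "x \<in> level (length (a # w'))" using intertwD(5) [OF intertwiner_lift [OF T(1)]] by blast
    next
      fix x assume "x \<in> level (length (a # w'))"
      then obtain P M where x: "P \<in> level (length w')" "M \<in> level (length w')" "x = sign_cons P M"
        unfolding length_Cons by (rule level_Suc_cases)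
      then obtain P' M' where "P' \<in> level (length w)" "T P' = P" "M' \<in> level (length w)" "T M' = M"
        using T(2) by (metis bij_betw_def imageE)
      then show "x \<in> lift_op T ` level (length (a # w))"
        by (intro image_eqI [of _ _ "sign_cons P' M'"]) (simp_all add: lift_op_def x)
    qed
  qed
  then show ?thesis using intertwiner_lift [OF T(1)] word_iso_def by blast
qed

lemma word_iso_swap:
  assumes "b \<noteq> a + 2" "b \<noteq> a - 2"
  shows "word_iso (a # b # w) (b # a # w)"
proof -
  define d where "d = (q powi a - q\<^sup>2 * q powi b) * (q powi b - q\<^sup>2 * q powi a)"
  have d: "d \<noteq> 0" unfolding d_def using rho_nonzero [of a b] rho_nonzero [of b a] assms by simp
  have inv: "Rmat b a (Rmat a b x) = d *\<^sub>C x" "Rmat a b (Rmat b a x) = d *\<^sub>C x"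
    if "x \<in> level (length (a # b # w))" for x
    using that Rmat_inverse [of x "length w"] by (simp_all add: d_def mult.commute)
  have "bij_betw (Rmat a b) (level (length (a # b # w))) (level (length (b # a # w)))"
  proof (rule bij_betw_byWitness [where f' = "\<lambda>x. inverse d *\<^sub>C Rmat b a x"])
    show "\<forall>x\<in>level (length (a # b # w)). inverse d *\<^sub>C Rmat b a (Rmat a b x) = x"
      using inv(1) d by (simp add: scaleC_scaleC scaleC_one)
    show "\<forall>x\<in>level (length (b # a # w)). Rmat a b (inverse d *\<^sub>C Rmat b a x) = x"
      using inv(2) d intertwD(2) [OF intertwiner_Rmat] by (simp add: scaleC_scaleC scaleC_one)
  qed (use intertwD(5) [OF intertwiner_Rmat] in auto)
  then show ?thesis using intertwiner_Rmat word_iso_def by blast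
qed

lemma word_iso_move:
  assumes "\<And>a. a \<in> set u \<Longrightarrow> b \<noteq> a + 2 \<and> b \<noteq> a - 2"
  shows "word_iso (b # u @ v) (u @ b # v)"
  using assms
proof (induction u)
  case (Cons a u)
  have "word_iso (b # a # u @ v) (a # b # u @ v)" using Cons.prems [of a] by (intro word_iso_swap) auto
  moreover have "word_iso (a # b # u @ v) (a # u @ b # v)" using Cons by (intro word_iso_Cons) auto
  ultimately show ?case by (auto intro: word_iso_trans)
qed (simp add: word_iso_refl)

text \<open>If the first letter of the shuffle comes from \<open>w2\<close>, the remainder is
  unshuffled first and then this letter is carried past all of \<open>w1\<close>, meeting no letter
  of \<open>w2\<close> on the way.\<close>

lemma word_iso_shuffle:
  assumes "w \<in> shuffles w1 w2" "\<And>a b. a \<in> set w1 \<Longrightarrow> b \<in> set w2 \<Longrightarrow> b \<noteq> a + 2 \<and> b \<noteq> a - 2"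
  shows "word_iso w (w1 @ w2)"
  using assms
proof (induction w1 w2 arbitrary: w rule: shuffles.induct)
  case (3 a w1 b w2)
  from "3.prems"(1) consider w' where "w = a # w'" "w' \<in> shuffles w1 (b # w2)"
    | w' where "w = b # w'" "w' \<in> shuffles (a # w1) w2" by auto
  then show ?case
  proof cases
    case 1
    then have "word_iso w' (w1 @ b # w2)" using "3.IH"(1) "3.prems"(2) by auto
    then show ?thesis using 1 word_iso_Cons by simp
  next
    case 2
    then have "word_iso w' (a # w1 @ w2)" using "3.IH"(2) "3.prems"(2) by auto
    then have "word_iso w (b # (a # w1) @ w2)" using 2 word_iso_Cons by simp
    moreover have "word_iso (b # (a # w1) @ w2) ((a # w1) @ b # w2)"
      by (rule word_iso_move) (use "3.prems"(2) in auto)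
    ultimately show ?thesis by (rule word_iso_trans)
  qed
qed (auto simp: word_iso_refl)

end

section \<open>Weights and submodules\<close>

lemma scaleC_apply: "(c *\<^sub>C f) t = c *\<^sub>C f t"
  by (simp add: scaleC_fun_def)

lemma component_apply: "component s x t = x (s # t)"
  by (simp add: component_def)

lemmas pointwise = fun_eq_iff plus_fun_apply zero_fun_apply minus_apply uminus_apply scaleC_apply scaleC_complex_def

text \<open>
  The method \<open>induction\<close> leaves \<open>0\<close> and \<open>+\<close> on functions eta-expanded, and the pointwise rules
  would then turn them into lambda terms.
\<close>

declare plus_fun_apply [simp del] zero_fun_apply [simp del] minus_apply [simp del] uminus_apply [simp del]

context generic_q
begin

lemma commutations:
  assumes "v \<in> level (length w)"
  shows "word_op q w Kp (word_op q w Km v) = v" "word_op q w Km (word_op q w Kp v) = v"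
    "word_op q w Kp (word_op q w E1 v) = q\<^sup>2 *\<^sub>C word_op q w E1 (word_op q w Kp v)"
    "word_op q w Kp (word_op q w F1 v) = (inverse q ^ 2) *\<^sub>C word_op q w F1 (word_op q w Kp v)"
    "word_op q w Kp (word_op q w E0 v) = (inverse q ^ 2) *\<^sub>C word_op q w E0 (word_op q w Kp v)"
    "word_op q w Kp (word_op q w F0 v) = q\<^sup>2 *\<^sub>C word_op q w F0 (word_op q w Kp v)"
    "word_op q w Km (word_op q w E1 v) = (inverse q ^ 2) *\<^sub>C word_op q w E1 (word_op q w Km v)"
proof -
  \<comment> \<open>The locale is entered for its commutation rules for \<open>op\<close>; the
    letter 0 is a placeholder.\<close>
  interpret eval_tensor "level (length w)" "word_op q w" q 0
    using word_op_U_ops [OF q0 q2] q0 q2 by (simp add: eval_tensor_def eval_tensor_axioms_def)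
  show "word_op q w Kp (word_op q w Km v) = v" "word_op q w Km (word_op q w Kp v) = v"
    "word_op q w Kp (word_op q w E1 v) = q\<^sup>2 *\<^sub>C word_op q w E1 (word_op q w Kp v)"
    "word_op q w Kp (word_op q w F1 v) = (inverse q ^ 2) *\<^sub>C word_op q w F1 (word_op q w Kp v)"
    "word_op q w Kp (word_op q w E0 v) = (inverse q ^ 2) *\<^sub>C word_op q w E0 (word_op q w Kp v)"
    "word_op q w Kp (word_op q w F0 v) = q\<^sup>2 *\<^sub>C word_op q w F0 (word_op q w Kp v)"
    "word_op q w Km (word_op q w E1 v) = (inverse q ^ 2) *\<^sub>C word_op q w E1 (word_op q w Km v)"
    by (rule KK Kp_move Km_move, rule assms)+
qed

fun weight :: "sign list \<Rightarrow> int" where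
  "weight [] = 0"
| "weight (Plus # t) = 1 + weight t"
| "weight (Minus # t) = weight t - 1"

lemma weight_bounds: "\<bar>weight t\<bar> \<le> int (length t)"
  by (induction t rule: weight.induct) auto

lemma weight_min: "weight t = - int (length t) \<longleftrightarrow> t = replicate (length t) Minus"
proof (induction t rule: weight.induct)
  case (2 t)
  then show ?case using weight_bounds [of t] by auto
qed auto

lemma word_op_Kp: "x \<in> level (length w) \<Longrightarrow> word_op q w Kp x t = q powi weight t * x t"
proof (induction w arbitrary: x t)
  case Nil
  then show ?case by (cases t) (auto simp: triv_op_def level_def)
next
  case (Cons a w)
  have c: "component s x \<in> level (length w)" for s using Cons.prems by simp
  have x: "x [] = 0" using Cons.prems by (simp add: level_def)
  show ?case
  proof (cases t)
    case Nil
    then show ?thesis using x by (simp add: sign_cons_def)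
  next
    case (Cons s t')
    have "word_op q w Kp (component s x) t' = q powi weight t' * x (s # t')"
      using Cons.IH [OF c] by (simp add: component_def)
    then show ?thesis using q0
      by (cases s) (simp_all add: Cons sign_cons_def scaleC_fun_def scaleC_complex_def power_int_add power_int_diff field_simps)
  qed
qed

lemma top_vec_ops:
  "word_op q w E1 (top_vec (length w)) = 0"
  "word_op q w Kp (top_vec (length w)) = q powi (int (length w)) *\<^sub>C top_vec (length w)"
  "word_op q w Km (top_vec (length w)) = q powi (- int (length w)) *\<^sub>C top_vec (length w)"
  "word_op q w F0 (top_vec (length w)) = 0"
proof -
  show "word_op q w E1 (top_vec (length w)) = 0"
    by (induction w) (simp_all add: top_vec_Suc triv_op_def sign_cons_eq_0)
  show "word_op q w Kp (top_vec (length w)) = q powi (int (length w)) *\<^sub>C top_vec (length w)"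
    using q0 by (induction w) (simp_all add: top_vec_Suc triv_op_def sign_cons_alg scaleC_one scaleC_scaleC power_int_add mult.commute)
  show "word_op q w Km (top_vec (length w)) = q powi (- int (length w)) *\<^sub>C top_vec (length w)"
    using q0 by (induction w) (simp_all add: top_vec_Suc triv_op_def sign_cons_alg scaleC_one scaleC_scaleC power_int_diff field_simps power_int_minus)
  show "word_op q w F0 (top_vec (length w)) = 0"
    by (induction w) (simp_all add: top_vec_Suc triv_op_def sign_cons_eq_0)
qed

section \<open>Submodules and their weight vectors\<close>

definition submod :: "int list \<Rightarrow> (sign list \<Rightarrow> complex) set \<Rightarrow> bool" where
  "submod w L \<longleftrightarrow> cvs.subspace L \<and> L \<subseteq> level (length w) \<and> (\<forall>g. \<forall>x\<in>L. word_op q w g x \<in> L)"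

lemma submodD:
  assumes "submod w L"
  shows "0 \<in> L" "x \<in> L \<Longrightarrow> y \<in> L \<Longrightarrow> x + y \<in> L" "x \<in> L \<Longrightarrow> y \<in> L \<Longrightarrow> x - y \<in> L" "x \<in> L \<Longrightarrow> c *\<^sub>C x \<in> L"
    "x \<in> L \<Longrightarrow> x \<in> level (length w)" "x \<in> L \<Longrightarrow> word_op q w g x \<in> L"
  using assms by (auto simp: submod_def cvs.subspace_0 cvs.subspace_add cvs.subspace_diff cvs.subspace_scale)

lemma submodI:
  assumes "0 \<in> L" "\<And>x y. x \<in> L \<Longrightarrow> y \<in> L \<Longrightarrow> x + y \<in> L" "\<And>c x. x \<in> L \<Longrightarrow> c *\<^sub>C x \<in> L"
    "\<And>x. x \<in> L \<Longrightarrow> x \<in> level (length w)" "\<And>g x. x \<in> L \<Longrightarrow> word_op q w g x \<in> L"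
  shows "submod w L"
  using assms by (auto simp: submod_def cvs.subspace_def)

lemma submod_level: "submod w (level (length w))" and submod_zero: "submod w {0}"
  by (auto intro!: submodI simp: cvs.scale_zero_right)

text \<open>A polynomial in K acts diagonally on sign lists; this one is the product of the factors
  K - q^j, which annihilates the weights in \<open>J\<close>.\<close>

lemma weight_filter:
  assumes L: "submod w L" and x: "x \<in> L" and "finite J"
  shows "(\<lambda>t. (\<Prod>j\<in>J. q powi weight t - q powi j) * x t) \<in> L"
  using \<open>finite J\<close>
proof (induction J)
  case (insert j J)
  let ?y = "\<lambda>t. (\<Prod>j\<in>J. q powi weight t - q powi j) * x t"
  have "word_op q w Kp ?y - (q powi j) *\<^sub>C ?y \<in> L"
    using insert.IH by (intro submodD [OF L])
  also have "word_op q w Kp ?y - (q powi j) *\<^sub>C ?y = (\<lambda>t. (\<Prod>j\<in>insert j J. q powi weight t - q powi j) * x t)"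
    using insert.hyps word_op_Kp [OF submodD(5) [OF L insert.IH]]
    by (simp add: pointwise algebra_simps)
  finally show ?case .
qed (use x in simp)

text \<open>Filtering out all other weights possible at this length leaves a nonzero multiple of the
  component of weight \<open>weight t\<close>, since distinct weights give distinct powers of
  q.\<close>

lemma weight_component:
  assumes L: "submod w L" and x: "x \<in> L" and t: "x t \<noteq> 0"
  obtains y where "y \<in> L" "y t \<noteq> 0" "word_op q w Kp y = q powi weight t *\<^sub>C y" "\<And>s. y s \<noteq> 0 \<Longrightarrow> weight s = weight t"
proof -
  let ?n = "int (length w)"
  let ?J = "{- ?n..?n} - {weight t}"
  let ?y = "\<lambda>t. (\<Prod>j\<in>?J. q powi weight t - q powi j) * x t"
  have y: "?y \<in> L" using weight_filter [OF L x] by simp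
  have s: "weight s = weight t" if "?y s \<noteq> 0" for s
  proof -
    have "x s \<noteq> 0" using that by auto
    then have "length s = length w" using submodD(5) [OF L x] by (auto simp: level_def)
    then have "weight s \<in> {- ?n..?n}" using weight_bounds [of s] by auto
    then show ?thesis using that by auto
  qed
  have "?y t \<noteq> 0" using t by (simp add: powi_eq_iff)
  moreover have "word_op q w Kp ?y s = (q powi weight t *\<^sub>C ?y) s" for s
    using word_op_Kp [OF submodD(5) [OF L y], of s] s [of s]
    by (cases "?y s = 0") (simp_all add: scaleC_fun_def scaleC_complex_def)
  ultimately show ?thesis using that y s by blast
qed

lemma weight_vectorD:
  assumes "x \<in> level (length w)" "word_op q w Kp x = q powi j *\<^sub>C x" "x t \<noteq> 0"
  shows "weight t = j" "\<bar>j\<bar> \<le> int (length w)"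
proof -
  have "q powi weight t * x t = q powi j * x t"
    using word_op_Kp [OF assms(1), of t] unfolding assms(2) by (auto simp: scaleC_fun_def scaleC_complex_def)
  then show "weight t = j" using assms(3) by (auto simp: powi_eq_iff)
  moreover have "length t = length w" using assms(1,3) by (auto simp: level_def)
  ultimately show "\<bar>j\<bar> \<le> int (length w)" using weight_bounds [of t] by simp
qed

lemma lowest_weight_vector:
  assumes "x \<in> level (length w)" "word_op q w Kp x = q powi (- int (length w)) *\<^sub>C x"
  shows "x = x (replicate (length w) Minus) *\<^sub>C bottom_vec (length w)"
proof
  fix t
  have "t = replicate (length w) Minus" if "x t \<noteq> 0"
  proof -
    have "length t = length w" using that assms(1) by (auto simp: level_def)
    then show ?thesis using weight_vectorD(1) [OF assms that] weight_min [of t] by simp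
  qed
  then show "x t = (x (replicate (length w) Minus) *\<^sub>C bottom_vec (length w)) t"
    by (auto simp: bottom_vec_def scaleC_fun_def scaleC_complex_def)
qed

lemma bottom_vec_mem:
  assumes L: "submod w L" and x: "x \<in> L" and t: "x (replicate (length w) Minus) \<noteq> 0"
  shows "bottom_vec (length w) \<in> L"
proof -
  let ?r = "replicate (length w) Minus"
  obtain y where y: "y \<in> L" "y ?r \<noteq> 0" "word_op q w Kp y = q powi weight ?r *\<^sub>C y" using weight_component [OF L x t] by metis
  have "weight ?r = - int (length w)" using weight_min [of ?r] by simp
  then have *: "y = y ?r *\<^sub>C bottom_vec (length w)"
    using lowest_weight_vector [OF submodD(5) [OF L y(1)]] y(3) by simp
  have "inverse (y ?r) *\<^sub>C y \<in> L" using y(1) by (rule submodD [OF L])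
  also have "inverse (y ?r) *\<^sub>C y = bottom_vec (length w)"
    by (subst (2) *) (use y(2) in \<open>simp add: scaleC_scaleC scaleC_one\<close>)
  finally show ?thesis .
qed

lemma bottom_vec_weight: "word_op q w Kp (bottom_vec (length w)) = q powi (- int (length w)) *\<^sub>C bottom_vec (length w)"
  using q0 by (induction w) (simp_all add: bottom_vec_Suc triv_op_def sign_cons_alg scaleC_one scaleC_scaleC power_int_diff power_int_minus field_simps)

section \<open>Quantum integers and the strings from the lowest to the highest vector\<close>

definition qint :: "nat \<Rightarrow> complex" where
  "qint n = (q powi int n - q powi (- int n)) / (q - inverse q)"

definition qfact :: "nat \<Rightarrow> complex" where "qfact n = (\<Prod>i\<in>{1..n}. qint i)"

lemma qdiff: "q - inverse q \<noteq> 0"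
  using q0 q2 by (simp add: field_simps power2_eq_square)

lemma qint_nonzero: "n > 0 \<Longrightarrow> qint n \<noteq> 0"
  using qdiff powi_eq_iff [of "int n" "- int n"] by (simp add: qint_def)

lemma qint_0: "qint 0 = 0" by (simp add: qint_def)

lemma qint_Suc: "qint (Suc n) = q powi (- int n) + q * qint n"
  using qdiff q0 by (simp add: qint_def power_int_add power_int_diff power_int_minus field_simps)

lemma qfact_nonzero: "qfact n \<noteq> 0"
  using qint_nonzero by (simp add: qfact_def)

lemma qfact_Suc: "qfact (Suc n) = qint (Suc n) * qfact n"
  by (simp add: qfact_def mult.commute)

lemma funpow_scale: "(word_op q w g ^^ n) (c *\<^sub>C x) = c *\<^sub>C (word_op q w g ^^ n) x"
  by (induction n) (simp_all add: word_op_scale)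

text \<open>f_0 can raise the first letter only once. Summing over the step at which this happens
  gives the geometric sum \<open>qint (Suc i)\<close>, together with one factor q^{-a}.\<close>

lemma F0_iterate:
  "(word_op q (a # w) F0 ^^ Suc i) (sign_cons 0 M) =
     sign_cons ((qint (Suc i) * q powi (- a)) *\<^sub>C (word_op q w F0 ^^ i) M) (q powi (- int (Suc i)) *\<^sub>C (word_op q w F0 ^^ Suc i) M)"
proof (induction i)
  case 0
  then show ?case by (simp add: qint_Suc qint_0 power_int_minus)
next
  case (Suc i)
  have "(word_op q (a # w) F0 ^^ Suc (Suc i)) (sign_cons 0 M) = word_op q (a # w) F0 ((word_op q (a # w) F0 ^^ Suc i) (sign_cons 0 M))"
    by simp
  also have "\<dots> = sign_cons ((qint (Suc (Suc i)) * q powi (- a)) *\<^sub>C (word_op q w F0 ^^ Suc i) M)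
      (q powi (- int (Suc (Suc i))) *\<^sub>C (word_op q w F0 ^^ Suc (Suc i)) M)"
    unfolding Suc.IH
    by (simp add: word_op_lin sign_cons_alg scaleC_scaleC qint_Suc [of "Suc i"] flip: scaleC_add_left)
      (use q0 in \<open>simp add: power_int_diff power_int_minus field_simps power2_eq_square\<close>)
  finally show ?case .
qed

text \<open>As for f_0, but the step that raises the first letter also applies K to the rest, so the
  weight k of \<open>M\<close> enters. The fraction is q^{k+i} \<open>qint (i + 1)\<close>.\<close>

lemma E1_iterate:
  assumes "M \<in> level (length w)" "word_op q w Kp M = q powi k *\<^sub>C M"
  shows "(word_op q (a # w) E1 ^^ Suc i) (sign_cons 0 M) =
     sign_cons (((q powi (2 * int i + k + 1) - q powi (k - 1)) / (q - inverse q)) *\<^sub>C (word_op q w E1 ^^ i) M) ((word_op q w E1 ^^ Suc i) M)"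
proof -
  have l: "(word_op q w E1 ^^ i) M \<in> level (length w)" for i
    by (induction i) (simp_all add: assms)
  have k: "word_op q w Kp ((word_op q w E1 ^^ i) M) = q powi (2 * int i + k) *\<^sub>C (word_op q w E1 ^^ i) M" for i
  proof (induction i)
    case (Suc i)
    show ?case
      using q0 by (simp add: commutations(3) [OF l] Suc.IH word_op_scale scaleC_scaleC power_int_add power2_eq_square ac_simps)
  qed (simp add: assms)
  show ?thesis
  proof (induction i)
    case 0
    have "q powi (2 * int 0 + k + 1) - q powi (k - 1) = (q - inverse q) * q powi k"
      using q0 by (simp add: power_int_add power_int_diff field_simps)
    then have "(q powi (2 * int 0 + k + 1) - q powi (k - 1)) / (q - inverse q) = q powi k"
      using qdiff by simp
    then show ?case using k [of 0] by simp
  next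
    case (Suc i)
    have "(word_op q (a # w) E1 ^^ Suc (Suc i)) (sign_cons 0 M) = word_op q (a # w) E1 ((word_op q (a # w) E1 ^^ Suc i) (sign_cons 0 M))"
      by simp
    also have "\<dots> = sign_cons (((q powi (2 * int (Suc i) + k + 1) - q powi (k - 1)) / (q - inverse q)) *\<^sub>C (word_op q w E1 ^^ Suc i) M)
       ((word_op q w E1 ^^ Suc (Suc i)) M)"
      unfolding Suc.IH word_op.simps component_sign_cons k word_op_scale
      using q0 qdiff by (simp add: sign_cons_alg flip: scaleC_add_left)
       (simp add: power_int_add power_int_diff field_simps power2_eq_square power3_eq_cube)
    finally show ?case .
  qed
qed

text \<open>Every letter a is raised exactly once, and on it f_0 is q^{-a} e_1. The scalar thus
  exceeds that of \<open>E1_power\<close> by q to minus the sum of the letters, which is the ratio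
  recorded in \<open>fundamental\<close>.\<close>

lemma F0_power: "(word_op q w F0 ^^ length w) (bottom_vec (length w)) = (qfact (length w) * q powi (- sum_list w)) *\<^sub>C top_vec (length w)"
proof (induction w)
  case Nil
  then show ?case by (simp add: qfact_def scaleC_one top_vec_def bottom_vec_def)
next
  case (Cons a w)
  have "(word_op q w F0 ^^ Suc (length w)) (bottom_vec (length w)) = 0"
    by (simp add: Cons.IH word_op_scale top_vec_ops)
  then show ?case using q0
    unfolding length_Cons bottom_vec_Suc F0_iterate Cons.IH top_vec_Suc
    by (simp add: sign_cons_alg scaleC_scaleC qfact_Suc power_int_diff power_int_minus field_simps)
qed

lemma E1_power: "(word_op q w E1 ^^ length w) (bottom_vec (length w)) = qfact (length w) *\<^sub>C top_vec (length w)"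
proof (induction w)
  case Nil
  then show ?case by (simp add: qfact_def scaleC_one top_vec_def bottom_vec_def)
next
  case (Cons a w)
  have "(word_op q w E1 ^^ Suc (length w)) (bottom_vec (length w)) = 0"
    by (simp add: Cons.IH word_op_scale top_vec_ops)
  moreover have "(q powi (2 * int (length w) + - int (length w) + 1) - q powi (- int (length w) - 1)) / (q - inverse q) = qint (Suc (length w))"
  proof -
    have "2 * int (length w) + - int (length w) + 1 = int (Suc (length w))" "- int (length w) - 1 = - int (Suc (length w))"
      by simp_all
    then show ?thesis unfolding qint_def by (simp only:)
  qed
  ultimately show ?case
    unfolding length_Cons bottom_vec_Suc E1_iterate [OF bottom_vec_level bottom_vec_weight] Cons.IH top_vec_Suc
    by (simp add: sign_cons_alg scaleC_scaleC qfact_Suc)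
qed

lemma top_vec_mem_if_bottom_vec_mem:
  assumes L: "submod w L" and "bottom_vec (length w) \<in> L"
  shows "top_vec (length w) \<in> L"
proof -
  have "(word_op q w E1 ^^ n) (bottom_vec (length w)) \<in> L" for n
    by (induction n) (simp_all add: assms submodD(6) [OF L])
  then have "inverse (qfact (length w)) *\<^sub>C qfact (length w) *\<^sub>C top_vec (length w) \<in> L"
    using submodD(4) [OF L] E1_power by metis
  then show ?thesis using qfact_nonzero by (simp add: scaleC_scaleC scaleC_one)
qed

section \<open>Cyclicity of increasing words\<close>

text \<open>
  Up to a power of $K$ this is the first imaginary root vector of the loop realisation; its coproduct
  is triangular.
\<close>

definition h_op :: "int list \<Rightarrow> (sign list \<Rightarrow> complex) \<Rightarrow> sign list \<Rightarrow> complex" where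
  "h_op w x = word_op q w E1 (word_op q w E0 x) - (inverse q ^ 2) *\<^sub>C word_op q w E0 (word_op q w E1 x)"

lemma h_op_linear: "h_op w (x + y) = h_op w x + h_op w y" "h_op w (c *\<^sub>C x) = c *\<^sub>C h_op w x" "h_op w (x - y) = h_op w x - h_op w y"
  by (simp_all add: h_op_def word_op_lin scaleC_add_right cvs.scale_right_diff_distrib scaleC_scaleC ac_simps algebra_simps)

text \<open>On one letter the eigenvalues are q^a at v_+ and -q^{a-2} at v_-. The only off-diagonal
  term lowers the first letter and raises the rest.\<close>

lemma h_op_Cons:
  assumes "P \<in> level (length w)" "M \<in> level (length w)"
  shows "h_op (a # w) (sign_cons P M) = sign_cons (q powi a *\<^sub>C P + h_op w P)
     (h_op w M - q powi (a - 2) *\<^sub>C M + (q powi (a + 2) - q powi (a - 2)) *\<^sub>C word_op q w Km (word_op q w E1 P))"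
proof -
  have E1Km: "word_op q w E1 (word_op q w Km P) = q\<^sup>2 *\<^sub>C word_op q w Km (word_op q w E1 P)"
    using q0 by (simp add: commutations(7) [OF assms(1)] scaleC_scaleC scaleC_one power_inverse)
  have "h_op (a # w) (sign_cons P M) =
     sign_cons (q powi a *\<^sub>C P + word_op q w Kp (word_op q w E0 M) + word_op q w E1 (word_op q w E0 P) - inverse q ^ 2 *\<^sub>C (word_op q w E0 (word_op q w Kp M) + word_op q w E0 (word_op q w E1 P)))
      (q powi a *\<^sub>C word_op q w E1 (word_op q w Km P) + word_op q w E1 (word_op q w E0 M)
        - inverse q ^ 2 *\<^sub>C (q powi a *\<^sub>C (M + word_op q w Km (word_op q w E1 P)) + word_op q w E0 (word_op q w E1 M)))"
    unfolding h_op_def word_op.simps component_sign_cons word_op_add word_op_scale commutations(1) [OF assms(1)] commutations(2) [OF assms(2)] sign_cons_alg(1-3)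
    by (simp add: sign_cons_alg)
  also have "\<dots> = sign_cons (q powi a *\<^sub>C P + h_op w P)
     (h_op w M - q powi (a - 2) *\<^sub>C M + (q powi (a + 2) - q powi (a - 2)) *\<^sub>C word_op q w Km (word_op q w E1 P))"
    using q0 unfolding sign_cons_alg(5) h_op_def commutations(5) [OF assms(2)] E1Km
    by (simp add: pointwise power_int_add power_int_diff field_simps power2_eq_square)
  finally show ?thesis .
qed

text \<open>
  $e_0$ applied to the highest vector is a sum over the position that is lowered;
  \<open>partial_E0 m\<close> keeps the first \<open>m\<close> positions.
\<close>

fun partial_E0 :: "nat \<Rightarrow> int list \<Rightarrow> sign list \<Rightarrow> complex" where
  "partial_E0 0 w = 0"
| "partial_E0 (Suc m) [] = 0"
| "partial_E0 (Suc m) (a # w) = sign_cons (partial_E0 m w) (q powi (a - int (length w)) *\<^sub>C top_vec (length w))"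

lemma partial_E0_level [simp]: "partial_E0 m w \<in> level (length w)"
  by (induction m w rule: partial_E0.induct) auto

lemma partial_E0_full: "partial_E0 (length w) w = word_op q w E0 (top_vec (length w))"
  using q0 by (induction w) (simp_all add: triv_op_def top_vec_Suc top_vec_ops sign_cons_alg scaleC_scaleC power_int_diff power_int_minus divide_inverse)

text \<open>Lowering position \<open>m\<close> by e_0 brings in K^{-1} on the later letters, raising
  it back by e_1 brings in K; these cancel and q^{w_m} remains.\<close>

lemma E1_partial_E0: "m < length w \<Longrightarrow> word_op q w E1 (partial_E0 (Suc m) w) = word_op q w E1 (partial_E0 m w) + q powi (w ! m) *\<^sub>C top_vec (length w)"
proof (induction m w rule: partial_E0.induct)
  case (1 w)
  then obtain a v where "w = a # v" by (cases w) auto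
  then show ?case using q0
    by (simp add: word_op_scale top_vec_ops top_vec_Suc sign_cons_alg scaleC_scaleC power_int_diff)
next
  case (3 m a w)
  then show ?case
    by (simp add: word_op_scale top_vec_ops top_vec_Suc sign_cons_alg scaleC_scaleC add.assoc)
qed simp

definition h_weight :: "int list \<Rightarrow> complex" where "h_weight w = (\<Sum>c\<leftarrow>w. q powi c)"

lemma E1_partial_E0_sum: "m \<le> length w \<Longrightarrow> word_op q w E1 (partial_E0 m w) = (\<Sum>i<m. q powi (w ! i)) *\<^sub>C top_vec (length w)"
  by (induction m) (simp_all add: E1_partial_E0 scaleC_add_left)

lemma h_op_top_vec: "h_op w (top_vec (length w)) = h_weight w *\<^sub>C top_vec (length w)"
  using E1_partial_E0_sum [of "length w" w]
  by (simp add: h_op_def top_vec_ops h_weight_def sum_list_sum_nth atLeast0LessThan flip: partial_E0_full)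

text \<open>The subtracted scalar is the eigenvalue for a single lowered letter c: relative to the
  highest vector, q^c is replaced by -q^{c-2}.\<close>

definition h_shift :: "int list \<Rightarrow> int \<Rightarrow> (sign list \<Rightarrow> complex) \<Rightarrow> sign list \<Rightarrow> complex" where
  "h_shift w c x = h_op w x - (h_weight w - (1 + inverse q ^ 2) * q powi c) *\<^sub>C x"

lemma h_op_zero [simp]: "h_op w 0 = 0"
  by (simp add: h_op_def)

lemma h_shift_zero [simp]: "h_shift w c 0 = 0"
  by (simp add: h_shift_def)

lemma h_shift_Cons:
  assumes "P \<in> level (length w)"
  shows "h_shift (a # w) c (sign_cons P (s *\<^sub>C top_vec (length w))) =
    sign_cons (h_shift w c P)
      (((1 + inverse q ^ 2) * (q powi c - q powi a) * s) *\<^sub>C top_vec (length w)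
        + (q powi (a + 2) - q powi (a - 2)) *\<^sub>C word_op q w Km (word_op q w E1 P))"
  using q0 assms unfolding h_shift_def
  by (simp add: h_op_Cons h_op_linear h_op_top_vec sign_cons_alg h_weight_def)
     (simp add: pointwise power_int_add power_int_diff field_simps power2_eq_square)

text \<open>Dropping position \<open>m\<close> is compensated by replacing its letter c by c + 2.
  The coupling in \<open>h_op_Cons\<close> contributes exactly the missing part: (1 + q^{-2}) q^c +
  (q^2 - q^{-2}) q^c = (1 + q^{-2}) q^{c+2}.\<close>

lemma h_shift_partial_E0:
  "m < length w \<Longrightarrow> h_shift w (w ! m) (partial_E0 (Suc m) w) = h_shift w (w ! m + 2) (partial_E0 m w)"
proof (induction m w rule: partial_E0.induct)
  case (1 w)
  then obtain a v where "w = a # v" by (cases w) auto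
  then show ?case
    by (simp add: h_shift_Cons sign_cons_eq_0)
next
  case (3 m a w)
  let ?c = "w ! m"
  have IH: "h_shift w ?c (partial_E0 (Suc m) w) = h_shift w (?c + 2) (partial_E0 m w)" using 3 by simp
  have E: "word_op q w E1 (partial_E0 (Suc m) w) = word_op q w E1 (partial_E0 m w) + q powi ?c *\<^sub>C top_vec (length w)"
    using 3 by (intro E1_partial_E0) simp
  show ?case using q0
    unfolding nth_Cons_Suc partial_E0.simps h_shift_Cons [OF partial_E0_level] IH E word_op_add word_op_scale top_vec_ops sign_cons_alg(5)
    by (simp add: pointwise power_int_add power_int_diff power_int_minus field_simps power2_eq_square)
qed simp

lemma h_shift_linear: "h_shift w c (x + y) = h_shift w c x + h_shift w c y" "h_shift w c (r *\<^sub>C x) = r *\<^sub>C h_shift w c x"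
  by (simp_all add: h_shift_def h_op_linear scaleC_add_right cvs.scale_right_diff_distrib scaleC_scaleC ac_simps algebra_simps)

lemma h_shift_h_op: "h_shift w c (h_op w x) = h_op w (h_shift w c x)"
  by (simp add: h_shift_def h_op_linear)

text \<open>\<open>partial_E0 1 w\<close> is a multiple of v_- \<otimes> v_+ \<otimes> ... \<otimes>
  v_+, an eigenvector of \<open>h_op\<close>: the coupling term starts from the v_+ part of the
  first letter, which is zero here.\<close>

lemma h_shift_partial_E0_1:
  assumes "w \<noteq> []"
  shows "h_shift w c (partial_E0 1 w) = ((1 + inverse q ^ 2) * (q powi c - q powi (w ! 0))) *\<^sub>C partial_E0 1 w"
proof -
  obtain a v where "w = a # v" using assms by (cases w) auto
  then show ?thesis by (simp add: h_shift_Cons sign_cons_alg scaleC_scaleC ac_simps)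
qed

text \<open>
  By the telescoping relation \<open>h_shift_partial_E0\<close>, membership of \<open>partial_E0 (m + 1)\<close> in \<open>L\<close> puts
  \<open>partial_E0 m\<close> into the preimage of \<open>L\<close> under \<open>h_shift\<close>. That preimage is again closed under
  \<open>h_op\<close>, so the induction runs over all such subspaces at once.
\<close>

lemma partial_E0_1_mem:
  assumes "cvs.subspace L" "L \<subseteq> level (length w)" "\<And>x. x \<in> L \<Longrightarrow> h_op w x \<in> L" "partial_E0 (Suc m) w \<in> L" "m < length w"
    and "\<And>i. i < length w \<Longrightarrow> w ! i + 2 \<noteq> w ! 0"
  shows "partial_E0 1 w \<in> L"
  using assms(1-5)
proof (induction m arbitrary: L)
  case (Suc m)
  note sub = cvs.subspace_0 [OF Suc.prems(1)] cvs.subspace_add [OF Suc.prems(1)] cvs.subspace_scale [OF Suc.prems(1)] cvs.subspace_diff [OF Suc.prems(1)]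
  let ?c = "w ! Suc m + 2"
  have "w \<noteq> []" using Suc.prems(5) by auto
  let ?L = "{x \<in> level (length w). h_shift w ?c x \<in> L}"
  have th: "h_shift w c x \<in> L" if "x \<in> L" for x c
    unfolding h_shift_def using that Suc.prems(3) by (intro sub)
  have "partial_E0 1 w \<in> ?L"
  proof (rule Suc.IH)
    show "cvs.subspace ?L"
      unfolding cvs.subspace_def by (auto simp: h_shift_linear intro: sub)
    show "h_op w x \<in> ?L" if "x \<in> ?L" for x
      using that Suc.prems(3) by (simp add: h_shift_h_op) (simp add: h_op_def)
    show "partial_E0 (Suc m) w \<in> ?L"
      using th [OF Suc.prems(4), of "w ! Suc m"] Suc.prems(5) h_shift_partial_E0 [of "Suc m" w] by simp
  qed (use Suc.prems in auto)
  then have "((1 + inverse q ^ 2) * (q powi ?c - q powi (w ! 0))) *\<^sub>C partial_E0 1 w \<in> L"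
    using h_shift_partial_E0_1 [OF \<open>w \<noteq> []\<close>] by simp
  moreover have "(1 + inverse q ^ 2) * (q powi ?c - q powi (w ! 0)) \<noteq> 0"
  proof -
    have "q ^ 4 \<noteq> 1" by (rule not_root) simp
    then have "q\<^sup>2 + 1 \<noteq> 0"
      by (auto simp: eval_nat_numeral add_eq_0_iff2)
    then have "1 + inverse q ^ 2 \<noteq> 0" using q0 by (simp add: field_simps)
    moreover have "q powi ?c \<noteq> q powi (w ! 0)" unfolding powi_eq_iff using assms(6) Suc.prems(5) by blast
    ultimately show ?thesis by simp
  qed
  ultimately show ?case
    using sub(3) by (metis cvs.scale_scale left_inverse cvs.scale_one)
qed simp

text \<open>e_0 applied to the top vector lies in \<open>L\<close>, and \<open>h_op\<close> isolates
  from it the summand that lowers the first letter. So \<open>L\<close> contains v_+ and v_- times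
  the top vector of the shorter word, and the induction runs over the P with both v_+ \<otimes> P
  and v_- \<otimes> P in \<open>L\<close>.\<close>

lemma cyclic:
  assumes "submod w L" "top_vec (length w) \<in> L" "sorted w"
  shows "L = level (length w)"
  using assms
proof (induction w arbitrary: L)
  case Nil
  note L = submodD [OF Nil.prems(1)]
  have "x = x [] *\<^sub>C top_vec 0" if "x \<in> level 0" for x
    using that by (auto simp: level_0_iff top_vec_def pointwise)
  then show ?case using L(4,5) Nil.prems(2) by (metis list.size(3) subsetI subset_antisym)
next
  case (Cons a w)
  note L = submodD [OF Cons.prems(1)]
  let ?L' = "{P \<in> level (length w). sign_cons P 0 \<in> L \<and> sign_cons 0 P \<in> L}"
  have h_op: "h_op (a # w) x \<in> L" if "x \<in> L" for x unfolding h_op_def using that by (intro L)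
  have "partial_E0 1 (a # w) \<in> L"
  proof (rule partial_E0_1_mem [where m = "length w"])
    show "partial_E0 (Suc (length w)) (a # w) \<in> L"
      using partial_E0_full [of "a # w"] L(6) [OF Cons.prems(2)] by (metis length_Cons)
    \<comment> \<open>In an increasing word no letter lies below the first one, so none equals it
      minus 2.\<close>
    show "(a # w) ! i + 2 \<noteq> (a # w) ! 0" if "i < length (a # w)" for i
      using sorted_nth_mono [OF Cons.prems(3) _ that, of 0] by linarith
  qed (use Cons.prems(1) h_op in \<open>auto simp: submod_def\<close>)
  then have "sign_cons 0 (q powi (a - int (length w)) *\<^sub>C top_vec (length w)) \<in> L" by simp
  then have "inverse (q powi (a - int (length w))) *\<^sub>C sign_cons 0 (q powi (a - int (length w)) *\<^sub>C top_vec (length w)) \<in> L"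
    by (rule L(4))
  then have t: "sign_cons 0 (top_vec (length w)) \<in> L"
    using q0 by (simp add: sign_cons_alg scaleC_scaleC scaleC_one)
  have "submod w ?L'"
  proof (rule submodI)
    fix x y assume "x \<in> ?L'" "y \<in> ?L'"
    then show "x + y \<in> ?L'"
      using L(2) [of "sign_cons x 0" "sign_cons y 0"] L(2) [of "sign_cons 0 x" "sign_cons 0 y"] by (simp add: sign_cons_alg)
  next
    fix c x assume "x \<in> ?L'"
    then show "c *\<^sub>C x \<in> ?L'"
      using L(4) [of "sign_cons x 0" c] L(4) [of "sign_cons 0 x" c] by (simp add: sign_cons_alg)
  next
    fix g x assume x: "x \<in> ?L'"
    have u: "word_op q (a # w) g (sign_cons x 0) \<in> L" "word_op q (a # w) g (sign_cons 0 x) \<in> L" for g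
      using x L(6) by auto
    have s: "sign_cons P 0 \<in> L" if "sign_cons (c *\<^sub>C P) 0 \<in> L" "c \<noteq> 0" for c P
      using L(4) [OF that(1), of "inverse c"] that(2) by (simp add: sign_cons_alg scaleC_scaleC scaleC_one)
    have s': "sign_cons 0 P \<in> L" if "sign_cons 0 (c *\<^sub>C P) \<in> L" "c \<noteq> 0" for c P
      using L(4) [OF that(1), of "inverse c"] that(2) by (simp add: sign_cons_alg scaleC_scaleC scaleC_one)
    have d: "sign_cons P 0 \<in> L" if "sign_cons P M \<in> L" "sign_cons 0 M \<in> L" for P M
      using L(3) [OF that] by (simp add: sign_cons_alg)
    have d': "sign_cons 0 M \<in> L" if "sign_cons P M \<in> L" "sign_cons P 0 \<in> L" for P M
      using L(3) [OF that] by (simp add: sign_cons_alg)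
    have sc: "sign_cons (c *\<^sub>C P) 0 \<in> L" if "sign_cons P 0 \<in> L" for c P
      using L(4) [OF that, of c] by (simp add: sign_cons_alg)
    have sc': "sign_cons 0 (c *\<^sub>C P) \<in> L" if "sign_cons 0 P \<in> L" for c P
      using L(4) [OF that, of c] by (simp add: sign_cons_alg)
    have Kp: "sign_cons (word_op q w Kp x) 0 \<in> L" "sign_cons 0 (word_op q w Kp x) \<in> L"
      using u [of Kp] s s' q0 by (simp_all add: sign_cons_alg)
    have Km: "sign_cons (word_op q w Km x) 0 \<in> L" "sign_cons 0 (word_op q w Km x) \<in> L"
      using u [of Km] s s' q0 by (simp_all add: sign_cons_alg)
    \<comment> \<open>Coproduct terms that act on the first letter leave x or K^{+-1} x in the
      second factor; these are already known to be in \<open>L\<close> and are subtracted.\<close>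
    have "sign_cons (word_op q w g x) 0 \<in> L \<and> sign_cons 0 (word_op q w g x) \<in> L"
    proof (cases g)
      case E0
      then show ?thesis using u [of E0] d [OF _ sc' [OF Km(2)]] by simp
    next
      case E1
      then show ?thesis using u [of E1] d' [OF _ Kp(1)] by simp
    next
      case F0
      have "sign_cons 0 (inverse q *\<^sub>C word_op q w F0 x) \<in> L"
        by (rule d' [where P = "q powi (- a) *\<^sub>C x"]) (use u(2) [of F0] x sc in auto)
      then show ?thesis using F0 u(1) [of F0] s s' q0 by simp
    next
      case F1
      have "sign_cons (inverse q *\<^sub>C word_op q w F1 x) 0 \<in> L"
        by (rule d [where M = x]) (use u(1) [of F1] x in auto)
      then show ?thesis using F1 u(2) [of F1] s s' q0 by simp
    qed (use Kp Km in auto)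
    then show "word_op q w g x \<in> ?L'" using x by simp
  qed (use L(1) in \<open>auto simp: sign_cons_alg\<close>)
  moreover have "top_vec (length w) \<in> ?L'" using t Cons.prems(2) by (simp add: top_vec_Suc)
  ultimately have "?L' = level (length w)" using Cons.IH [of ?L'] Cons.prems(3) by simp
  then have m: "sign_cons P 0 \<in> L" "sign_cons 0 P \<in> L" if "P \<in> level (length w)" for P using that by auto
  have "x \<in> L" if x: "x \<in> level (length (a # w))" for x
  proof -
    from x obtain P M where "P \<in> level (length w)" "M \<in> level (length w)" "x = sign_cons P M"
      unfolding length_Cons by (rule level_Suc_cases)
    then show ?thesis using L(2) [OF m(1) m(2), of P M] by (simp add: sign_cons_alg)
  qed
  then show ?case using L(5) by blast
qed

end

section \<open>Contraction with a dual word\<close>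

text \<open>
  The pairing of letters is $\langle v_-, v_+ \rangle = 1$, $\langle v_+, v_- \rangle = q^{-a}$; with
  it the adjoint of a generator on a word is, up to $K$ and a scalar, a generator acting on the word
  with negated letters, in the same order.
\<close>

fun contract :: "complex \<Rightarrow> int list \<Rightarrow> (sign list \<Rightarrow> complex) \<Rightarrow> (sign list \<Rightarrow> complex) \<Rightarrow> sign list \<Rightarrow> complex" where
  "contract q [] f x = f [] *\<^sub>C x"
| "contract q (a # w) f x = contract q w (component Minus f) (component Plus x) + q powi (- a) *\<^sub>C contract q w (component Plus f) (component Minus x)"

lemma contract_linear:
  "contract q w (f + g) x = contract q w f x + contract q w g x" "contract q w (c *\<^sub>C f) x = c *\<^sub>C contract q w f x"
  "contract q w f (x + y) = contract q w f x + contract q w f y" "contract q w f (c *\<^sub>C x) = c *\<^sub>C contract q w f x"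
proof -
  show "contract q w (f + g) x = contract q w f x + contract q w g x"
    by (induction w arbitrary: f g x) (simp_all add: plus_fun_apply scaleC_add_left scaleC_add_right ac_simps)
  show "contract q w (c *\<^sub>C f) x = c *\<^sub>C contract q w f x"
    by (induction w arbitrary: f x) (simp_all add: scaleC_apply scaleC_complex_def scaleC_scaleC scaleC_add_right ac_simps)
  show "contract q w f (x + y) = contract q w f x + contract q w f y"
    by (induction w arbitrary: f x y) (simp_all add: scaleC_add_left scaleC_add_right ac_simps)
  show "contract q w f (c *\<^sub>C x) = c *\<^sub>C contract q w f x"
    by (induction w arbitrary: f x) (simp_all add: scaleC_scaleC scaleC_add_right ac_simps)
qed

lemma contract_zero [simp]: "contract q w 0 x = 0" "contract q w f 0 = 0"
  using contract_linear(2) [of q w 0 0 x] contract_linear(4) [of q w f 0 0] by simp_all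

lemma contract_level: "x \<in> level (length w + n) \<Longrightarrow> contract q w f x \<in> level n"
  by (induction w arbitrary: f x) auto

text \<open>The pairing is perfect: f is the multiple of the flipped basis vector that is dual to
  the basis vector of s.\<close>

lemma contract_slice:
  assumes "q \<noteq> 0" "length s = length w"
  shows "\<exists>f\<in>level (length w). \<forall>x. contract q w f x = (\<lambda>t. x (s @ t))"
  using assms(2)
proof (induction w arbitrary: s)
  case Nil
  then show ?case
    by (intro bexI [of _ "\<lambda>t. if t = [] then 1 else 0"]) (auto simp: level_def scaleC_one)
next
  case (Cons a w)
  then obtain b s' where s: "s = b # s'" "length s' = length w" by (cases s) auto
  then obtain f where f: "f \<in> level (length w)" "\<And>x. contract q w f x = (\<lambda>t. x (s' @ t))" using Cons.IH by metis
  show ?case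
  proof (cases b)
    case Plus
    then show ?thesis
      by (intro bexI [of _ "sign_cons 0 f"]) (simp_all add: f s component_apply)
  next
    case Minus
    then show ?thesis using assms(1)
      by (intro bexI [of _ "sign_cons (q powi a *\<^sub>C f) 0"])
        (simp_all add: f s component_apply contract_linear scaleC_scaleC power_int_minus scaleC_one)
  qed
qed

context generic_q
begin

lemma contract_top_vec: "\<exists>c. c \<noteq> 0 \<and> (\<forall>x. contract q w (top_vec (length w)) x = c *\<^sub>C (\<lambda>t. x (replicate (length w) Minus @ t)))"
proof (induction w)
  case Nil
  then show ?case by (intro exI [of _ 1]) (simp add: top_vec_def scaleC_one)
next
  case (Cons a w)
  then obtain c where "c \<noteq> 0" "\<And>x. contract q w (top_vec (length w)) x = c *\<^sub>C (\<lambda>t. x (replicate (length w) Minus @ t))" by blast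
  then show ?case using q0
    by (intro exI [of _ "q powi (- a) * c"]) (simp add: top_vec_Suc component_apply scaleC_scaleC)
qed

text \<open>The coproduct splits a generator over \<open>w\<close> and \<open>v\<close>, and the
  part on \<open>w\<close> is moved to \<open>f\<close> as its adjoint: for instance e_1 has the
  adjoint q K^{-1} f_0. The last two formulas cancel K against K^{-1} on components of
  \<open>f\<close>, which is where its level is used.\<close>

lemma contract_word_op:
  assumes "f \<in> level (length w)"
  defines "u \<equiv> map uminus w"
  shows "contract q w f (word_op q (w @ v) Kp x) = word_op q v Kp (contract q w (word_op q u Km f) x)" (is ?Kp)
    and "contract q w f (word_op q (w @ v) Km x) = word_op q v Km (contract q w (word_op q u Kp f) x)" (is ?Km)
    and "contract q w f (word_op q (w @ v) E1 x) = word_op q v E1 (contract q w f x) + q *\<^sub>C word_op q v Kp (contract q w (word_op q u Km (word_op q u F0 f)) x)" (is ?E1)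
    and "contract q w f (word_op q (w @ v) E0 x) = word_op q v E0 (contract q w f x) + q *\<^sub>C word_op q v Km (contract q w (word_op q u Kp (word_op q u F1 f)) x)" (is ?E0)
    and "contract q w f (word_op q (w @ v) F1 x) = word_op q v F1 (contract q w (word_op q u Kp f) x) + q *\<^sub>C contract q w (word_op q u Kp (word_op q u E0 f)) x" (is ?F1)
    and "contract q w f (word_op q (w @ v) F0 x) = word_op q v F0 (contract q w (word_op q u Km f) x) + q *\<^sub>C contract q w (word_op q u Km (word_op q u E1 f)) x" (is ?F0)
proof -
  note lin = contract_linear word_op_add word_op_scale scaleC_add_right scaleC_scaleC
  have Kp: "contract q w f (word_op q (w @ v) Kp x) = word_op q v Kp (contract q w (word_op q (map uminus w) Km f) x)" for w f x
    using q0 by (induction w arbitrary: f x) (simp_all add: lin triv_op_def ac_simps)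
  have Km: "contract q w f (word_op q (w @ v) Km x) = word_op q v Km (contract q w (word_op q (map uminus w) Kp f) x)" for w f x
    using q0 by (induction w arbitrary: f x) (simp_all add: lin triv_op_def ac_simps)
  show ?Kp ?Km unfolding u_def by (rule Kp Km)+
  show ?E1 unfolding u_def using q0
  proof (induction w arbitrary: f x)
    case (Cons a w)
    show ?case using q0
      apply (simp add: lin Kp Cons.IH)
      apply (simp add: pointwise power_int_minus field_simps)
      done
  qed (simp add: triv_op_def lin)
  show ?E0 unfolding u_def using q0
  proof (induction w arbitrary: f x)
    case (Cons a w)
    show ?case using q0
      apply (simp add: lin Km Cons.IH)
      apply (simp add: pointwise power_int_minus field_simps)
      done
  qed (simp add: triv_op_def lin)
  show ?F1 unfolding u_def using q0 assms(1)
  proof (induction w arbitrary: f x)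
    case (Cons a w)
    have c: "component s f \<in> level (length (map uminus w))" and c': "component s f \<in> level (length w)" for s
      using Cons.prems by simp_all
    show ?case using q0
      apply (simp add: lin Cons.IH c' commutations(1) [OF c])
      apply (simp add: pointwise power_int_minus field_simps)
      done
  qed (simp add: triv_op_def lin)
  show ?F0 unfolding u_def using q0 assms(1)
  proof (induction w arbitrary: f x)
    case (Cons a w)
    have c: "component s f \<in> level (length (map uminus w))" and c': "component s f \<in> level (length w)" for s
      using Cons.prems by simp_all
    show ?case using q0
      apply (simp add: lin Cons.IH c' commutations(2) [OF c])
      apply (simp add: pointwise power_int_minus field_simps)
      done
  qed (simp add: triv_op_def lin)
qed

lemma contract_word_op_scalar:
  assumes "f \<in> level (length w)"
  defines "u \<equiv> map uminus w"
  shows "contract q w (word_op q u Km f) x = contract q w f (word_op q w Kp x)"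
    and "contract q w (word_op q u Kp f) x = contract q w f (word_op q w Km x)"
    and "q *\<^sub>C contract q w (word_op q u Km (word_op q u F0 f)) x = contract q w f (word_op q w E1 x)"
    and "q *\<^sub>C contract q w (word_op q u Kp (word_op q u F1 f)) x = contract q w f (word_op q w E0 x)"
    and "q *\<^sub>C contract q w (word_op q u Kp (word_op q u E0 f)) x = contract q w f (word_op q w F1 x)"
    and "q *\<^sub>C contract q w (word_op q u Km (word_op q u E1 f)) x = contract q w f (word_op q w F0 x)"
  using contract_word_op [OF assms(1), of "[]" x] unfolding u_def by (simp_all add: triv_op_def)

text \<open>By the adjunction, a generator applied to \<open>f\<close> pairs with \<open>L\<close>
  like a generator applied to \<open>L\<close>, up to the factor q and a power of K, and K is
  invertible on the level.\<close>

lemma annihilator_submod: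
  assumes "submod w L"
  shows "submod (map uminus w) {f \<in> level (length w). \<forall>x\<in>L. contract q w f x = 0}" (is "submod ?u ?N")
proof (rule submodI)
  note L = submodD [OF assms]
  fix g f assume f: "f \<in> ?N"
  then have fl: "f \<in> level (length w)" and f0: "\<And>x. x \<in> L \<Longrightarrow> contract q w f x = 0" by auto
  have u: "word_op q ?u g f \<in> level (length w)" if "f \<in> level (length w)" for g f
    using that word_op_level [of f ?u q g] by simp
  note scalar = contract_word_op_scalar [OF fl]
  have K: "word_op q ?u Kp f \<in> ?N" "word_op q ?u Km f \<in> ?N" if "f \<in> ?N" for f
    using that u contract_word_op_scalar(1,2) [of f w] L(6) by auto
  have q: "y = 0" if "q *\<^sub>C y = 0" for y using that q0 by simp
  have Km: "word_op q ?u g f \<in> ?N" if "\<And>x. x \<in> L \<Longrightarrow> q *\<^sub>C contract q w (word_op q ?u Km (word_op q ?u g f)) x = 0" for g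
  proof -
    have "word_op q ?u Km (word_op q ?u g f) \<in> ?N" using that q u fl by blast
    from K(1) [OF this] show ?thesis using commutations(1) [of "word_op q ?u g f" ?u] u [OF fl] by simp
  qed
  have Kp: "word_op q ?u g f \<in> ?N" if "\<And>x. x \<in> L \<Longrightarrow> q *\<^sub>C contract q w (word_op q ?u Kp (word_op q ?u g f)) x = 0" for g
  proof -
    have "word_op q ?u Kp (word_op q ?u g f) \<in> ?N" using that q u fl by blast
    from K(2) [OF this] show ?thesis using commutations(2) [of "word_op q ?u g f" ?u] u [OF fl] by simp
  qed
  show "word_op q ?u g f \<in> ?N"
  proof (cases g)
    case E0 then show ?thesis using Kp [of E0] scalar(5) f0 L(6) by simp
  next
    case E1 then show ?thesis using Km [of E1] scalar(6) f0 L(6) by simp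
  next
    case F0 then show ?thesis using Km [of F0] scalar(3) f0 L(6) by simp
  next
    case F1 then show ?thesis using Kp [of F1] scalar(4) f0 L(6) by simp
  qed (use K f in blast)+
qed (auto simp: contract_linear)

text \<open>Dual to \<open>cyclic\<close>. The annihilator of a nonzero \<open>L\<close> is a proper
  submodule of the increasing word with negated letters, so it misses the top vector. Pairing with
  that vector reads the coefficient of v_-^n, so some element of \<open>L\<close> has it nonzero,
  and its lowest weight component is a multiple of v_-^n.\<close>

lemma cocyclic:
  assumes L: "submod w L" and "sorted (map uminus w)" "x \<in> L" "x \<noteq> 0"
  shows "bottom_vec (length w) \<in> L"
proof -
  let ?N = "{f \<in> level (length w). \<forall>x\<in>L. contract q w f x = 0}"
  have "top_vec (length w) \<notin> ?N"
  proof
    assume "top_vec (length w) \<in> ?N"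
    then have N: "?N = level (length w)"
      using cyclic [OF annihilator_submod [OF L]] assms(2) by simp
    have "x s = 0" for s
    proof (cases "length s = length w")
      case True
      from contract_slice [OF q0 True] obtain f where f: "f \<in> level (length w)" "\<And>x. contract q w f x = (\<lambda>t. x (s @ t))" by blast
      from f(1) have "f \<in> ?N" by (subst N)
      then have "(\<lambda>t. x (s @ t)) = 0" using assms(3) f(2) by auto
      from fun_cong [OF this, of "[]"] show ?thesis by (simp add: zero_fun_apply)
    next
      case False
      then show ?thesis using submodD(5) [OF L assms(3)] by (simp add: level_def)
    qed
    then show False using assms(4) by (simp add: pointwise)
  qed
  then obtain y where y: "y \<in> L" "contract q w (top_vec (length w)) y \<noteq> 0" by auto
  obtain c where c: "contract q w (top_vec (length w)) y = c *\<^sub>C (\<lambda>t. y (replicate (length w) Minus @ t))"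
    using contract_top_vec by blast
  have "y (replicate (length w) Minus) \<noteq> 0"
  proof
    assume *: "y (replicate (length w) Minus) = 0"
    have "y (replicate (length w) Minus @ t) = 0" for t
    proof (cases t)
      case (Cons a s)
      then show ?thesis using submodD(5) [OF L y(1)] by (simp add: level_def)
    qed (simp add: *)
    then have "contract q w (top_vec (length w)) y = 0" unfolding c by (simp add: pointwise)
    then show False using y(2) by blast
  qed
  then show ?thesis using bottom_vec_mem [OF L y(1)] by blast
qed

section \<open>Simple subquotients\<close>

text \<open>Maps that relabel and rescale generators, needed because the contraction exchanges e_1
  with f_0 and e_0 with f_1. Surjectivity of \<sigma> and nonzero \<gamma> make images of submodules
  submodules.\<close>

definition twisted :: "(gen \<Rightarrow> gen) \<Rightarrow> (gen \<Rightarrow> complex) \<Rightarrow> int list \<Rightarrow> int list \<Rightarrow>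
    ((sign list \<Rightarrow> complex) \<Rightarrow> sign list \<Rightarrow> complex) \<Rightarrow> bool" where
  "twisted \<sigma> \<gamma> w w' T \<longleftrightarrow> (\<forall>x y. T (x + y) = T x + T y) \<and> (\<forall>c x. T (c *\<^sub>C x) = c *\<^sub>C T x) \<and>
     (\<forall>x\<in>level (length w). T x \<in> level (length w')) \<and>
     (\<forall>g. \<forall>x\<in>level (length w). T (word_op q w g x) = \<gamma> g *\<^sub>C word_op q w' (\<sigma> g) (T x)) \<and> surj \<sigma> \<and> (\<forall>g. \<gamma> g \<noteq> 0)"

lemma twistedD:
  assumes "twisted \<sigma> \<gamma> w w' T"
  shows "T (x + y) = T x + T y" "T (c *\<^sub>C x) = c *\<^sub>C T x" "T (x - y) = T x - T y" "T 0 = 0"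
    "x \<in> level (length w) \<Longrightarrow> T x \<in> level (length w')"
    "x \<in> level (length w) \<Longrightarrow> T (word_op q w g x) = \<gamma> g *\<^sub>C word_op q w' (\<sigma> g) (T x)"
    "\<exists>h. \<sigma> h = g" "\<gamma> g \<noteq> 0"
proof -
  show a: "T (x + y) = T x + T y" and c: "T (c *\<^sub>C x) = c *\<^sub>C T x" for x y c using assms by (auto simp: twisted_def)
  have "T (x + (-1) *\<^sub>C y) = T x - T y"
    unfolding a c by (simp add: cvs.scale_minus_left scaleC_one)
  then show "T (x - y) = T x - T y" by (simp add: cvs.scale_minus_left scaleC_one)
  show "T 0 = 0" using c [of 0 0] by simp
  show "\<exists>h. \<sigma> h = g" using assms unfolding twisted_def surj_def by metis
qed (use assms in \<open>auto simp: twisted_def\<close>)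

lemma intertwiner_twisted: "intertwiner w w' T \<Longrightarrow> twisted id (\<lambda>_. 1) w w' T"
  by (simp add: intertwiner_def twisted_def scaleC_one)

lemma image_submod:
  assumes T: "twisted \<sigma> \<gamma> w w' T" and L: "submod w L"
  shows "submod w' (T ` L)"
proof (rule submodI)
  note T = twistedD [OF T] and L = submodD [OF L]
  fix g y assume "y \<in> T ` L"
  then obtain x where x: "x \<in> L" "y = T x" by blast
  obtain h where h: "\<sigma> h = g" using T(7) by blast
  have "T (inverse (\<gamma> h) *\<^sub>C word_op q w h x) = word_op q w' g y"
    using T(8) [of h] by (simp add: T(2,6) L(5) x h scaleC_scaleC scaleC_one)
  then show "word_op q w' g y \<in> T ` L" using L(4) [OF L(6) [OF x(1)]] by (metis imageI)
qed (use twistedD [OF T] submodD [OF L] in \<open>auto simp: image_iff, metis+\<close>)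

lemma vimage_submod:
  assumes T: "twisted \<sigma> \<gamma> w w' T" and L: "submod w' L"
  shows "submod w {x \<in> level (length w). T x \<in> L}"
  by (rule submodI) (use twistedD [OF T] submodD [OF L] in auto)

lemma sum_submod:
  assumes "submod w A" "submod w B"
  shows "submod w {a + b |a b. a \<in> A \<and> b \<in> B}"
proof (rule submodI)
  note A = submodD [OF assms(1)] and B = submodD [OF assms(2)]
  show "0 \<in> {a + b |a b. a \<in> A \<and> b \<in> B}" using A(1) B(1) by (metis (mono_tags, lifting) add_0 mem_Collect_eq)
  fix x y assume "x \<in> {a + b |a b. a \<in> A \<and> b \<in> B}" "y \<in> {a + b |a b. a \<in> A \<and> b \<in> B}"
  then obtain a b a' b' where "x = a + b" "y = a' + b'" "a \<in> A" "b \<in> B" "a' \<in> A" "b' \<in> B" by blast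
  then have "x + y = (a + a') + (b + b')" "a + a' \<in> A" "b + b' \<in> B" by (auto simp: A B algebra_simps)
  then show "x + y \<in> {a + b |a b. a \<in> A \<and> b \<in> B}" by blast
next
  note A = submodD [OF assms(1)] and B = submodD [OF assms(2)]
  fix x assume "x \<in> {a + b |a b. a \<in> A \<and> b \<in> B}"
  then obtain a b where x: "x = a + b" "a \<in> A" "b \<in> B" by blast
  show "c *\<^sub>C x \<in> {a + b |a b. a \<in> A \<and> b \<in> B}" for c
    using x A(4) [of a c] B(4) [of b c] scaleC_add_right [of c a b] by blast
  show "x \<in> level (length w)" using x A(5) B(5) by auto
  show "word_op q w g x \<in> {a + b |a b. a \<in> A \<and> b \<in> B}" for g
    using x A(6) [of a g] B(6) [of b g] word_op_add [of q w g a b] by blast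
qed

lemma inter_submod: "submod w A \<Longrightarrow> submod w B \<Longrightarrow> submod w (A \<inter> B)"
  unfolding submod_def by (auto simp: cvs.subspace_inter)

text \<open>A simple subquotient is kept as the pair of submodules; no quotient is formed, and
  statements about M / N are statements modulo N.\<close>

definition simple_subquotient :: "int list \<Rightarrow> (sign list \<Rightarrow> complex) set \<Rightarrow> (sign list \<Rightarrow> complex) set \<Rightarrow> bool" where
  "simple_subquotient w N M \<longleftrightarrow> submod w N \<and> submod w M \<and> N \<subset> M \<and> (\<forall>L. submod w L \<longrightarrow> N \<subseteq> L \<longrightarrow> L \<subseteq> M \<longrightarrow> L = N \<or> L = M)"

text \<open>N + (M \<inter> A) lies between N and M and is not N, so simplicity makes it all of
  M.\<close>

lemma simple_decompose:
  assumes s: "simple_subquotient w N M" and A: "submod w A" and ne: "\<not> M \<inter> A \<subseteq> N" and m: "m \<in> M"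
  obtains n a where "n \<in> N" "a \<in> M" "a \<in> A" "m = n + a"
proof -
  have N: "submod w N" and M: "submod w M" and NM: "N \<subset> M" using s by (auto simp: simple_subquotient_def)
  let ?S = "{a + b |a b. a \<in> N \<and> b \<in> M \<inter> A}"
  have S: "submod w ?S" by (intro sum_submod inter_submod N M A)
  have "N \<subseteq> ?S"
  proof
    fix n assume "n \<in> N"
    moreover have "0 \<in> M \<inter> A" using submodD(1) [OF M] submodD(1) [OF A] by blast
    ultimately show "n \<in> ?S" by (metis (mono_tags, lifting) add_0_right mem_Collect_eq)
  qed
  moreover have "?S \<subseteq> M" using NM submodD(2) [OF M] by blast
  ultimately have "?S = N \<or> ?S = M" using s S unfolding simple_subquotient_def by blast
  moreover have "?S \<noteq> N"
  proof
    assume *: "?S = N"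
    obtain a where a: "a \<in> M \<inter> A" "a \<notin> N" using ne by blast
    have "0 + a \<in> ?S" using a(1) submodD(1) [OF N] by blast
    then have "a \<in> ?S" unfolding add_0 .
    then show False unfolding * using a(2) by blast
  qed
  ultimately have "m \<in> ?S" using m by blast
  then show ?thesis using that by blast
qed

text \<open>If M meets the image of T outside N, then M is covered modulo N by that image, and T
  identifies the quotient of the preimages with M / N.\<close>

lemma simple_pull:
  assumes T: "twisted \<sigma> \<gamma> w w' T" and s: "simple_subquotient w' N M" and ne: "\<not> M \<inter> T ` level (length w) \<subseteq> N"
  shows "simple_subquotient w {x \<in> level (length w). T x \<in> N} {x \<in> level (length w). T x \<in> M}" (is "simple_subquotient w ?N ?M")
proof -
  note T' = twistedD [OF T]
  have N: "submod w' N" and M: "submod w' M" and NM: "N \<subset> M" using s by (auto simp: simple_subquotient_def)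
  have "L = ?N \<or> L = ?M" if L: "submod w L" "?N \<subseteq> L" "L \<subseteq> ?M" for L
  proof (cases "M \<inter> T ` L \<subseteq> N")
    case True
    have "L \<subseteq> ?N"
    proof
      fix x assume "x \<in> L"
      then have "x \<in> level (length w)" "T x \<in> M" using L(3) by auto
      then show "x \<in> ?N" using True \<open>x \<in> L\<close> by auto
    qed
    then show ?thesis using L(2) by auto
  next
    case False
    have "x \<in> L" if x: "x \<in> ?M" for x
    proof -
      from x have "T x \<in> M" by simp
      then obtain n a where na: "n \<in> N" "a \<in> M" "a \<in> T ` L" "T x = n + a"
        by (rule simple_decompose [OF s image_submod [OF T L(1)] False])
      then obtain l where l: "l \<in> L" "a = T l" by blast
      have "T (x - l) = n" using na l by (simp add: T')
      then have "x - l \<in> ?N" using x na(1) submodD(5) [OF L(1) l(1)] by simp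
      then show ?thesis using L(2) l(1) submodD(2) [OF L(1), of "x - l" l] by auto
    qed
    then show ?thesis using L(3) by blast
  qed
  moreover have "?N \<subset> ?M" using NM ne by blast
  ultimately show ?thesis
    unfolding simple_subquotient_def using vimage_submod [OF T N] vimage_submod [OF T M] by blast
qed

text \<open>If the kernel of T on M lies in N, then T identifies M / N with T M / T N.\<close>

lemma simple_push:
  assumes T: "twisted \<sigma> \<gamma> w w' T" and s: "simple_subquotient w N M" and k: "\<And>x. x \<in> M \<Longrightarrow> T x = 0 \<Longrightarrow> x \<in> N"
  shows "simple_subquotient w' (T ` N) (T ` M)"
proof -
  note T' = twistedD [OF T]
  have N: "submod w N" and M: "submod w M" and NM: "N \<subset> M" using s by (auto simp: simple_subquotient_def)
  have "T ` M \<noteq> T ` N"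
  proof
    assume *: "T ` M = T ` N"
    have "m \<in> N" if m: "m \<in> M" for m
    proof -
      obtain n where n: "n \<in> N" "T m = T n" using * m by (metis imageE imageI)
      have "m - n \<in> N" using k [of "m - n"] m n NM submodD(3) [OF M, of m n] by (auto simp: T')
      then show ?thesis using submodD(2) [OF N, of "m - n" n] n(1) by simp
    qed
    then show False using NM by blast
  qed
  moreover have "L = T ` N \<or> L = T ` M" if L: "submod w' L" "T ` N \<subseteq> L" "L \<subseteq> T ` M" for L
  proof -
    let ?L = "{x \<in> level (length w). T x \<in> L} \<inter> M"
    have "submod w ?L" by (intro inter_submod vimage_submod [OF T] L M)
    moreover have "N \<subseteq> ?L" using NM L(2) submodD(5) [OF N] by auto
    ultimately have "?L = N \<or> ?L = M" using s unfolding simple_subquotient_def by blast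
    then show ?thesis using L submodD(5) [OF M] by blast
  qed
  ultimately show ?thesis
    unfolding simple_subquotient_def using image_submod [OF T N] image_submod [OF T M] NM by blast
qed

text \<open>
  \<open>y\<close> spans the lowest weight space of $M / N$, where $f_0^k y = q^{-s} e_1^k y \neq 0$ with \<open>s\<close> the
  sum of the letters of \<open>c\<close>. This is what remains of the Drinfeld polynomial, and it is all that is
  needed to tell apart subquotients of words with distant letters.
\<close>

definition fundamental :: "int set \<Rightarrow> int list \<Rightarrow> (sign list \<Rightarrow> complex) set \<Rightarrow> (sign list \<Rightarrow> complex) set \<Rightarrow> bool" where
  "fundamental S w N M \<longleftrightarrow> (\<exists>c y. set c \<subseteq> S \<and> y \<in> M \<and>
     word_op q w Kp y - q powi (- int (length c)) *\<^sub>C y \<in> N \<and>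
     (word_op q w E1 ^^ length c) y \<notin> N \<and>
     (word_op q w F0 ^^ length c) y - q powi (- sum_list c) *\<^sub>C (word_op q w E1 ^^ length c) y \<in> N \<and>
     (\<forall>m\<in>M. \<forall>j. word_op q w Kp m - q powi j *\<^sub>C m \<in> N \<longrightarrow> m \<in> N \<or> \<bar>j\<bar> \<le> int (length c)) \<and>
     (\<forall>m\<in>M. word_op q w Kp m - q powi (- int (length c)) *\<^sub>C m \<in> N \<longrightarrow> (\<exists>\<alpha>. m - \<alpha> *\<^sub>C y \<in> N)))"

lemma iterate_mem: "submod w L \<Longrightarrow> x \<in> L \<Longrightarrow> (word_op q w g ^^ k) x \<in> L"
  by (induction k) (simp_all add: submodD(6))

lemma intertwiner_iterate:
  assumes T: "intertwiner w w' T" and x: "x \<in> level (length w)"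
  shows "T ((word_op q w g ^^ k) x) = (word_op q w' g ^^ k) (T x)"
  using iterate_mem [OF submod_level x] by (induction k) (simp_all add: intertwD(6) [OF T])

text \<open>The identification of \<open>simple_pull\<close> transports the lowest weight data. A
  plain intertwiner is required here, since a twist would interchange e_1 and f_0.\<close>

lemma fundamental_pull:
  assumes T: "intertwiner w w' T" and s: "simple_subquotient w' N M" and ne: "\<not> M \<inter> T ` level (length w) \<subseteq> N"
    and f: "fundamental S w {x \<in> level (length w). T x \<in> N} {x \<in> level (length w). T x \<in> M}" (is "fundamental S w ?N ?M")
  shows "fundamental S w' N M"
proof -
  note T' = intertwD [OF T]
  have N: "submod w' N" and M: "submod w' M" and NM: "N \<subset> M" using s by (auto simp: simple_subquotient_def)
  note N = submodD [OF N]
  obtain c y where c: "set c \<subseteq> S" and y: "y \<in> ?M"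
    and K: "word_op q w Kp y - q powi (- int (length c)) *\<^sub>C y \<in> ?N"
    and E: "(word_op q w E1 ^^ length c) y \<notin> ?N"
    and F: "(word_op q w F0 ^^ length c) y - q powi (- sum_list c) *\<^sub>C (word_op q w E1 ^^ length c) y \<in> ?N"
    and W: "\<And>m j. m \<in> ?M \<Longrightarrow> word_op q w Kp m - q powi j *\<^sub>C m \<in> ?N \<Longrightarrow> m \<in> ?N \<or> \<bar>j\<bar> \<le> int (length c)"
    and U: "\<And>m. m \<in> ?M \<Longrightarrow> word_op q w Kp m - q powi (- int (length c)) *\<^sub>C m \<in> ?N \<Longrightarrow> \<exists>\<alpha>. m - \<alpha> *\<^sub>C y \<in> ?N"
    using f unfolding fundamental_def by blast
  have yl: "y \<in> level (length w)" using y by simp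
  note It = intertwiner_iterate [OF T yl]
  have el: "(word_op q w E1 ^^ length c) y \<in> level (length w)" by (rule iterate_mem [OF submod_level yl])
  \<comment> \<open>Each m in M is T x modulo N, and a weight vector modulo N lifts to a weight
    vector modulo the preimage of N.\<close>
  have D: "\<exists>n\<in>N. \<exists>x\<in>?M. m = n + T x \<and> (\<forall>j. word_op q w' Kp m - q powi j *\<^sub>C m \<in> N \<longrightarrow> word_op q w Kp x - q powi j *\<^sub>C x \<in> ?N)" if m: "m \<in> M" for m
  proof -
    from m obtain n a where na: "n \<in> N" "a \<in> M" "a \<in> T ` level (length w)" "m = n + a"
      by (rule simple_decompose [OF s image_submod [OF intertwiner_twisted [OF T] submod_level] ne])
    then obtain x where x: "x \<in> level (length w)" "a = T x" by blast
    have "word_op q w Kp x - q powi j *\<^sub>C x \<in> ?N" if j: "word_op q w' Kp m - q powi j *\<^sub>C m \<in> N" for j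
    proof -
      have "T (word_op q w Kp x - q powi j *\<^sub>C x) = (word_op q w' Kp m - q powi j *\<^sub>C m) - (word_op q w' Kp n - q powi j *\<^sub>C n)"
        unfolding na(4) by (simp add: T' x word_op_lin scaleC_add_right)
      also have "\<dots> \<in> N"
        by (rule N(3) [OF j N(3) [OF N(6) [OF na(1)] N(4) [OF na(1)]]])
      finally show ?thesis using x by simp
    qed
    moreover have "x \<in> ?M" "m = n + T x" using na x by simp_all
    ultimately show ?thesis using na(1) by blast
  qed
  show ?thesis unfolding fundamental_def
  proof (rule exI [of _ c], rule exI [of _ "T y"], intro conjI ballI allI impI)
    show "set c \<subseteq> S" by fact
    show "T y \<in> M" using y by simp
    show "word_op q w' Kp (T y) - q powi (- int (length c)) *\<^sub>C T y \<in> N" using K yl by (simp add: T')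
    show "(word_op q w' E1 ^^ length c) (T y) \<notin> N" using E el by (simp add: It)
    show "(word_op q w' F0 ^^ length c) (T y) - q powi (- sum_list c) *\<^sub>C (word_op q w' E1 ^^ length c) (T y) \<in> N"
      using F by (simp add: T' It)
  next
    fix m j assume m: "m \<in> M" "word_op q w' Kp m - q powi j *\<^sub>C m \<in> N"
    then obtain n x where "n \<in> N" "x \<in> ?M" "m = n + T x" "word_op q w Kp x - q powi j *\<^sub>C x \<in> ?N" using D by blast
    then show "m \<in> N \<or> \<bar>j\<bar> \<le> int (length c)" using W [of x j] N(2) by blast
  next
    fix m assume m: "m \<in> M" "word_op q w' Kp m - q powi (- int (length c)) *\<^sub>C m \<in> N"
    then obtain n x where x: "n \<in> N" "x \<in> ?M" "m = n + T x" "word_op q w Kp x - q powi (- int (length c)) *\<^sub>C x \<in> ?N" using D by blast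
    then obtain \<alpha> where "x - \<alpha> *\<^sub>C y \<in> ?N" using U by blast
    then have "n + T (x - \<alpha> *\<^sub>C y) \<in> N" using x N(2) by blast
    then show "\<exists>\<alpha>. m - \<alpha> *\<^sub>C T y \<in> N" unfolding x(3) by (auto simp: T' add_diff_eq)
  qed
qed

text \<open>On M, membership of T x in T N is the same as membership of x in N, so each condition
  can be read back through T.\<close>

lemma fundamental_push:
  assumes T: "intertwiner w w' T" and s: "simple_subquotient w N M" and k: "\<And>x. x \<in> M \<Longrightarrow> T x = 0 \<Longrightarrow> x \<in> N"
    and f: "fundamental S w' (T ` N) (T ` M)"
  shows "fundamental S w N M"
proof -
  note T' = intertwD [OF T]
  have N: "submod w N" and M: "submod w M" and NM: "N \<subset> M" using s by (auto simp: simple_subquotient_def)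
  note Nd = submodD [OF N] and Md = submodD [OF M]
  have TN: "x \<in> N" if "x \<in> M" "T x \<in> T ` N" for x
  proof -
    from that(2) obtain n where n: "n \<in> N" "T x = T n" by blast
    then have "x - n \<in> N" using k [of "x - n"] NM Md(3) [OF that(1), of n] by (auto simp: T')
    then show ?thesis using Nd(2) [of "x - n" n] n by simp
  qed
  obtain c y where c: "set c \<subseteq> S" and y: "y \<in> M"
    and K: "word_op q w' Kp (T y) - q powi (- int (length c)) *\<^sub>C T y \<in> T ` N"
    and E: "(word_op q w' E1 ^^ length c) (T y) \<notin> T ` N"
    and F: "(word_op q w' F0 ^^ length c) (T y) - q powi (- sum_list c) *\<^sub>C (word_op q w' E1 ^^ length c) (T y) \<in> T ` N"
    and W: "\<And>m j. m \<in> M \<Longrightarrow> word_op q w' Kp (T m) - q powi j *\<^sub>C T m \<in> T ` N \<Longrightarrow> T m \<in> T ` N \<or> \<bar>j\<bar> \<le> int (length c)"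
    and U: "\<And>m. m \<in> M \<Longrightarrow> word_op q w' Kp (T m) - q powi (- int (length c)) *\<^sub>C T m \<in> T ` N \<Longrightarrow> \<exists>\<alpha>. T m - \<alpha> *\<^sub>C T y \<in> T ` N"
    using f unfolding fundamental_def by blast
  have yl: "y \<in> level (length w)" using y Md(5) by blast
  note It = intertwiner_iterate [OF T yl]
  note im = iterate_mem [OF M y]
  show ?thesis unfolding fundamental_def
  proof (rule exI [of _ c], rule exI [of _ y], intro conjI ballI allI impI)
    show "set c \<subseteq> S" by fact
    show "y \<in> M" by fact
    show "word_op q w Kp y - q powi (- int (length c)) *\<^sub>C y \<in> N"
      using K y by (intro TN Md) (simp_all add: T' yl)
    show "(word_op q w E1 ^^ length c) y \<notin> N" using E It by (metis imageI)
    show "(word_op q w F0 ^^ length c) y - q powi (- sum_list c) *\<^sub>C (word_op q w E1 ^^ length c) y \<in> N"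
      using F im by (intro TN Md) (simp_all add: T' It)
  next
    fix m j assume m: "m \<in> M" "word_op q w Kp m - q powi j *\<^sub>C m \<in> N"
    from m(2) have "T (word_op q w Kp m - q powi j *\<^sub>C m) \<in> T ` N" by (rule imageI)
    then have "T m \<in> T ` N \<or> \<bar>j\<bar> \<le> int (length c)"
      using Md(5) [OF m(1)] by (intro W [OF m(1)]) (simp add: T')
    then show "m \<in> N \<or> \<bar>j\<bar> \<le> int (length c)" using TN [OF m(1)] by (elim disjE) simp_all
  next
    fix m assume m: "m \<in> M" "word_op q w Kp m - q powi (- int (length c)) *\<^sub>C m \<in> N"
    from m(2) have "T (word_op q w Kp m - q powi (- int (length c)) *\<^sub>C m) \<in> T ` N" by (rule imageI)
    then have "word_op q w' Kp (T m) - q powi (- int (length c)) *\<^sub>C T m \<in> T ` N"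
      using Md(5) [OF m(1)] by (simp add: T')
    from U [OF m(1) this] obtain \<alpha> where "T m - \<alpha> *\<^sub>C T y \<in> T ` N" ..
    then have "m - \<alpha> *\<^sub>C y \<in> N" using m(1) y by (intro TN Md) (simp_all add: T')
    then show "\<exists>\<alpha>. m - \<alpha> *\<^sub>C y \<in> N" ..
  qed
qed

end

section \<open>A measure for sorting words by adjacent exchanges\<close>

fun ascents :: "int list \<Rightarrow> nat" where
  "ascents [] = 0"
| "ascents (a # w) = length (filter (\<lambda>b. a < b) w) + ascents w"

lemma ascents_swap: "a < b \<Longrightarrow> ascents (u @ a # b # v) = Suc (ascents (u @ b # a # v))"
  by (induction u) auto

lemma not_sorted_adjacent:
  fixes w :: "'a::linorder list"
  shows "\<not> sorted w \<Longrightarrow> \<exists>u a b v. w = u @ b # a # v \<and> a < b"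
proof (induction w rule: induct_list012)
  case (3 x y zs)
  show ?case
  proof (cases "x \<le> y")
    case True
    then have "\<not> sorted (y # zs)" using 3(3) True by (metis sorted2)
    then obtain u a b v where "y # zs = u @ b # a # v" "a < b" using 3(2) by blast
    then have "x # y # zs = (x # u) @ b # a # v \<and> a < b" by simp
    then show ?thesis by blast
  next
    case False
    then have "x # y # zs = [] @ x # y # zs \<and> y < x" by simp
    then show ?thesis by blast
  qed
qed auto

lemma not_desc_adjacent:
  fixes w :: "int list"
  assumes "\<not> sorted (map uminus w)"
  obtains u a b v where "w = u @ a # b # v" "a < b"
proof -
  obtain u a b v where *: "map uminus w = u @ b # a # v" "a < b"
    using not_sorted_adjacent [OF assms] by blast
  have "w = map uminus (map uminus w)" by (simp add: comp_def)
  also have "\<dots> = map uminus u @ (- b) # (- a) # map uminus v" by (simp add: *)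
  finally show ?thesis using that * by auto
qed

context generic_q
begin

text \<open>A nonzero N would contain v_-^n, hence v_+^n, hence the whole image of the increasing
  word and so M. Therefore N = 0, and M contains v_-^n, on which all data are known with c =
  w.\<close>

lemma fundamental_base:
  assumes s: "simple_subquotient w N M" and w: "sorted (map uminus w)" "set w \<subseteq> S" and \<phi>: "intertwiner w0 w \<phi>" "sorted w0" "length w0 = length w"
    and c: "c \<noteq> 0" "\<phi> (top_vec (length w)) = c *\<^sub>C top_vec (length w)" and M: "M \<subseteq> \<phi> ` level (length w)"
  shows "fundamental S w N M"
proof -
  have Ns: "submod w N" and Ms: "submod w M" and NM: "N \<subset> M" using s by (auto simp: simple_subquotient_def)
  note Nd = submodD [OF Ns] and Md = submodD [OF Ms]
  let ?n = "length w"
  have N0: "N = {0}"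
  proof (rule ccontr)
    assume "N \<noteq> {0}"
    then obtain x where "x \<in> N" "x \<noteq> 0" using Nd(1) by blast
    then have "top_vec ?n \<in> N" using cocyclic [OF Ns w(1)] top_vec_mem_if_bottom_vec_mem [OF Ns] by blast
    then have "\<phi> (top_vec ?n) \<in> N" unfolding c(2) by (rule Nd(4))
    then have "{x \<in> level (length w0). \<phi> x \<in> N} = level (length w0)"
      using cyclic [OF vimage_submod [OF intertwiner_twisted [OF \<phi>(1)] Ns] _ \<phi>(2)] \<phi>(3) by simp
    then have "\<phi> ` level ?n \<subseteq> N" unfolding \<phi>(3) by blast
    then show False using M NM by blast
  qed
  obtain x where "x \<in> M" "x \<noteq> 0" using NM N0 Md(1) by blast
  then have bottom_vec: "bottom_vec ?n \<in> M" using cocyclic [OF Ms w(1)] by blast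
  show ?thesis unfolding fundamental_def
  proof (rule exI [of _ w], rule exI [of _ "bottom_vec ?n"], intro conjI ballI allI impI)
    show "word_op q w Kp (bottom_vec ?n) - q powi (- int ?n) *\<^sub>C bottom_vec ?n \<in> N" by (simp add: bottom_vec_weight N0)
    show "(word_op q w E1 ^^ ?n) (bottom_vec ?n) \<notin> N" by (simp add: E1_power N0 qfact_nonzero)
    show "(word_op q w F0 ^^ ?n) (bottom_vec ?n) - q powi (- sum_list w) *\<^sub>C (word_op q w E1 ^^ ?n) (bottom_vec ?n) \<in> N"
      by (simp add: E1_power F0_power N0 scaleC_scaleC mult.commute)
  next
    fix m j assume m: "m \<in> M" "word_op q w Kp m - q powi j *\<^sub>C m \<in> N"
    show "m \<in> N \<or> \<bar>j\<bar> \<le> int ?n"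
    proof (cases "m = 0")
      case False
      then obtain t where "m t \<noteq> 0" by (auto simp: pointwise)
      then show ?thesis using weight_vectorD(2) [of m w j t] m Md(5) by (simp add: N0)
    qed (simp add: N0)
  next
    fix m assume m: "m \<in> M" "word_op q w Kp m - q powi (- int ?n) *\<^sub>C m \<in> N"
    then have "m = m (replicate ?n Minus) *\<^sub>C bottom_vec ?n" using Md(5) by (intro lowest_weight_vector) (simp_all add: N0)
    then have "m - m (replicate ?n Minus) *\<^sub>C bottom_vec ?n \<in> N" by (simp add: N0)
    then show "\<exists>\<alpha>. m - \<alpha> *\<^sub>C bottom_vec ?n \<in> N" ..
  qed (use w bottom_vec in auto)
qed

text \<open>
  Sorting an increasing word into decreasing order by exchanges: a simple subquotient is carried
  along until it either falls into the kernel of an exchange, hence into a shorter word, or arrives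
  inside the image of the increasing word. That image is simple, being cyclic on $v_+^{\otimes n}$
  and cocyclic.
\<close>

lemma fundamental_from_image:
  assumes shorter: "\<And>v N M. length v < length w \<Longrightarrow> set v \<subseteq> S \<Longrightarrow> simple_subquotient v N M \<Longrightarrow> fundamental S v N M"
    and "simple_subquotient w N M" "set w \<subseteq> S" "intertwiner w0 w \<phi>" "sorted w0" "length w0 = length w"
    and "c \<noteq> 0" "\<phi> (top_vec (length w)) = c *\<^sub>C top_vec (length w)" "M \<subseteq> \<phi> ` level (length w)"
  shows "fundamental S w N M"
  using assms
proof (induction "ascents w" arbitrary: w N M \<phi> c)
  case (0 w N M \<phi> c)
  have "sorted (map uminus w)"
  proof (rule ccontr)
    assume "\<not> sorted (map uminus w)"
    then obtain u a b v where "w = u @ a # b # v" "a < b" by (rule not_desc_adjacent)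
    then show False using 0(1) ascents_swap by simp
  qed
  then show ?case using fundamental_base 0 by blast
next
  case (Suc k w N M \<phi> c)
  show ?case
  proof (cases "sorted (map uminus w)")
    case True
    then show ?thesis using fundamental_base Suc by blast
  next
    case False
    then obtain u a b v where w: "w = u @ a # b # v" and ab: "a < b" by (rule not_desc_adjacent)
    let ?w' = "u @ b # a # v"
    obtain T \<iota> \<pi> where "exchange_maps w ?w' (u @ v) T \<iota> \<pi>" using exchange_maps_exists [OF ab] w by blast
    then have T: "intertwiner w ?w' T" and i: "intertwiner (u @ v) w \<iota>"
      and "\<exists>d. d \<noteq> 0 \<and> T (top_vec (length w)) = d *\<^sub>C top_vec (length w)"
      and k: "\<And>x. x\<in>level (length w) \<Longrightarrow> T x = 0 \<Longrightarrow> \<exists>y\<in>level (length (u @ v)). x = \<iota> y"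
      by (auto simp: exchange_maps_def)
    then obtain d where d: "d \<noteq> 0" "T (top_vec (length w)) = d *\<^sub>C top_vec (length w)" by blast
    have len: "length ?w' = length w" using w by simp
    have "submod w M" using Suc.prems(2) by (simp add: simple_subquotient_def)
    note Ml = submodD(5) [OF this]
    show ?thesis
    proof (cases "M \<inter> \<iota> ` level (length (u @ v)) \<subseteq> N")
      case True
      then have ker: "x \<in> N" if "x \<in> M" "T x = 0" for x using k [OF Ml] that by blast
      have f: "fundamental S ?w' (T ` N) (T ` M)"
      proof (rule Suc.hyps(1))
        show "k = ascents ?w'" using Suc.hyps(2) ascents_swap [OF ab, of u v] w by simp
        show "simple_subquotient ?w' (T ` N) (T ` M)" by (rule simple_push [OF intertwiner_twisted [OF T] Suc.prems(2) ker])
        show "intertwiner w0 ?w' (\<lambda>x. T (\<phi> x))" by (rule intertwiner_comp [OF Suc.prems(4) T])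
        show "T (\<phi> (top_vec (length ?w'))) = (c * d) *\<^sub>C top_vec (length ?w')"
          unfolding len Suc.prems(8) intertwD(2) [OF T] d(2) by (simp add: scaleC_scaleC)
        show "c * d \<noteq> 0" using d Suc.prems(7) by simp
        show "T ` M \<subseteq> (\<lambda>x. T (\<phi> x)) ` level (length ?w')" using Suc.prems(9) unfolding len by blast
        show "fundamental S v N M" if "length v < length ?w'" "set v \<subseteq> S" "simple_subquotient v N M" for v N M
          using Suc.prems(1) that len by simp
      qed (use Suc.prems w in auto)
      show ?thesis by (rule fundamental_push [OF T Suc.prems(2) ker f])
    next
      case False
      show ?thesis
      proof (rule fundamental_pull [OF i Suc.prems(2) False])
        show "fundamental S (u @ v) {x \<in> level (length (u @ v)). \<iota> x \<in> N} {x \<in> level (length (u @ v)). \<iota> x \<in> M}"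
          using Suc.prems(3) w by (intro Suc.prems(1) simple_pull [OF intertwiner_twisted [OF i] Suc.prems(2) False]) auto
      qed
    qed
  qed
qed

text \<open>
  An arbitrary word is first brought into increasing order, now walking the exchanges backwards and
  using their cokernels.
\<close>

lemma fundamental_from_shorter:
  assumes shorter: "\<And>v N M. length v < length w \<Longrightarrow> set v \<subseteq> S \<Longrightarrow> simple_subquotient v N M \<Longrightarrow> fundamental S v N M"
    and "simple_subquotient w N M" "set w \<subseteq> S"
  shows "fundamental S w N M"
  using assms
proof (induction "ascents (map uminus w)" arbitrary: w N M rule: less_induct)
  case (less w N M)
  have sM: "submod w M" and NM: "N \<subset> M" using less.prems(2) by (auto simp: simple_subquotient_def)
  note Ml = submodD(5) [OF sM]
  show ?case
  proof (cases "sorted w")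
    case True
    then show ?thesis
      using fundamental_from_image [OF less.prems intertwiner_id True, of 1] Ml by (simp add: scaleC_one subset_iff)
  next
    case False
    then obtain u a b v where w: "w = u @ b # a # v" and ab: "a < b" using not_sorted_adjacent by blast
    let ?w' = "u @ a # b # v"
    obtain T \<iota> \<pi> where "exchange_maps ?w' w (u @ v) T \<iota> \<pi>" using exchange_maps_exists [OF ab] w by blast
    then have T: "intertwiner ?w' w T" and p: "intertwiner w (u @ v) \<pi>"
      and k: "\<And>x. x\<in>level (length w) \<Longrightarrow> \<pi> x = 0 \<Longrightarrow> \<exists>y\<in>level (length ?w'). x = T y"
      by (auto simp: exchange_maps_def)
    show ?thesis
    proof (cases "M \<inter> T ` level (length ?w') \<subseteq> N")
      case True
      then have ker: "x \<in> N" if "x \<in> M" "\<pi> x = 0" for x using k [OF Ml] that by blast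
      have f: "fundamental S (u @ v) (\<pi> ` N) (\<pi> ` M)"
        using less.prems(3) w
        by (intro less.prems(1) simple_push [OF intertwiner_twisted [OF p] less.prems(2) ker]) auto
      show ?thesis by (rule fundamental_push [OF p less.prems(2) ker f])
    next
      case False
      show ?thesis
      proof (rule fundamental_pull [OF T less.prems(2) False])
        show "fundamental S ?w' {x \<in> level (length ?w'). T x \<in> N} {x \<in> level (length ?w'). T x \<in> M}"
        proof (rule less.hyps)
          show "ascents (map uminus ?w') < ascents (map uminus w)"
            using ascents_swap [of "- b" "- a" "map uminus u" "map uminus v"] ab w by simp
          show "simple_subquotient ?w' {x \<in> level (length ?w'). T x \<in> N} {x \<in> level (length ?w'). T x \<in> M}"
            by (rule simple_pull [OF intertwiner_twisted [OF T] less.prems(2) False])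
          show "fundamental S v N M" if "length v < length ?w'" "set v \<subseteq> S" "simple_subquotient v N M" for v N M
            using less.prems(1) that w by simp
        qed (use less.prems w in auto)
      qed
    qed
  qed
qed

theorem simple_subquotient_fundamental:
  assumes "simple_subquotient w N M" "set w \<subseteq> S"
  shows "fundamental S w N M"
  using assms
proof (induction "length w" arbitrary: w N M rule: less_induct)
  case less
  show ?case by (rule fundamental_from_shorter) (use less in auto)
qed

text \<open>M' is generated by y, and N is maximal among the submodules of M' that avoid y. A
  submodule strictly above N contains y and is all of M'.\<close>

lemma simple_exists:
  assumes M: "submod w M" and y: "y \<in> M" "y \<noteq> 0"
  obtains N M' where "simple_subquotient w N M'" "M' \<subseteq> M" "y \<in> M'" "y \<notin> N"
proof -
  define M' where "M' = \<Inter>{L. submod w L \<and> y \<in> L}"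
  have M': "submod w M'"
    unfolding M'_def by (rule submodI) (use M y in \<open>auto simp: submodD\<close>)
  have yM': "y \<in> M'" and min: "\<And>L. submod w L \<Longrightarrow> y \<in> L \<Longrightarrow> M' \<subseteq> L" by (auto simp: M'_def)
  let ?A = "{N. submod w N \<and> N \<subseteq> M' \<and> y \<notin> N}"
  have "\<exists>N\<in>?A. \<forall>X\<in>?A. N \<subseteq> X \<longrightarrow> X = N"
  proof (rule subset_Zorn_nonempty)
    have "{0} \<in> ?A" using submod_zero [of w] submodD(1) [OF M'] y(2) by simp
    then show "?A \<noteq> {}" by blast
    fix C assume C: "C \<noteq> {}" "subset.chain ?A C"
    then have CA: "\<And>X. X \<in> C \<Longrightarrow> submod w X \<and> X \<subseteq> M' \<and> y \<notin> X"
      and ch: "\<And>X Y. X \<in> C \<Longrightarrow> Y \<in> C \<Longrightarrow> X \<subseteq> Y \<or> Y \<subseteq> X"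
      by (auto simp: subset_chain_def)
    have "submod w (\<Union>C)"
    proof (rule submodI)
      obtain X where "X \<in> C" using C(1) by blast
      then show "0 \<in> \<Union>C" using CA [of X] submodD(1) [of w X] by blast
      fix x z assume "x \<in> \<Union>C" "z \<in> \<Union>C"
      then obtain X Y where "X \<in> C" "x \<in> X" "Y \<in> C" "z \<in> Y" by blast
      then obtain Z where "Z \<in> C" "x \<in> Z" "z \<in> Z" using ch [of X Y] by blast
      then show "x + z \<in> \<Union>C" using CA [of Z] submodD(2) [of w Z x z] by blast
    next
      fix x assume "x \<in> \<Union>C"
      then obtain X where X: "X \<in> C" "x \<in> X" by blast
      then have "submod w X" using CA by blast
      note X' = submodD(4-6) [OF this X(2)]
      show "c *\<^sub>C x \<in> \<Union>C" "x \<in> level (length w)" "word_op q w g x \<in> \<Union>C" for c g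
        using X' X(1) by blast+
    qed
    then show "\<Union>C \<in> ?A" using CA by blast
  qed
  then obtain N where NA: "N \<in> ?A" and mx: "\<forall>X\<in>?A. N \<subseteq> X \<longrightarrow> X = N" by (rule bexE)
  from NA have N: "submod w N" "N \<subseteq> M'" "y \<notin> N" by simp_all
  have "simple_subquotient w N M'"
    unfolding simple_subquotient_def
  proof (intro conjI allI impI)
    fix L assume L: "submod w L" "N \<subseteq> L" "L \<subseteq> M'"
    show "L = N \<or> L = M'"
    proof (cases "y \<in> L")
      case True
      then show ?thesis using min [OF L(1)] L(3) by simp
    next
      case False
      then have "L \<in> ?A" using L by simp
      then show ?thesis using mx L(2) by simp
    qed
  qed (use N M' yM' in auto)
  then show ?thesis using that min [OF M y(1)] yM' N(3) by simp
qed

section \<open>Invariants of a concatenation\<close>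

text \<open>
  The dual of a word is, up to the exchange of the two nodes of the Dynkin diagram, the word with negated
  letters: this is the composite of the antipode with the flip $v_+ \leftrightarrow v_-$.
\<close>

fun dual_gen :: "gen \<Rightarrow> gen" where
  "dual_gen E1 = F0" | "dual_gen F0 = E1" | "dual_gen E0 = F1" | "dual_gen F1 = E0" | "dual_gen Kp = Kp" | "dual_gen Km = Km"

fun dual_coeff :: "gen \<Rightarrow> complex" where
  "dual_coeff E1 = - q" | "dual_coeff E0 = - q" | "dual_coeff F0 = - inverse q" | "dual_coeff F1 = - inverse q"
| "dual_coeff Kp = 1" | "dual_coeff Km = 1"

text \<open>Applied to an invariant x, the formulas of \<open>contract_word_op\<close> have a
  trivial left side, so the action on the contraction can be solved for the action on
  \<open>f\<close>.\<close>

lemma contraction_twisted: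
  assumes x: "x \<in> invariants q (w1 @ w2)"
  shows "twisted dual_gen dual_coeff (map uminus w1) w2 (\<lambda>f. contract q w1 f x)"
proof -
  let ?u = "map uminus w1"
  have xl: "x \<in> level (length w1 + length w2)" and inv: "word_op q (w1 @ w2) g x = triv_op g x" for g
    using x by (auto simp: invariants_def)
  have ops: "contract q w1 (word_op q ?u g f) x = dual_coeff g *\<^sub>C word_op q w2 (dual_gen g) (contract q w1 f x)"
    if f: "f \<in> level (length w1)" for f g
  proof -
    have fu: "f \<in> level (length ?u)" using f by simp
    have ul: "word_op q ?u g f \<in> level (length w1)" if "f \<in> level (length w1)" for g f
      using that word_op_level [of f ?u q g] by simp
    note cw = contract_word_op [where x = x and w = w1 and v = w2, unfolded inv triv_op_def, simplified]
    have Kp: "word_op q w2 Kp (contract q w1 f x) = contract q w1 (word_op q ?u Kp f) x"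
      and Km: "word_op q w2 Km (contract q w1 f x) = contract q w1 (word_op q ?u Km f) x" if "f \<in> level (length w1)" for f
      using cw(1) [OF ul [OF that], of Kp] cw(2) [OF ul [OF that], of Km] commutations(1,2) [of f ?u] that by simp_all
    have solve: "z = (- (q * inverse c)) *\<^sub>C y" if "0 = q *\<^sub>C y + c *\<^sub>C z" "c \<noteq> 0" for c and y z :: "sign list \<Rightarrow> complex"
    proof -
      have "c *\<^sub>C z = - (q *\<^sub>C y)" using that(1) by (simp add: eq_neg_iff_add_eq_0 add.commute)
      then have "inverse c *\<^sub>C c *\<^sub>C z = inverse c *\<^sub>C (- (q *\<^sub>C y))" by simp
      then show ?thesis using that(2) by (simp add: scaleC_scaleC scaleC_one cvs.scale_minus_right cvs.scale_minus_left mult.commute)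
    qed
    have qq: "q * (inverse q * inverse q) = inverse q" using q0 by simp
    show ?thesis
    proof (cases g)
      case E0
      \<comment> \<open>The formula for f_1 is taken at K^{-1} f, so that K cancels in the first
        term; conjugating e_0 by K in the second turns the factor q into q^{-1}.\<close>
      have "0 = word_op q w2 F1 (contract q w1 f x) + inverse q *\<^sub>C contract q w1 (word_op q ?u E0 f) x"
        using cw(5) [OF ul [OF f], of Km] commutations(1) [OF fu] commutations(5) [OF word_op_level [OF fu, of q Km]] q0
        by (simp add: contract_linear scaleC_scaleC power2_eq_square qq)
      from arg_cong [OF this, of "\<lambda>y. q *\<^sub>C y"] show ?thesis using solve [of _ 1] E0 q0
        by (simp add: scaleC_add_right scaleC_scaleC scaleC_one)
    next
      case E1
      have "0 = word_op q w2 F0 (contract q w1 f x) + inverse q *\<^sub>C contract q w1 (word_op q ?u E1 f) x"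
        using cw(6) [OF ul [OF f], of Kp] commutations(2) [OF fu] commutations(7) [OF word_op_level [OF fu, of q Kp]] q0
        by (simp add: contract_linear scaleC_scaleC power2_eq_square qq)
      from arg_cong [OF this, of "\<lambda>y. q *\<^sub>C y"] show ?thesis using solve [of _ 1] E1 q0
        by (simp add: scaleC_add_right scaleC_scaleC scaleC_one)
    next
      case F0
      have "0 = word_op q w2 E1 (contract q w1 f x) + q *\<^sub>C contract q w1 (word_op q ?u F0 f) x"
        using cw(3) [OF f] Kp [OF ul [OF ul [OF f]], of Km F0] commutations(1) [OF word_op_level [OF fu, of q F0]] by simp
      from arg_cong [OF this, of "\<lambda>y. q *\<^sub>C y"] show ?thesis using solve [of _ "q * q"] F0 q0
        by (simp add: qq scaleC_add_right scaleC_scaleC scaleC_one)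
    next
      case F1
      have "0 = word_op q w2 E0 (contract q w1 f x) + q *\<^sub>C contract q w1 (word_op q ?u F1 f) x"
        using cw(4) [OF f] Km [OF ul [OF ul [OF f]], of Kp F1] commutations(2) [OF word_op_level [OF fu, of q F1]] by simp
      from arg_cong [OF this, of "\<lambda>y. q *\<^sub>C y"] show ?thesis using solve [of _ "q * q"] F1 q0
        by (simp add: qq scaleC_add_right scaleC_scaleC scaleC_one)
    qed (simp_all add: Kp Km f scaleC_one)
  qed
  have "surj dual_gen"
  proof (rule surjI)
    show "dual_gen (dual_gen g) = g" for g by (cases g) simp_all
  qed
  moreover have "dual_coeff g \<noteq> 0" for g using q0 by (cases g) simp_all
  ultimately show ?thesis
    unfolding twisted_def using ops contract_level [OF xl] by (simp add: contract_linear)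
qed

end

lemma sum_list_ge:
  fixes c c' :: "int list"
  assumes "length c = length c'" "\<And>x y. x \<in> set c \<Longrightarrow> y \<in> set c' \<Longrightarrow> x + y \<ge> d"
  shows "sum_list c + sum_list c' \<ge> d * int (length c)"
  using assms
proof (induction c c' rule: list_induct2)
  case (Cons x xs y ys)
  have "sum_list xs + sum_list ys \<ge> d * int (length xs)" "x + y \<ge> d" using Cons by auto
  then show ?case by (simp add: algebra_simps)
qed simp

context generic_q
begin

lemma twisted_iterate:
  assumes T: "twisted \<sigma> \<gamma> w w' T" and x: "x \<in> level (length w)"
  shows "T ((word_op q w g ^^ k) x) = (\<gamma> g ^ k) *\<^sub>C (word_op q w' (\<sigma> g) ^^ k) (T x)"
proof (induction k)
  case (Suc k)
  have "(word_op q w g ^^ k) x \<in> level (length w)" by (rule iterate_mem [OF submod_level x])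
  then show ?case by (simp add: twistedD(6) [OF T] Suc.IH word_op_scale scaleC_scaleC mult.commute)
qed (simp add: scaleC_one)

text \<open>
  A simple subquotient of the image of the contraction is \<open>fundamental\<close> both for \<open>w2\<close> and for the
  negated \<open>w1\<close>. With lowest weight $-k$ this forces $\sum b_i - \sum a_i = 2 k$ for \<open>k\<close> letters on
  either side, while $b_i - a_j \geq 4$; so $k = 0$.
\<close>

lemma contraction_weight_zero:
  assumes x: "x \<in> invariants q (w1 @ w2)" and far: "\<And>a b. a \<in> set w1 \<Longrightarrow> b \<in> set w2 \<Longrightarrow> b \<ge> a + 4"
    and y: "y \<in> (\<lambda>f. contract q w1 f x) ` level (length w1)" "y \<noteq> 0" "word_op q w2 Kp y = q powi j *\<^sub>C y"
  shows "j = 0"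
proof -
  let ?T = "\<lambda>f. contract q w1 f x" and ?u = "map uminus w1"
  have T: "twisted dual_gen dual_coeff ?u w2 ?T" by (rule contraction_twisted [OF x])
  note T' = twistedD [OF T]
  let ?Y = "?T ` level (length ?u)"
  have Y: "submod w2 ?Y" by (rule image_submod [OF T submod_level])
  have "y \<in> ?Y" using y(1) by simp
  then obtain N M where s: "simple_subquotient w2 N M" and MY: "M \<subseteq> ?Y" and yM: "y \<in> M" "y \<notin> N"
    using simple_exists [OF Y _ y(2)] by metis
  have Ns: "submod w2 N" and Ms: "submod w2 M" using s by (auto simp: simple_subquotient_def)
  note Nd = submodD [OF Ns] and Md = submodD [OF Ms]
  define N' M' where "N' = {f \<in> level (length ?u). ?T f \<in> N}" and "M' = {f \<in> level (length ?u). ?T f \<in> M}"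
  then have memN: "f \<in> N' \<longleftrightarrow> f \<in> level (length ?u) \<and> ?T f \<in> N"
    and memM: "f \<in> M' \<longleftrightarrow> f \<in> level (length ?u) \<and> ?T f \<in> M" for f by simp_all
  have "\<not> M \<inter> ?Y \<subseteq> N" using yM MY by blast
  then have s': "simple_subquotient ?u N' M'" unfolding N'_def M'_def by (rule simple_pull [OF T s])
  obtain c y1 where c: "set c \<subseteq> set w2" and y1: "y1 \<in> M"
    and K: "word_op q w2 Kp y1 - q powi (- int (length c)) *\<^sub>C y1 \<in> N"
    and E: "(word_op q w2 E1 ^^ length c) y1 \<notin> N"
    and F: "(word_op q w2 F0 ^^ length c) y1 - q powi (- sum_list c) *\<^sub>C (word_op q w2 E1 ^^ length c) y1 \<in> N"
    and W: "\<And>m j. m \<in> M \<Longrightarrow> word_op q w2 Kp m - q powi j *\<^sub>C m \<in> N \<Longrightarrow> m \<in> N \<or> \<bar>j\<bar> \<le> int (length c)"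
    and U: "\<And>m. m \<in> M \<Longrightarrow> word_op q w2 Kp m - q powi (- int (length c)) *\<^sub>C m \<in> N \<Longrightarrow> \<exists>\<alpha>. m - \<alpha> *\<^sub>C y1 \<in> N"
    using simple_subquotient_fundamental [OF s subset_refl] unfolding fundamental_def by blast
  obtain c' f where c': "set c' \<subseteq> set ?u" and f: "f \<in> M'"
    and K': "word_op q ?u Kp f - q powi (- int (length c')) *\<^sub>C f \<in> N'"
    and E': "(word_op q ?u E1 ^^ length c') f \<notin> N'"
    and F': "(word_op q ?u F0 ^^ length c') f - q powi (- sum_list c') *\<^sub>C (word_op q ?u E1 ^^ length c') f \<in> N'"
    and W': "\<And>m j. m \<in> M' \<Longrightarrow> word_op q ?u Kp m - q powi j *\<^sub>C m \<in> N' \<Longrightarrow> m \<in> N' \<or> \<bar>j\<bar> \<le> int (length c')"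
    using simple_subquotient_fundamental [OF s' subset_refl] unfolding fundamental_def by blast
  define z where "z = ?T f"
  have fl: "f \<in> level (length ?u)" and zM: "z \<in> M" using f by (simp_all add: z_def memM)
  note It = twisted_iterate [OF T fl]
  have y1N: "y1 \<notin> N" using E iterate_mem [OF Ns] by blast
  have fN: "f \<notin> N'" using E' iterate_mem [of ?u N'] s' unfolding simple_subquotient_def by blast
  then have zN: "z \<notin> N" using fl by (simp add: z_def memN)
  have Kz: "word_op q w2 Kp z - q powi (- int (length c')) *\<^sub>C z \<in> N"
    using K' fl by (simp add: T' z_def scaleC_one memN)
  \<comment> \<open>The lengths of \<open>c\<close> and \<open>c'\<close> bound all weights of the
    same simple subquotient seen from both sides, and each bound is attained. The twist fixes K, so
    they agree.\<close>
  have "length c' \<le> length c" using W [OF zM Kz] zN by simp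
  moreover have "length c \<le> length c'"
  proof -
    obtain m where m: "m \<in> level (length ?u)" "y1 = ?T m" using y1 MY by blast
    then have "m \<in> M'" "m \<notin> N'" using y1 y1N by (simp_all add: memN memM)
    moreover have "word_op q ?u Kp m - q powi (- int (length c)) *\<^sub>C m \<in> N'"
      using K m word_op_level [of m ?u q Kp] by (simp add: T' scaleC_one memN)
    ultimately show ?thesis using W' [of m "- int (length c)"] by simp
  qed
  ultimately have len: "length c' = length c" by simp
  define k where "k = length c"
  define e where "e = (word_op q w2 E1 ^^ k) z"
  define g where "g = (word_op q w2 F0 ^^ k) z"
  \<comment> \<open>The lowest weight space is one-dimensional modulo N, so the two lowest weight
    vectors are proportional there and share their data.\<close>
  obtain \<alpha> where \<alpha>: "z - \<alpha> *\<^sub>C y1 \<in> N" using U [OF zM] Kz unfolding len by blast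
  have 1: "g - q powi (- sum_list c) *\<^sub>C e \<in> N"
  proof -
    define n where "n = z - \<alpha> *\<^sub>C y1"
    have z: "z = n + \<alpha> *\<^sub>C y1" by (simp add: n_def)
    have iter_add: "(word_op q w2 h ^^ k) (a + b) = (word_op q w2 h ^^ k) a + (word_op q w2 h ^^ k) b" for h a b and k :: nat
      by (induction k) (simp_all add: word_op_add)
    have "g - q powi (- sum_list c) *\<^sub>C e =
      ((word_op q w2 F0 ^^ k) n - q powi (- sum_list c) *\<^sub>C (word_op q w2 E1 ^^ k) n)
      + \<alpha> *\<^sub>C ((word_op q w2 F0 ^^ k) y1 - q powi (- sum_list c) *\<^sub>C (word_op q w2 E1 ^^ k) y1)"
      unfolding g_def e_def z iter_add funpow_scale
      by (simp add: pointwise algebra_simps)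
    also have "\<dots> \<in> N"
      using Nd(2-4) iterate_mem [OF Ns] \<alpha> F unfolding n_def k_def by simp
    finally show ?thesis .
  qed
  \<comment> \<open>The relation between f_0^k and e_1^k on the dual side, with the two exchanged by
    the twist and the coefficients -q^{-1} and -q to the power k.\<close>
  have 2: "((- inverse q) ^ k) *\<^sub>C e - (q powi (- sum_list c') * (- q) ^ k) *\<^sub>C g \<in> N"
    using F' unfolding len k_def [symmetric]
    by (simp add: T' It scaleC_scaleC e_def g_def z_def memN)
  have gN: "g \<notin> N"
  proof
    assume "g \<in> N"
    then have "(word_op q ?u E1 ^^ k) f \<in> N'"
      using iterate_mem [OF submod_level fl] Nd(4) by (simp add: It g_def z_def memN)
    then show False using E' unfolding len k_def by blast
  qed
  have eN: "e \<notin> N"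
  proof
    assume "e \<in> N"
    then have "(g - q powi (- sum_list c) *\<^sub>C e) + q powi (- sum_list c) *\<^sub>C e \<in> N" by (intro Nd(2,4) 1)
    then show False using gN by simp
  qed
  let ?d = "(- inverse q) ^ k - q powi (- sum_list c') * (- q) ^ k * q powi (- sum_list c)"
  have "(((- inverse q) ^ k) *\<^sub>C e - (q powi (- sum_list c') * (- q) ^ k) *\<^sub>C g)
      + (q powi (- sum_list c') * (- q) ^ k) *\<^sub>C (g - q powi (- sum_list c) *\<^sub>C e) \<in> N"
    by (rule Nd(2) [OF 2 Nd(4) [OF 1]])
  also have "(((- inverse q) ^ k) *\<^sub>C e - (q powi (- sum_list c') * (- q) ^ k) *\<^sub>C g)
      + (q powi (- sum_list c') * (- q) ^ k) *\<^sub>C (g - q powi (- sum_list c) *\<^sub>C e) = ?d *\<^sub>C e"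
    by (simp add: pointwise algebra_simps)
  finally have "?d *\<^sub>C e \<in> N" .
  then have "inverse ?d *\<^sub>C ?d *\<^sub>C e \<in> N" by (rule Nd(4))
  then have d0: "?d = 0" using eN by (cases "?d = 0") (simp_all add: scaleC_scaleC scaleC_one)
  \<comment> \<open>Both relations express g through e modulo N, and e is nonzero there; the signs
    cancel and equality of the coefficients is this power of q.\<close>
  have "q powi (2 * int k - sum_list c - sum_list c') = 1"
  proof -
    have qk: "(- 1) ^ k * (- q) ^ k = q ^ k" "q ^ k * ((- 1) ^ k * (- inverse q) ^ k) = 1"
      using q0 by (simp_all add: power_mult_distrib [symmetric])
    have "1 = q ^ k * ((- 1) ^ k * (q powi (- sum_list c') * (- q) ^ k * q powi (- sum_list c)))"
      using qk(2) d0 by simp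
    also have "\<dots> = q ^ k * ((- 1) ^ k * (- q) ^ k) * (q powi (- sum_list c') * q powi (- sum_list c))"
      by (simp add: ac_simps)
    also have "\<dots> = q ^ k * q ^ k * (q powi (- sum_list c') * q powi (- sum_list c))" by (simp only: qk(1))
    also have "\<dots> = q powi (2 * int k - sum_list c - sum_list c')"
      using q0 by (simp add: power_int_add power_int_diff power_int_minus power_int_mult power2_eq_square field_simps power_mult_distrib)
    finally show ?thesis by simp
  qed
  then have "2 * int k = sum_list c + sum_list c'" unfolding powi_eq_1_iff by simp
  moreover have "sum_list c + sum_list c' \<ge> 4 * int k"
    unfolding k_def
  proof (rule sum_list_ge)
    show "length c = length c'" using len by simp
    fix a b assume ab: "a \<in> set c" "b \<in> set c'"
    then have "- b \<in> set w1" using c' by auto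
    then show "4 \<le> a + b" using far [of "- b" a] c ab by auto
  qed
  ultimately have "k = 0" by simp
  then show "j = 0" using W [OF yM(1), of j] yM(2) y(3) Nd(1) by (simp add: k_def)
qed

text \<open>The image of the contraction has weight 0 only. Each e_i and f_i shifts the weight by 2
  or -2, hence acts by zero, and K acts by 1.\<close>

lemma contraction_invariant:
  assumes x: "x \<in> invariants q (w1 @ w2)" and far: "\<And>a b. a \<in> set w1 \<Longrightarrow> b \<in> set w2 \<Longrightarrow> b \<ge> a + 4"
    and f: "f \<in> level (length w1)"
  shows "contract q w1 f x \<in> invariants q w2"
proof -
  let ?T = "\<lambda>f. contract q w1 f x"
  define Y where "Y = ?T ` level (length w1)"
  have Ys: "submod w2 Y"
    using image_submod [OF contraction_twisted [OF x] submod_level] by (simp add: Y_def)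
  note Yd = submodD [OF Ys]
  have zero: "y = 0" if "y \<in> Y" "word_op q w2 Kp y = q powi j *\<^sub>C y" "j \<noteq> 0" for y j
    using contraction_weight_zero [OF x far, of y j] that unfolding Y_def by blast
  have Kp: "word_op q w2 Kp y = y" if y: "y \<in> Y" for y
  proof
    fix t
    have "weight t = 0" if "y t \<noteq> 0"
    proof -
      obtain y' where "y' \<in> Y" "y' t \<noteq> 0" "word_op q w2 Kp y' = q powi weight t *\<^sub>C y'"
        using weight_component [OF Ys y \<open>y t \<noteq> 0\<close>] by metis
      then show ?thesis using zero [of y' "weight t"] by (metis zero_fun_apply)
    qed
    then show "word_op q w2 Kp y t = y t" using word_op_Kp [OF Yd(5) [OF y], of t] by (cases "y t = 0") simp_all
  qed
  have "word_op q w2 g y = triv_op g y" if y: "y \<in> Y" for g y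
  proof -
    note yl = Yd(5) [OF y]
    have i: "q powi (- 2) = inverse q ^ 2" by (simp add: power_int_minus power_inverse)
    have r: "word_op q w2 g y = 0" if "word_op q w2 Kp (word_op q w2 g y) = q powi j *\<^sub>C word_op q w2 g (word_op q w2 Kp y)" "j \<noteq> 0" for g j
      using zero [OF Yd(6) [OF y], of g j] that by (simp add: Kp [OF y])
    have "word_op q w2 Km y = y" using commutations(2) [OF yl] Kp [OF y] by simp
    then show ?thesis
      using r [of E1 2] r [of F0 2] r [of F1 "- 2"] r [of E0 "- 2"] commutations(3-6) [OF yl] Kp [OF y]
      by (cases g) (simp_all add: triv_op_def i)
  qed
  then show ?thesis using f Yd(5) unfolding invariants_def Y_def by blast
qed

end

section \<open>Vectors u \<otimes> v on concatenated sign lists, and the factorisation of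
  invariants\<close>

definition juxtapose :: "nat \<Rightarrow> (sign list \<Rightarrow> complex) \<Rightarrow> (sign list \<Rightarrow> complex) \<Rightarrow> sign list \<Rightarrow> complex" where
  "juxtapose k u v = (\<lambda>t. u (take k t) * v (drop k t))"

lemma juxtapose_linear:
  "juxtapose k (u + u') v = juxtapose k u v + juxtapose k u' v" "juxtapose k (c *\<^sub>C u) v = c *\<^sub>C juxtapose k u v"
  "juxtapose k u (v + v') = juxtapose k u v + juxtapose k u v'" "juxtapose k u (c *\<^sub>C v) = c *\<^sub>C juxtapose k u v"
  "juxtapose k (u - u') v = juxtapose k u v - juxtapose k u' v"
  by (simp_all add: juxtapose_def pointwise algebra_simps)

lemma juxtapose_zero [simp]: "juxtapose k 0 v = 0" "juxtapose k u 0 = 0"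
  by (simp_all add: juxtapose_def pointwise)

lemma juxtapose_sum: "juxtapose k (\<Sum>i\<in>I. f i) v = (\<Sum>i\<in>I. juxtapose k (f i) v)" "juxtapose k u (\<Sum>i\<in>I. f i) = (\<Sum>i\<in>I. juxtapose k u (f i))"
  by (induction I rule: infinite_finite_induct) (simp_all add: juxtapose_linear)

lemma juxtapose_level: "u \<in> level k \<Longrightarrow> v \<in> level l \<Longrightarrow> juxtapose k u v \<in> level (k + l)"
proof -
  assume u: "u \<in> level k" and v: "v \<in> level l"
  have "juxtapose k u v t = 0" if "length t \<noteq> k + l" for t
  proof (cases "length (take k t) = k")
    case True
    then have "length (drop k t) \<noteq> l" using that by auto
    then show ?thesis using v by (simp add: juxtapose_def level_def)
  next
    case False
    then show ?thesis using u by (simp add: juxtapose_def level_def)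
  qed
  then show ?thesis by (simp add: level_def)
qed

lemma juxtapose_sign_cons: "juxtapose (Suc k) (sign_cons P M) v = sign_cons (juxtapose k P v) (juxtapose k M v)"
  by (auto simp: juxtapose_def sign_cons_def fun_eq_iff split: list.split sign.split)

lemma juxtapose_append: "length s = k \<Longrightarrow> juxtapose k u v (s @ t) = u s * v t"
  by (simp add: juxtapose_def)

lemma finite_sign_lists: "finite {s :: sign list. length s = n}"
proof -
  have "finite (UNIV :: sign set)" by (rule finite_subset [of _ "{Plus, Minus}"]) (auto intro: sign.exhaust)
  from finite_lists_length_eq [OF this, of n] show ?thesis by simp
qed

lemma sum_fun_apply: "(\<Sum>i\<in>I. f i) t = (\<Sum>i\<in>I. f i t)" for f :: "'a \<Rightarrow> 'b \<Rightarrow> 'c::comm_monoid_add"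
  by (induction I rule: infinite_finite_induct) (simp_all add: plus_fun_apply zero_fun_apply)

lemma level_span: "\<exists>F. finite F \<and> level n \<subseteq> cvs.span F"
proof -
  let ?\<delta> = "\<lambda>s t :: sign list. if t = s then 1 else (0 :: complex)"
  let ?S = "{s :: sign list. length s = n}"
  have "x \<in> cvs.span (?\<delta> ` ?S)" if "x \<in> level n" for x
  proof -
    have "x = (\<Sum>s\<in>?S. x s *\<^sub>C ?\<delta> s)"
    proof
      fix t
      have "(\<Sum>s\<in>?S. x s *\<^sub>C ?\<delta> s) t = (\<Sum>s\<in>?S. if t = s then x s else 0)"
        by (simp add: sum_fun_apply scaleC_apply scaleC_complex_def if_distrib cong: if_cong)
      also have "\<dots> = x t" using that finite_sign_lists by (simp add: level_def)
      finally show "x t = (\<Sum>s\<in>?S. x s *\<^sub>C ?\<delta> s) t" by simp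
    qed
    also have "\<dots> \<in> cvs.span (?\<delta> ` ?S)" by (intro cvs.span_sum cvs.span_scale cvs.span_base) auto
    finally show ?thesis .
  qed
  then show ?thesis using finite_sign_lists by (intro exI [of _ "?\<delta> ` ?S"]) auto
qed

lemma finite_basis:
  assumes "V \<subseteq> level n"
  obtains B where "finite B" "B \<subseteq> V" "cvs.independent B" "V \<subseteq> cvs.span B" "card B = cvs.dim V"
proof -
  obtain F where F: "finite F" "level n \<subseteq> cvs.span F" using level_span by blast
  obtain B where B: "B \<subseteq> V" "cvs.independent B" "V \<subseteq> cvs.span B" "card B = cvs.dim V" by (rule cvs.basis_exists)
  moreover have "finite B" using cvs.independent_span_bound [OF F(1) B(2)] B(1) assms F(2) by blast
  ultimately show ?thesis using that by blast
qed

text \<open>Fixing the first part \<open>t\<close> of the sign list turns the relation into a linear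
  relation among the basis vectors, with coefficients \<open>u b t\<close>.\<close>

lemma juxtapose_independent:
  assumes B: "finite B" "cvs.independent B" and u: "\<And>b. b \<in> B \<Longrightarrow> u b \<in> level k"
    and s: "(\<Sum>b\<in>B. juxtapose k (u b) b) = 0" and b: "b \<in> B"
  shows "u b = 0"
proof
  fix t show "u b t = 0 t"
  proof (cases "length t = k")
    case True
    have "(\<Sum>b\<in>B. u b t *\<^sub>C b) = 0"
    proof
      fix r
      have "(\<Sum>b\<in>B. u b t *\<^sub>C b) r = (\<Sum>b\<in>B. juxtapose k (u b) b) (t @ r)"
        by (simp add: sum_fun_apply juxtapose_append [OF True] scaleC_apply scaleC_complex_def)
      then show "(\<Sum>b\<in>B. u b t *\<^sub>C b) r = 0 r" by (simp add: s zero_fun_apply)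
    qed
    then show ?thesis using cvs.independentD [OF B(2) B(1) subset_refl, of "\<lambda>b. u b t" b] b by (simp add: zero_fun_apply)
  qed (use u [OF b] in \<open>simp add: level_def zero_fun_apply\<close>)
qed

lemma triv_op_zero [simp]: "triv_op g 0 = 0"
  by (simp add: triv_op_def)

context generic_q
begin

text \<open>On an invariant v all e_i and f_i vanish and K is 1, so of the coproduct only the action
  on u survives.\<close>

lemma word_op_juxtapose:
  assumes "v \<in> invariants q w2" "u \<in> level (length w1)"
  shows "word_op q (w1 @ w2) g (juxtapose (length w1) u v) = juxtapose (length w1) (word_op q w1 g u) v"
  using assms(2)
proof (induction w1 arbitrary: g u)
  case Nil
  then obtain c where u: "u = (\<lambda>t. if t = [] then c else 0)" unfolding list.size level_0_iff by blast
  have "juxtapose 0 u v = c *\<^sub>C v" by (simp add: juxtapose_def u pointwise)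
  moreover have "word_op q w2 g v = triv_op g v" using assms(1) by (simp add: invariants_def)
  moreover have "juxtapose 0 (triv_op g u) v = c *\<^sub>C triv_op g v"
    using \<open>juxtapose 0 u v = c *\<^sub>C v\<close> by (simp add: triv_op_def)
  ultimately show ?case by (simp add: word_op_scale)
next
  case (Cons a w1)
  from Cons.prems obtain P M where "P \<in> level (length w1)" "M \<in> level (length w1)" "u = sign_cons P M"
    unfolding length_Cons by (rule level_Suc_cases)
  then show ?case
    by (cases g) (simp_all add: juxtapose_sign_cons Cons.IH juxtapose_linear)
qed

lemma triv_op_juxtapose: "triv_op g (juxtapose k u v) = juxtapose k (triv_op g u) v"
  by (simp add: triv_op_def)

lemma juxtapose_invariants: "u \<in> invariants q w1 \<Longrightarrow> v \<in> invariants q w2 \<Longrightarrow> juxtapose (length w1) u v \<in> invariants q (w1 @ w2)"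
  using word_op_juxtapose [of v w2 u w1] juxtapose_level by (auto simp: invariants_def triv_op_juxtapose)

text \<open>The slices of x at fixed first part are contractions, hence invariants of
  \<open>w2\<close>, and are expanded over B. A generator acts on the coefficients alone, so
  independence of B compares them one by one.\<close>

lemma invariants_append_decompose:
  assumes x: "x \<in> invariants q (w1 @ w2)" and far: "\<And>a b. a \<in> set w1 \<Longrightarrow> b \<in> set w2 \<Longrightarrow> b \<ge> a + 4"
    and B: "finite B" "B \<subseteq> invariants q w2" "cvs.independent B" "invariants q w2 \<subseteq> cvs.span B"
  shows "\<exists>u. (\<forall>b\<in>B. u b \<in> invariants q w1) \<and> x = (\<Sum>b\<in>B. juxtapose (length w1) (u b) b)"
proof -
  let ?k = "length w1"
  have xl: "x \<in> level (?k + length w2)" using x by (simp add: invariants_def)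
  have slice: "(\<lambda>t. x (s @ t)) \<in> cvs.span B" if "length s = ?k" for s
  proof -
    from contract_slice [OF q0 that] obtain f where f: "f \<in> level ?k" "\<And>x. contract q w1 f x = (\<lambda>t. x (s @ t))" by blast
    then show ?thesis using contraction_invariant [OF x far f(1)] B(4) by auto
  qed
  define u where "u = (\<lambda>b s. if length s = ?k then cvs.representation B (\<lambda>t. x (s @ t)) b else 0)"
  have ul: "u b \<in> level ?k" for b by (simp add: u_def level_def)
  have sum: "x = (\<Sum>b\<in>B. juxtapose ?k (u b) b)"
  proof
    fix t
    show "x t = (\<Sum>b\<in>B. juxtapose ?k (u b) b) t"
    proof (cases "length t \<ge> ?k")
      case True
      then have l: "length (take ?k t) = ?k" by simp
      have "x t = (\<lambda>r. x (take ?k t @ r)) (drop ?k t)" by simp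
      also have "(\<lambda>r. x (take ?k t @ r)) = (\<Sum>b\<in>B. cvs.representation B (\<lambda>r. x (take ?k t @ r)) b *\<^sub>C b)"
        by (rule cvs.sum_representation_eq [symmetric]) (use B slice [OF l] in auto)
      also have "\<dots> (drop ?k t) = (\<Sum>b\<in>B. juxtapose ?k (u b) b) t"
        using l by (simp add: sum_fun_apply juxtapose_def u_def scaleC_apply scaleC_complex_def)
      finally show ?thesis .
    next
      case False
      then have "x t = 0" using xl by (simp add: level_def)
      moreover have "juxtapose ?k (u b) b t = 0" for b using ul [of b] False by (simp add: juxtapose_def level_def)
      ultimately show ?thesis by (simp add: sum_fun_apply)
    qed
  qed
  have "word_op q w1 g (u b) = triv_op g (u b)" if b: "b \<in> B" for g b
  proof -
    have ws: "word_op q (w1 @ w2) g (\<Sum>i\<in>I. f i) = (\<Sum>i\<in>I. word_op q (w1 @ w2) g (f i))" for I and f :: "(sign list \<Rightarrow> complex) \<Rightarrow> _"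
      by (induction I rule: infinite_finite_induct) (simp_all add: word_op_add)
    have ts: "triv_op g (\<Sum>i\<in>I. f i) = (\<Sum>i\<in>I. triv_op g (f i :: sign list \<Rightarrow> complex))" for I and f :: "(sign list \<Rightarrow> complex) \<Rightarrow> _"
      by (induction I rule: infinite_finite_induct) (simp_all add: triv_op_linear)
    have "word_op q (w1 @ w2) g x = triv_op g x" using x by (simp add: invariants_def)
    then have "(\<Sum>b\<in>B. juxtapose ?k (word_op q w1 g (u b)) b) = (\<Sum>b\<in>B. juxtapose ?k (triv_op g (u b)) b)"
      unfolding sum ws ts using B(2) by (simp add: word_op_juxtapose ul triv_op_juxtapose subset_iff cong: sum.cong)
    then have "(\<Sum>b\<in>B. juxtapose ?k (word_op q w1 g (u b) - triv_op g (u b)) b) = 0"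
      by (simp add: juxtapose_linear sum_subtractf)
    moreover have "word_op q w1 g (u b) - triv_op g (u b) \<in> level ?k" for b
      using ul [of b] by (simp add: triv_op_def)
    ultimately have "word_op q w1 g (u b) - triv_op g (u b) = 0"
      using juxtapose_independent [OF B(1,3), where u = "\<lambda>b. word_op q w1 g (u b) - triv_op g (u b)"] b by blast
    then show ?thesis by simp
  qed
  then have "\<forall>b\<in>B. u b \<in> invariants q w1" using ul by (simp add: invariants_def)
  then show ?thesis using sum by blast
qed

end

section \<open>Isomorphisms of subspaces and their dimensions\<close>

lemma linear_on_sum:
  assumes "linear_on V f" "cvs.subspace V" "\<And>i. i \<in> I \<Longrightarrow> g i \<in> V"
  shows "f (\<Sum>i\<in>I. c i *\<^sub>C g i) = (\<Sum>i\<in>I. c i *\<^sub>C f (g i))"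
  using assms(3)
proof (induction I rule: infinite_finite_induct)
  case (insert i I)
  have "(\<Sum>i\<in>I. c i *\<^sub>C g i) \<in> V" using insert by (intro cvs.subspace_sum [OF assms(2)] cvs.subspace_scale [OF assms(2)]) auto
  moreover have "c i *\<^sub>C g i \<in> V" using insert by (intro cvs.subspace_scale [OF assms(2)]) auto
  ultimately show ?case using insert assms(1) by (simp add: linear_on_def)
next
  have "f (0 *\<^sub>C 0) = 0 *\<^sub>C f 0" using assms(1) cvs.subspace_0 [OF assms(2)] unfolding linear_on_def by blast
  then have "f 0 = 0" by simp
  then show "f (\<Sum>i\<in>{}. c i *\<^sub>C g i) = (\<Sum>i\<in>{}. c i *\<^sub>C f (g i))" by simp
  show "f (\<Sum>i\<in>I. c i *\<^sub>C g i) = (\<Sum>i\<in>I. c i *\<^sub>C f (g i))" if "infinite I" for I using that \<open>f 0 = 0\<close> by simp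
qed

lemma vs_iso_sym:
  assumes "V \<cong>\<^sub>C W" "cvs.subspace V"
  shows "W \<cong>\<^sub>C V"
proof -
  obtain f where f: "linear_on V f" "bij_betw f V W" using assms by (auto simp: vs_iso_def)
  let ?g = "the_inv_into V f"
  have g: "?g (f v) = v" if "v \<in> V" for v using f(2) that by (simp add: bij_betw_def the_inv_into_f_f)
  have fg: "f (?g w) = w" "?g w \<in> V" if "w \<in> W" for w
    using f(2) that by (auto simp: bij_betw_def f_the_inv_into_f the_inv_into_into)
  have "linear_on W ?g"
    unfolding linear_on_def
  proof (intro conjI ballI allI)
    fix x y assume "x \<in> W" "y \<in> W"
    then have "f (?g x + ?g y) = x + y" using f(1) fg by (simp add: linear_on_def)
    then show "?g (x + y) = ?g x + ?g y" using g [of "?g x + ?g y"] fg \<open>x \<in> W\<close> \<open>y \<in> W\<close> cvs.subspace_add [OF assms(2)] by metis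
  next
    fix c x assume "x \<in> W"
    then have "f (c *\<^sub>C ?g x) = c *\<^sub>C x" using f(1) fg by (simp add: linear_on_def)
    then show "?g (c *\<^sub>C x) = c *\<^sub>C ?g x" using g [of "c *\<^sub>C ?g x"] fg \<open>x \<in> W\<close> cvs.subspace_scale [OF assms(2)] by metis
  qed
  then show ?thesis using bij_betw_the_inv_into [OF f(2)] by (auto simp: vs_iso_def)
qed

lemma vs_iso_trans:
  assumes "X \<cong>\<^sub>C V" "V \<cong>\<^sub>C W"
  shows "X \<cong>\<^sub>C W"
proof -
  obtain f g where f: "linear_on X f" "bij_betw f X V" and g: "linear_on V g" "bij_betw g V W"
    using assms by (auto simp: vs_iso_def)
  have "f x \<in> V" if "x \<in> X" for x using f(2) that by (auto simp: bij_betw_def)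
  then have "linear_on X (g \<circ> f)" using f(1) g(1) by (simp add: linear_on_def)
  then show ?thesis using bij_betw_trans [OF f(2) g(2)] vs_iso_def by blast
qed

lemma vs_iso_dim:
  assumes "V \<cong>\<^sub>C W" "cvs.subspace V" "finite B" "B \<subseteq> V" "cvs.independent B" "V \<subseteq> cvs.span B"
  shows "cvs.dim W = card B"
proof -
  obtain f where f: "linear_on V f" "inj_on f V" "f ` V = W" using assms(1) by (auto simp: vs_iso_def bij_betw_def)
  have fs: "f (\<Sum>b\<in>B. c b *\<^sub>C b) = (\<Sum>b\<in>B. c b *\<^sub>C f b)" for c
    using assms(4) by (intro linear_on_sum [OF f(1) assms(2)]) auto
  have inj: "inj_on f B" using f(2) assms(4) by (rule inj_on_subset)
  have sV: "(\<Sum>b\<in>B. c b *\<^sub>C b) \<in> V" for c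
    using assms(4) by (intro cvs.subspace_sum [OF assms(2)] cvs.subspace_scale [OF assms(2)]) auto
  have f0: "f 0 = 0" using fs [of "\<lambda>_. 0"] by simp
  have "cvs.independent (f ` B)"
  proof (rule cvs.independent_if_scalars_zero)
    fix c y assume s: "(\<Sum>x\<in>f ` B. c x *\<^sub>C x) = 0" and y: "y \<in> f ` B"
    then obtain b where b: "b \<in> B" "y = f b" by blast
    have "f (\<Sum>b\<in>B. c (f b) *\<^sub>C b) = 0" using s by (simp add: fs sum.reindex [OF inj])
    then have "(\<Sum>b\<in>B. c (f b) *\<^sub>C b) = 0"
      by (intro inj_onD [OF f(2) _ sV cvs.subspace_0 [OF assms(2)]]) (simp add: f0)
    then show "c y = 0" using cvs.independentD [OF assms(5,3) subset_refl, of "\<lambda>b. c (f b)" b] b by simp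
  qed (use assms(3) in simp)
  moreover have "W \<subseteq> cvs.span (f ` B)"
  proof
    fix y assume "y \<in> W"
    then obtain v where v: "v \<in> V" "y = f v" using f(3) by blast
    then obtain c where "v = (\<Sum>b\<in>B. c b *\<^sub>C b)" using assms(3,6) cvs.span_finite [OF assms(3)] by blast
    then have "y = (\<Sum>b\<in>B. c b *\<^sub>C f b)" using v fs by simp
    then show "y \<in> cvs.span (f ` B)" by (simp add: cvs.span_sum cvs.span_scale cvs.span_base)
  qed
  moreover have "f ` B \<subseteq> W" using f(3) assms(4) by blast
  ultimately have "card (f ` B) = cvs.dim W" by (intro cvs.basis_card_eq_dim)
  then show ?thesis using card_image [OF inj] by simp
qed

section \<open>Passage to the abstract tensor product\<close>

type_synonym hom_vec = "complex \<Rightarrow> sign list \<Rightarrow> complex"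

text \<open>The bilinear map sending two homomorphisms to the juxtaposition of their values at 1,
  extended to formal combinations of pairs; it descends because it kills the bilinear
  relations.\<close>

definition tensor_map0 :: "nat \<Rightarrow> ((hom_vec \<times> hom_vec) \<Rightarrow>\<^sub>0 complex) \<Rightarrow> sign list \<Rightarrow> complex" where
  "tensor_map0 k p = (\<Sum>x\<in>Poly_Mapping.keys p. Poly_Mapping.lookup p x *\<^sub>C juxtapose k (fst x 1) (snd x 1))"

lemma tensor_map0_sup:
  assumes "finite S" "Poly_Mapping.keys p \<subseteq> S"
  shows "tensor_map0 k p = (\<Sum>x\<in>S. Poly_Mapping.lookup p x *\<^sub>C juxtapose k (fst x 1) (snd x 1))"
  unfolding tensor_map0_def using assms
  by (intro sum.mono_neutral_left) (auto simp: in_keys_iff)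

lemma tensor_map0_add: "tensor_map0 k (p + r) = tensor_map0 k p + tensor_map0 k r"
proof -
  let ?S = "Poly_Mapping.keys p \<union> Poly_Mapping.keys r"
  have "Poly_Mapping.keys (p + r) \<subseteq> ?S" by (rule Poly_Mapping.keys_add)
  then show ?thesis
    by (simp add: tensor_map0_sup [where S = ?S] lookup_add scaleC_add_left sum.distrib)
qed

lemma tensor_map0_scale: "tensor_map0 k (c *\<^sub>C p) = c *\<^sub>C tensor_map0 k p"
proof -
  have l: "Poly_Mapping.lookup (c *\<^sub>C p) m = c *\<^sub>C Poly_Mapping.lookup p m" for m by transfer simp
  have "Poly_Mapping.keys (c *\<^sub>C p) \<subseteq> Poly_Mapping.keys p" by (auto simp: in_keys_iff l)
  then show ?thesis
    by (simp add: tensor_map0_sup [where S = "Poly_Mapping.keys p"] l scaleC_complex_def scaleC_scaleC cvs.scale_sum_right)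
qed

lemma tensor_map0_diff: "tensor_map0 k (p - r) = tensor_map0 k p - tensor_map0 k r"
  using tensor_map0_add [of k "p - r" r] by simp

lemma tensor_map0_single: "tensor_map0 k (Poly_Mapping.single (\<phi>, \<psi>) 1) = juxtapose k (\<phi> 1) (\<psi> 1)"
  by (simp add: tensor_map0_def scaleC_one)

lemma tensor_map0_span: "p \<in> cvs.span bilinear_relations \<Longrightarrow> tensor_map0 k p = 0"
proof (induction rule: cvs.span_induct)
  case base
  show ?case
    using tensor_map0_scale [of k 0 0] by (simp add: cvs.subspace_def tensor_map0_add tensor_map0_scale)
next
  case (step x)
  then show ?case
    by (auto simp: bilinear_relations_def tensor_map0_diff tensor_map0_scale tensor_map0_single juxtapose_linear plus_fun_apply scaleC_apply)
qed

lift_definition tensor_map :: "nat \<Rightarrow> (hom_vec, hom_vec) tensor \<Rightarrow> sign list \<Rightarrow> complex" is tensor_map0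
  using tensor_map0_span tensor_map0_diff by (fastforce simp: tensor_eq_def)

lemma tensor_map_linear: "tensor_map k (x + y) = tensor_map k x + tensor_map k y" "tensor_map k (c *\<^sub>C x) = c *\<^sub>C tensor_map k x"
  by (transfer, simp add: tensor_map0_add tensor_map0_scale)+

lemma tensor_map_pure: "tensor_map k (pure_tensor \<phi> \<psi>) = juxtapose k (\<phi> 1) (\<psi> 1)"
  by transfer (simp add: tensor_map0_single)

lemma pure_tensor_linear:
  fixes u v :: "'a::complex_vs" and w x :: "'b::complex_vs"
  shows
  "pure_tensor (u + v) w = pure_tensor u w + pure_tensor v w"
  "pure_tensor u (w + x) = pure_tensor u w + pure_tensor u x"
  "pure_tensor (c *\<^sub>C u) w = c *\<^sub>C pure_tensor u w"
  "pure_tensor u (c *\<^sub>C w) = c *\<^sub>C pure_tensor u w"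
proof -
  have rel: "p \<in> bilinear_relations \<Longrightarrow> p = r - s \<Longrightarrow> tensor_eq r s" for p r s :: "('a \<times> 'b) \<Rightarrow>\<^sub>0 complex"
    by (simp add: tensor_eq_def cvs.span_base)
  show "pure_tensor (u + v) w = pure_tensor u w + pure_tensor v w"
  proof (transfer, rule rel)
    show "Poly_Mapping.single (u + v, w) 1 - Poly_Mapping.single (u, w) 1 - Poly_Mapping.single (v, w) 1 \<in> bilinear_relations"
      for u v and w unfolding bilinear_relations_def by blast
  qed (rule diff_diff_eq)
  show "pure_tensor u (w + x) = pure_tensor u w + pure_tensor u x"
  proof (transfer, rule rel)
    show "Poly_Mapping.single (u, w + x) 1 - Poly_Mapping.single (u, w) 1 - Poly_Mapping.single (u, x) 1 \<in> bilinear_relations"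
      for u and w x unfolding bilinear_relations_def by blast
  qed (rule diff_diff_eq)
  show "pure_tensor (c *\<^sub>C u) w = c *\<^sub>C pure_tensor u w"
  proof (transfer, rule rel)
    show "Poly_Mapping.single (c *\<^sub>C u, w) 1 - c *\<^sub>C Poly_Mapping.single (u, w) 1 \<in> bilinear_relations"
      for c u and w unfolding bilinear_relations_def by blast
  qed (rule refl)
  show "pure_tensor u (c *\<^sub>C w) = c *\<^sub>C pure_tensor u w"
  proof (transfer, rule rel)
    show "Poly_Mapping.single (u, c *\<^sub>C w) 1 - c *\<^sub>C Poly_Mapping.single (u, w) 1 \<in> bilinear_relations"
      for c u and w unfolding bilinear_relations_def by blast
  qed (rule refl)
qed

lemma tensor_map_sum: "tensor_map k (\<Sum>i\<in>I. f i) = (\<Sum>i\<in>I. tensor_map k (f i))"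
proof -
  have "tensor_map k 0 = 0" using tensor_map_linear(2) [of k 0 0] by simp
  then show ?thesis by (induction I rule: infinite_finite_induct) (simp_all add: tensor_map_linear)
qed

definition hom_of :: "(sign list \<Rightarrow> complex) \<Rightarrow> hom_vec" where "hom_of v = (\<lambda>c. c *\<^sub>C v)"

lemma hom_of_linear: "hom_of (u + v) = hom_of u + hom_of v" "hom_of (c *\<^sub>C v) = c *\<^sub>C hom_of v"
  by (simp_all add: hom_of_def fun_eq_iff [where 'b = "sign list \<Rightarrow> complex"] plus_fun_apply scaleC_apply scaleC_add_right scaleC_scaleC mult.commute)

lemma hom_of_1 [simp]: "hom_of v 1 = v"
  by (simp add: hom_of_def scaleC_one)

lemma pure_tensor_hom_of_sum:
  "pure_tensor \<phi> (hom_of (\<Sum>i\<in>I. c i *\<^sub>C f i)) = (\<Sum>i\<in>I. pure_tensor (c i *\<^sub>C \<phi>) (hom_of (f i)))"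
proof -
  have z: "pure_tensor \<phi> (hom_of 0) = 0" using pure_tensor_linear(4) [of \<phi> 0 0] hom_of_linear(2) [of 0 0] by simp
  show ?thesis
    by (induction I rule: infinite_finite_induct) (simp_all add: z hom_of_linear pure_tensor_linear)
qed

context generic_q
begin

lemma H_eq: "H q w = hom_of ` invariants q w"
proof -
  have H: "\<phi> \<in> H q w \<longleftrightarrow> \<phi> 1 \<in> invariants q w \<and> \<phi> = hom_of (\<phi> 1)" for \<phi>
    unfolding H_iff [OF q0 q2] hom_of_def by (auto simp: fun_eq_iff [where 'b = "sign list \<Rightarrow> complex"])
  show ?thesis
  proof (intro equalityI subsetI)
    fix \<phi> assume "\<phi> \<in> H q w"
    then have "\<phi> 1 \<in> invariants q w" "\<phi> = hom_of (\<phi> 1)" by (simp_all only: H)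
    then show "\<phi> \<in> hom_of ` invariants q w" by (intro image_eqI [of _ _ "\<phi> 1"])
  next
    fix \<phi> assume "\<phi> \<in> hom_of ` invariants q w"
    then obtain v where "v \<in> invariants q w" "\<phi> = hom_of v" by (rule imageE)
    then show "\<phi> \<in> H q w" by (simp add: H)
  qed
qed

lemma H_iso_invariants: "H q w \<cong>\<^sub>C invariants q w"
proof -
  have "bij_betw (\<lambda>\<phi>. \<phi> 1) (H q w) (invariants q w)"
    unfolding H_eq by (rule bij_betw_byWitness [where f' = hom_of]) auto
  moreover have "linear_on (H q w) (\<lambda>\<phi>. \<phi> 1)" by (simp add: linear_on_def plus_fun_apply scaleC_apply)
  ultimately show ?thesis unfolding vs_iso_def by blast
qed

lemma subspace_H: "cvs.subspace (H q w)"
  unfolding cvs.subspace_def H_eq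
proof (intro conjI ballI allI)
  show "0 \<in> hom_of ` invariants q w" using hom_of_linear(2) [of 0 0] cvs.subspace_0 [OF subspace_invariants] by (metis cvs.scale_zero_left imageI)
qed (use cvs.subspace_add [OF subspace_invariants] cvs.subspace_scale [OF subspace_invariants] in \<open>auto simp: hom_of_linear [symmetric]\<close>)

lemma h_eq: "h q w = cvs.dim (invariants q w)"
proof -
  have l: "invariants q w \<subseteq> level (length w)" by (auto simp: invariants_def)
  obtain B where B: "finite B" "B \<subseteq> invariants q w" "cvs.independent B" "invariants q w \<subseteq> cvs.span B" "card B = cvs.dim (invariants q w)"
    using l by (rule finite_basis)
  show ?thesis unfolding h_def
    using vs_iso_dim [OF vs_iso_sym [OF H_iso_invariants subspace_H] subspace_invariants B(1-4)] B(5) by simp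
qed

lemma word_iso_invariants:
  assumes "word_iso w w'"
  shows "invariants q w \<cong>\<^sub>C invariants q w'"
proof -
  obtain T where T: "intertwiner w w' T" "bij_betw T (level (length w)) (level (length w'))" using assms by (auto simp: word_iso_def)
  note T' = intertwD [OF T(1)]
  have tr: "T (triv_op g x) = triv_op g (T x)" for g x by (simp add: triv_op_def T'(4))
  have "bij_betw T (invariants q w) (invariants q w')"
  proof (rule bij_betw_imageI)
    show inj: "inj_on T (invariants q w)"
      using T(2) by (auto simp: bij_betw_def invariants_def intro: inj_on_subset)
    show "T ` invariants q w = invariants q w'"
    proof (intro equalityI subsetI)
      fix y assume "y \<in> T ` invariants q w"
      then show "y \<in> invariants q w'" using T'(5,6) by (auto simp: invariants_def tr simp flip: T'(6))
    next
      fix y assume y: "y \<in> invariants q w'"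
      then obtain x where x: "x \<in> level (length w)" "y = T x" using T(2) by (auto simp: invariants_def bij_betw_def)
      have "word_op q w g x = triv_op g x" for g
      proof (rule inj_onD [OF bij_betw_imp_inj_on [OF T(2)]])
        show "T (word_op q w g x) = T (triv_op g x)" using y x by (simp add: T'(6) tr invariants_def)
        show "triv_op g x \<in> level (length w)" using x by (simp add: triv_op_def)
      qed (use x in simp)
      then show "y \<in> T ` invariants q w" using x by (auto simp: invariants_def)
    qed
  qed
  moreover have "linear_on (invariants q w) T" by (simp add: linear_on_def T')
  ultimately show ?thesis unfolding vs_iso_def by blast
qed

text \<open>Over a basis B of the second factor every tensor is a sum of \<open>u b\<close>
  \<otimes> b. In this form injectivity of the tensor map is \<open>juxtapose_independent\<close>
  and surjectivity is the decomposition of invariants.\<close>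

lemma invariants_append:
  assumes far: "\<And>a b. a \<in> set w1 \<Longrightarrow> b \<in> set w2 \<Longrightarrow> b \<ge> a + 4"
  shows "H q w1 \<otimes>\<^sub>C H q w2 \<cong>\<^sub>C invariants q (w1 @ w2)"
    and "cvs.dim (invariants q (w1 @ w2)) = cvs.dim (invariants q w1) * cvs.dim (invariants q w2)"
proof -
  let ?k = "length w1"
  have l: "invariants q w \<subseteq> level (length w)" for w by (auto simp: invariants_def)
  obtain B where B: "finite B" "B \<subseteq> invariants q w2" "cvs.independent B" "invariants q w2 \<subseteq> cvs.span B" "card B = cvs.dim (invariants q w2)"
    using l by (rule finite_basis)
  obtain A where A: "finite A" "A \<subseteq> invariants q w1" "cvs.independent A" "invariants q w1 \<subseteq> cvs.span A" "card A = cvs.dim (invariants q w1)"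
    using l by (rule finite_basis)
  note dec = invariants_append_decompose [OF _ far B(1-4)]
  note I1 = cvs.subspace_0 [OF subspace_invariants] cvs.subspace_add [OF subspace_invariants] cvs.subspace_scale [OF subspace_invariants]
  let ?pt = "\<lambda>u. \<Sum>b\<in>B. pure_tensor (hom_of (u b)) (hom_of b)"
  \<comment> \<open>This normal form of tensors is closed under the vector space operations and
    contains the pure tensors, hence is the whole tensor product.\<close>
  let ?P = "{?pt u |u. \<forall>b\<in>B. u b \<in> invariants q w1}"
  have tm: "tensor_map ?k (?pt u) = (\<Sum>b\<in>B. juxtapose ?k (u b) b)" for u
    by (simp add: tensor_map_sum tensor_map_pure)
  have pt_add: "?pt u + ?pt v = ?pt (\<lambda>b. u b + v b)" and pt_scale: "c *\<^sub>C ?pt u = ?pt (\<lambda>b. c *\<^sub>C u b)" for u v c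
    by (simp_all add: hom_of_linear pure_tensor_linear sum.distrib cvs.scale_sum_right)
  have PI: "?pt u \<in> ?P" if "\<forall>b\<in>B. u b \<in> invariants q w1" for u using that by blast
  have subP: "cvs.subspace ?P"
    unfolding cvs.subspace_def
  proof (intro conjI ballI allI)
    have "?pt (\<lambda>_. 0) \<in> ?P" by (rule PI) (simp add: I1(1))
    moreover have "?pt (\<lambda>_. 0) = 0" using pt_scale [of 0 "\<lambda>_. 0"] by simp
    ultimately show "0 \<in> ?P" by (simp only:)
    fix x assume "x \<in> ?P"
    then obtain u where u: "\<forall>b\<in>B. u b \<in> invariants q w1" "x = ?pt u" by blast
    show "c *\<^sub>C x \<in> ?P" for c
      unfolding u(2) pt_scale by (rule PI) (simp add: u(1) I1(3))
    fix y assume "y \<in> ?P"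
    then obtain v where v: "\<forall>b\<in>B. v b \<in> invariants q w1" "y = ?pt v" by blast
    show "x + y \<in> ?P"
      unfolding u(2) v(2) pt_add by (rule PI) (simp add: u(1) v(1) I1(2))
  qed
  have top_vec: "H q w1 \<otimes>\<^sub>C H q w2 = ?P"
  proof (rule subset_antisym)
    show "H q w1 \<otimes>\<^sub>C H q w2 \<subseteq> ?P"
      unfolding tensor_product_def
    proof (rule cvs.span_minimal [OF _ subP], rule subsetI)
      fix x assume "x \<in> {pure_tensor v w |v w. v \<in> H q w1 \<and> w \<in> H q w2}"
      then obtain u v where uv: "u \<in> invariants q w1" "v \<in> invariants q w2" "x = pure_tensor (hom_of u) (hom_of v)" unfolding H_eq by blast
      obtain c where c: "v = (\<Sum>b\<in>B. c b *\<^sub>C b)" using uv(2) B(4) cvs.span_finite [OF B(1)] by blast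
      have x: "x = ?pt (\<lambda>b. c b *\<^sub>C u)" unfolding uv(3) c pure_tensor_hom_of_sum by (simp add: hom_of_linear)
      show "x \<in> ?P" unfolding x by (rule PI) (simp add: I1(3) [OF uv(1)])
    qed
    show "?P \<subseteq> H q w1 \<otimes>\<^sub>C H q w2"
    proof
      fix x assume "x \<in> ?P"
      then obtain u where u: "\<forall>b\<in>B. u b \<in> invariants q w1" "x = ?pt u" by blast
      show "x \<in> H q w1 \<otimes>\<^sub>C H q w2"
        unfolding u(2) tensor_product_def
      proof (intro cvs.span_sum cvs.span_base)
        fix b assume "b \<in> B"
        then have "hom_of (u b) \<in> H q w1" "hom_of b \<in> H q w2" using u(1) B(2) unfolding H_eq by auto
        then show "pure_tensor (hom_of (u b)) (hom_of b) \<in> {pure_tensor v w |v w. v \<in> H q w1 \<and> w \<in> H q w2}" by blast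
      qed
    qed
  qed
  have "bij_betw (tensor_map ?k) ?P (invariants q (w1 @ w2))"
  proof (rule bij_betw_imageI)
    show "inj_on (tensor_map ?k) ?P"
    proof (rule inj_onI)
      fix x y assume xy: "x \<in> ?P" "y \<in> ?P" "tensor_map ?k x = tensor_map ?k y"
      obtain u where u: "\<forall>b\<in>B. u b \<in> invariants q w1" "x = ?pt u" using xy(1) by blast
      obtain v where v: "\<forall>b\<in>B. v b \<in> invariants q w1" "y = ?pt v" using xy(2) by blast
      have "(\<Sum>b\<in>B. juxtapose ?k (u b - v b) b) = 0"
        using xy(3) unfolding u(2) v(2) tm by (simp add: juxtapose_linear sum_subtractf)
      moreover have "u b - v b \<in> level ?k" if "b \<in> B" for b using that u(1) v(1) l [of w1] by auto
      ultimately have "u b - v b = 0" if "b \<in> B" for b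
        using juxtapose_independent [OF B(1,3), where u = "\<lambda>b. u b - v b"] that by blast
      then show "x = y" unfolding u(2) v(2) by (intro sum.cong) auto
    qed
    show "tensor_map ?k ` ?P = invariants q (w1 @ w2)"
    proof (intro equalityI subsetI)
      fix x assume "x \<in> tensor_map ?k ` ?P"
      then obtain u where u: "\<forall>b\<in>B. u b \<in> invariants q w1" "x = (\<Sum>b\<in>B. juxtapose ?k (u b) b)" using tm by blast
      then show "x \<in> invariants q (w1 @ w2)" using B(2) by (auto intro!: cvs.subspace_sum [OF subspace_invariants] juxtapose_invariants)
    next
      fix x assume "x \<in> invariants q (w1 @ w2)"
      from dec [OF this] obtain u where "\<forall>b\<in>B. u b \<in> invariants q w1" "x = tensor_map ?k (?pt u)" unfolding tm by blast
      then show "x \<in> tensor_map ?k ` ?P" by blast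
    qed
  qed
  moreover have "linear_on ?P (tensor_map ?k)" by (simp add: linear_on_def tensor_map_linear)
  ultimately show "H q w1 \<otimes>\<^sub>C H q w2 \<cong>\<^sub>C invariants q (w1 @ w2)" unfolding top_vec vs_iso_def by blast
  let ?t = "\<lambda>(a, b). juxtapose ?k a b"
  have ind: "c (a, b) = 0" if c: "(\<Sum>p\<in>A \<times> B. c p *\<^sub>C ?t p) = 0" and ab: "a \<in> A" "b \<in> B" for c a b
  proof -
    have "(\<Sum>p\<in>A \<times> B. c p *\<^sub>C ?t p) = (\<Sum>b\<in>B. \<Sum>a\<in>A. c (a, b) *\<^sub>C juxtapose ?k a b)"
      by (subst sum.swap) (simp add: sum.cartesian_product case_prod_unfold)
    also have "\<dots> = (\<Sum>b\<in>B. juxtapose ?k (\<Sum>a\<in>A. c (a, b) *\<^sub>C a) b)" by (simp add: juxtapose_sum juxtapose_linear)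
    finally have "(\<Sum>b\<in>B. juxtapose ?k (\<Sum>a\<in>A. c (a, b) *\<^sub>C a) b) = 0" using c by simp
    moreover have "(\<Sum>a\<in>A. c (a, b) *\<^sub>C a) \<in> level ?k" for b
      using A(2) l [of w1] by (intro cvs.subspace_sum [OF subspace_level] cvs.subspace_scale [OF subspace_level]) auto
    ultimately have "(\<Sum>a\<in>A. c (a, b) *\<^sub>C a) = 0"
      using juxtapose_independent [OF B(1,3), where u = "\<lambda>b. \<Sum>a\<in>A. c (a, b) *\<^sub>C a"] ab(2) by blast
    then show ?thesis using cvs.independentD [OF A(3,1) subset_refl, of "\<lambda>a. c (a, b)" a] ab(1) by simp
  qed
  have inj: "inj_on ?t (A \<times> B)"
  proof (rule inj_onI, rule ccontr)
    fix p r assume pr: "p \<in> A \<times> B" "r \<in> A \<times> B" "?t p = ?t r" "p \<noteq> r"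
    \<comment> \<open>Two distinct pairs with equal juxtaposition would give a vanishing combination
      with coefficients 1 and -1. Distinctness is needed because the basis is an image set and its
      cardinality is counted.\<close>
    let ?c = "\<lambda>s. (if s = p then 1 else 0) - (if s = r then 1 else 0) :: complex"
    have "(\<Sum>s\<in>A \<times> B. ?c s *\<^sub>C ?t s) = (\<Sum>s\<in>A \<times> B. (if s = p then ?t s else 0)) - (\<Sum>s\<in>A \<times> B. (if s = r then ?t s else 0))"
      unfolding sum_subtractf [symmetric] by (rule sum.cong) (auto simp: cvs.scale_left_diff_distrib scaleC_one)
    also have "\<dots> = 0" using pr A(1) B(1) by simp
    finally have z: "(\<Sum>s\<in>A \<times> B. ?c s *\<^sub>C ?t s) = 0" .
    obtain a b where p: "p = (a, b)" "a \<in> A" "b \<in> B" using pr(1) by blast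
    have "?c (a, b) = 0" by (rule ind [OF z p(2,3)])
    then show False using pr(4) p(1) by (simp split: if_splits)
  qed
  have "card (?t ` (A \<times> B)) = cvs.dim (invariants q (w1 @ w2))"
  proof (rule cvs.basis_card_eq_dim)
    show "?t ` (A \<times> B) \<subseteq> invariants q (w1 @ w2)" using A(2) B(2) by (auto intro!: juxtapose_invariants)
    show "cvs.independent (?t ` (A \<times> B))"
    proof (rule cvs.independent_if_scalars_zero)
      fix c x assume s: "(\<Sum>x\<in>?t ` (A \<times> B). c x *\<^sub>C x) = 0" and x: "x \<in> ?t ` (A \<times> B)"
      then obtain a b where ab: "a \<in> A" "b \<in> B" "x = ?t (a, b)" by auto
      have "(\<Sum>p\<in>A \<times> B. c (?t p) *\<^sub>C ?t p) = 0" using s by (simp add: sum.reindex [OF inj])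
      from ind [OF this ab(1,2)] show "c x = 0" using ab(3) by simp
    qed (use A(1) B(1) in simp)
    show "invariants q (w1 @ w2) \<subseteq> cvs.span (?t ` (A \<times> B))"
    proof
      fix x assume "x \<in> invariants q (w1 @ w2)"
      from dec [OF this] obtain u where u: "\<forall>b\<in>B. u b \<in> invariants q w1" "x = (\<Sum>b\<in>B. juxtapose ?k (u b) b)" by blast
      have "juxtapose ?k (u b) b \<in> cvs.span (?t ` (A \<times> B))" if b: "b \<in> B" for b
      proof -
        have "u b \<in> range (\<lambda>c. \<Sum>a\<in>A. c a *\<^sub>C a)" using u(1) b A(4) cvs.span_finite [OF A(1)] by blast
        then obtain c where c: "u b = (\<Sum>a\<in>A. c a *\<^sub>C a)" by blast
        have "juxtapose ?k a b \<in> ?t ` (A \<times> B)" if "a \<in> A" for a using that b by force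
        then show ?thesis unfolding c juxtapose_sum juxtapose_linear by (intro cvs.span_sum cvs.span_scale cvs.span_base)
      qed
      then show "x \<in> cvs.span (?t ` (A \<times> B))" unfolding u(2) by (rule cvs.span_sum)
    qed
  qed
  then show "cvs.dim (invariants q (w1 @ w2)) = cvs.dim (invariants q w1) * cvs.dim (invariants q w2)"
    using A(5) B(5) by (simp add: card_image [OF inj] card_cartesian_product)
qed

lemma vs_iso_dim_invariants:
  assumes "invariants q w \<cong>\<^sub>C invariants q w'"
  shows "cvs.dim (invariants q w) = cvs.dim (invariants q w')"
proof -
  have l: "invariants q w \<subseteq> level (length w)" by (auto simp: invariants_def)
  obtain B where B: "finite B" "B \<subseteq> invariants q w" "cvs.independent B" "invariants q w \<subseteq> cvs.span B" "card B = cvs.dim (invariants q w)"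
    using l by (rule finite_basis)
  show ?thesis using vs_iso_dim [OF assms subspace_invariants B(1-4)] B(5) by simp
qed

end

theorem proposition4p12:
  fixes q :: complex and w1 w2 w :: "int list"
  assumes q_nonzero: "q \<noteq> 0"
    and q_not_root_of_unity: "\<And>n::nat. n > 0 \<Longrightarrow> q ^ n \<noteq> 1"
    and "w1 \<noteq> []" and "w2 \<noteq> []"
    and "\<And>a. a \<in> set w1 \<Longrightarrow> even a" and "\<And>b. b \<in> set w2 \<Longrightarrow> even b"
    and "\<And>a b. a \<in> set w1 \<Longrightarrow> b \<in> set w2 \<Longrightarrow> b \<ge> a + 4"
    and "w \<in> shuffles w1 w2"
  shows "H q w \<cong>\<^sub>C H q w1 \<otimes>\<^sub>C H q w2 \<and> h q w = h q w1 * h q w2"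
proof -
  interpret generic_q q using q_nonzero q_not_root_of_unity by unfold_locales
  have far: "\<And>a b. a \<in> set w1 \<Longrightarrow> b \<in> set w2 \<Longrightarrow> b \<ge> a + 4" by fact
  have "word_iso w (w1 @ w2)" by (rule word_iso_shuffle [OF assms(8)]) (use far in force)
  then have i: "invariants q w \<cong>\<^sub>C invariants q (w1 @ w2)" by (rule word_iso_invariants)
  have "cvs.subspace (H q w1 \<otimes>\<^sub>C H q w2)" by (simp add: tensor_product_def cvs.subspace_span)
  then have "invariants q (w1 @ w2) \<cong>\<^sub>C H q w1 \<otimes>\<^sub>C H q w2" using vs_iso_sym [OF invariants_append(1) [OF far]] by blast
  then have "H q w \<cong>\<^sub>C H q w1 \<otimes>\<^sub>C H q w2"
    by (rule vs_iso_trans [OF vs_iso_trans [OF H_iso_invariants i]])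
  moreover have "h q w = h q w1 * h q w2"
    unfolding h_eq using vs_iso_dim_invariants [OF i] invariants_append(2) [OF far] by simp
  ultimately show ?thesis ..
qed

end
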